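(* Let $1<k\le n$ be integers. The poset $\mathrm{Poset}(\mathrm{PF}_{n,k})$ admits a symmetric chain decomposition.
   Context: A (graded) poset $P$ of height $N$ has a symmetric chain decomposition if its elements can be partitioned into saturated chains such that, for each chain, the ranks of its minimum and maximum elements sum to $N$. The poset $\mathrm{Poset}(\mathrm{PF}_{n,k})$ defined below has height $n$, the rank of a partition being $n+1$ minus its number of blocks. Write $[n]=\{1,\dots,n\}$. A parking function of length $n$ is an $n$-tuple $(a_1,\dots,a_n)$ of positive integers whose weakly increasing rearrangement $b_1\le\dots\le b_n$ satisfies $b_i\le i$ for all $i$; $\mathrm{PF}_n$ is the set of these. For $1<k\le n$, $\mathrm{PF}_{n,k}$ is the set of $a\in\mathrm{PF}_n$ such that $k$ is not an entry of $a$ but each of $k+1,\dots,n$ is an entry of $a$. $\mathrm{NC}_m$ is the lattice of noncrossing partitions of $[m]$ (partitions for which, placing $1,\dots,m$ in clockwise order on a circle, the convex hulls of the blocks are pairwise disjoint), ordered by refinement, with the finer partition being smaller. Each covering relation $\sigma<\tau$ in $\mathrm{NC}_{n+1}$ merges two blocks $B_1,B_2$ of $\sigma$ into one block $B=B_1\cup B_2$ of $\tau$; name them so that $\min B\in B_1$, and label the covering relation by the largest element of $B_1$ that is less than every element of $B_2$. Reading the labels of a maximal chain of $\mathrm{NC}_{n+1}$ from bottom to top gives a parking function of length $n$, and this is a (known) bijection from maximal chains of $\mathrm{NC}_{n+1}$ to $\mathrm{PF}_n$. $\mathrm{Poset}(\mathrm{PF}_{n,k})$ is the poset whose Hasse diagram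 is the union of the maximal chains of $\mathrm{NC}_{n+1}$ corresponding to elements of $\mathrm{PF}_{n,k}$: its elements are the noncrossing partitions lying on at least one of these chains, and its order is the reflexive-transitive closure of the covering relations occurring in these chains (it need not be an induced subposet of $\mathrm{NC}_{n+1}$). *)

theory Defs
  imports "HOL-Analysis.Analysis"
begin

section \<open>Graded posets and symmetric chain decompositions\<close>

text \<open>A poset is given by its carrier \<open>P\<close> and its (reflexive) order relation \<open>r\<close>.\<close>

definition poset_covers :: "'a set \<Rightarrow> ('a \<times> 'a) set \<Rightarrow> 'a \<Rightarrow> 'a \<Rightarrow> bool" where
  "poset_covers P r x y \<longleftrightarrow>
     x \<in> P \<and> y \<in> P \<and> (x, y) \<in> r \<and> x \<noteq> y \<and>
     \<not> (\<exists>z\<in>P. z \<noteq> x \<and> z \<noteq> y \<and> (x, z) \<in> r \<and> (z, y) \<in> r)"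

text \<open>\<open>N\<close> is the height: minimal elements have rank \<open>0\<close>, maximal elements rank \<open>N\<close>.\<close>

definition graded_poset :: "'a set \<Rightarrow> ('a \<times> 'a) set \<Rightarrow> ('a \<Rightarrow> nat) \<Rightarrow> nat \<Rightarrow> bool" where
  "graded_poset P r rk N \<longleftrightarrow>
     finite P \<and> partial_order_on P r \<and>
     (\<forall>x\<in>P. \<forall>y\<in>P. poset_covers P r x y \<longrightarrow> rk y = Suc (rk x)) \<and>
     (\<forall>x\<in>P. (\<forall>y\<in>P. (y, x) \<in> r \<longrightarrow> y = x) \<longrightarrow> rk x = 0) \<and>
     (\<forall>x\<in>P. (\<forall>y\<in>P. (x, y) \<in> r \<longrightarrow> y = x) \<longrightarrow> rk x = N)"

text \<open>A saturated chain is listed from its minimum \<open>hd xs\<close> to its maximum \<open>last xs\<close>.\<close>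

definition symmetric_chain ::
  "'a set \<Rightarrow> ('a \<times> 'a) set \<Rightarrow> ('a \<Rightarrow> nat) \<Rightarrow> nat \<Rightarrow> 'a set \<Rightarrow> bool" where
  "symmetric_chain P r rk N C \<longleftrightarrow>
     (\<exists>xs. xs \<noteq> [] \<and> set xs = C \<and> C \<subseteq> P \<and>
           successively (poset_covers P r) xs \<and>
           rk (hd xs) + rk (last xs) = N)"

definition has_symmetric_chain_decomposition ::
  "'a set \<Rightarrow> ('a \<times> 'a) set \<Rightarrow> ('a \<Rightarrow> nat) \<Rightarrow> nat \<Rightarrow> bool" where
  "has_symmetric_chain_decomposition P r rk N \<longleftrightarrow>
     graded_poset P r rk N \<and>
     (\<exists>D. partition_on P D \<and> (\<forall>C\<in>D. symmetric_chain P r rk N C))"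


section \<open>Parking functions\<close>

text \<open>Tuples are lists; list positions start at \<open>0\<close>, hence the bound \<open>Suc i\<close>.\<close>

definition parking_functions :: "nat \<Rightarrow> nat list set" where
  "parking_functions n =
     {a. length a = n \<and> (\<forall>x\<in>set a. 0 < x) \<and> (\<forall>i<n. sort a ! i \<le> Suc i)}"

definition PF :: "nat \<Rightarrow> nat \<Rightarrow> nat list set" where
  "PF n k = {a \<in> parking_functions n. k \<notin> set a \<and> {k+1..n} \<subseteq> set a}"


section \<open>Noncrossing partitions\<close>

text \<open>The points \<open>1, \<dots>, m\<close> in clockwise order, equally spaced on the unit circle.\<close>

definition circle_point :: "nat \<Rightarrow> nat \<Rightarrow> complex" where
  "circle_point m j = cis (- (2 * pi * real j / real m))"

definition NC :: "nat \<Rightarrow> nat set set set" where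
  "NC m = {\<sigma>. partition_on {1..m} \<sigma> \<and>
     (\<forall>B\<in>\<sigma>. \<forall>B'\<in>\<sigma>. B \<noteq> B' \<longrightarrow>
        convex hull (circle_point m ` B) \<inter> convex hull (circle_point m ` B') = {})}"

text \<open>The order of \<open>NC m\<close> is \<open>refines {1..m}\<close>, the finer partition being smaller. A maximal
  chain is represented by the list of its elements from bottom to top.\<close>

definition NC_maximal_chain :: "nat \<Rightarrow> nat set set list \<Rightarrow> bool" where
  "NC_maximal_chain m c \<longleftrightarrow>
     pred_on.maxchain (NC m) (refines {1..m}) (set c) \<and>
     sorted_wrt (\<lambda>\<sigma> \<tau>. refines {1..m} \<sigma> \<tau> \<and> \<sigma> \<noteq> \<tau>) c"

text \<open>Only meaningful when \<open>\<tau>\<close> covers \<open>\<sigma>\<close>, in which case \<open>B1\<close> and \<open>B2\<close> are uniquely determined.\<close>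

definition cover_label :: "nat set set \<Rightarrow> nat set set \<Rightarrow> nat" where
  "cover_label \<sigma> \<tau> =
     (THE l. \<exists>B1 B2. B1 \<in> \<sigma> \<and> B2 \<in> \<sigma> \<and> B1 \<noteq> B2 \<and>
        \<tau> = insert (B1 \<union> B2) (\<sigma> - {B1, B2}) \<and>
        Min (B1 \<union> B2) \<in> B1 \<and>
        l = Max {x \<in> B1. \<forall>y\<in>B2. x < y})"

definition chain_labels :: "nat set set list \<Rightarrow> nat list" where
  "chain_labels c = map (\<lambda>i. cover_label (c ! i) (c ! Suc i)) [0..<length c - 1]"


section \<open>The poset of a set of parking functions\<close>

text \<open>The definitions make sense for any set \<open>X\<close> of parking functions of length \<open>n\<close>.\<close>

definition chains_of :: "nat \<Rightarrow> nat list set \<Rightarrow> nat set set list set" where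
  "chains_of n X = {c. NC_maximal_chain (n + 1) c \<and> chain_labels c \<in> X}"

definition Poset_carrier :: "nat \<Rightarrow> nat list set \<Rightarrow> nat set set set" where
  "Poset_carrier n X = (\<Union>c\<in>chains_of n X. set c)"

definition Poset_edges :: "nat \<Rightarrow> nat list set \<Rightarrow> (nat set set \<times> nat set set) set" where
  "Poset_edges n X = {(c ! i, c ! Suc i) | c i. c \<in> chains_of n X \<and> Suc i < length c}"

text \<open>\<open>Restr\<close> only discards the reflexive pairs outside the carrier.\<close>

definition Poset_order :: "nat \<Rightarrow> nat list set \<Rightarrow> (nat set set \<times> nat set set) set" where
  "Poset_order n X = Restr ((Poset_edges n X)\<^sup>*) (Poset_carrier n X)"

definition Poset_rank :: "nat \<Rightarrow> nat set set \<Rightarrow> nat" where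
  "Poset_rank n \<sigma> = n + 1 - card \<sigma>"

end

(* A parking function a in PF(n,k) uses each label j > k exactly once and never uses k. In terms of
   the chain, the step that merges a block with minimum m into a block B has a label l < m, and
   every m in {2..n+1} is the minimum lost in exactly one step. Counting downwards from n, the chain
   belongs to PF(n,k) iff m - 1 lies in B whenever m > k + 1, and k does not lie in B when m = k + 1.
   So the poset is the poset of those partitions that lie on a path of such admissible merges.

   For n > k the point n + 1 is either a singleton or joined to n, so each further point multiplies
   the poset by a two-element chain. For n = k the poset splits according to the minima of the blocks
   of k and k + 1, as in the Simion-Ullman decomposition of the noncrossing partition lattice:
     NC(k-1) x (three-element chain),
     NC(j-1) x NC(k-j) x (two-element chain)  for 1 < j < k,
     NC(i-1) x NC(k+1-i)  for 1 < i < k,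
   all centred at the middle rank. Products of symmetric chain orders have symmetric chain
   decompositions, and it suffices that these embeddings map edges to edges. *)
theory Submission
  imports Defs
begin

section \<open>Symmetric chain decompositions of products\<close>

text \<open>The order of the poset need not be the restriction of refinement, so chains have to
  consist of admissible merges, and it must be known which partitions lie on a path at all. Going
  up, a point m > k + 1 ceases to be the minimum of its block only by joining a block that contains
  m - 1, and k + 1 only by joining a block with a minimum below k (\<open>rising\<close>). Towards
  the top there is one further obstruction (\<open>blocked\<close>). Deleting the largest point
  respects both conditions, whereas lying on a path is not visibly inherited. For n = k two families
  drop out of NC(k+1): k is the minimum of the block of k + 1, or k + 1 is a singleton and k lies
  with 1. Each is a copy of NC(k-1) with one block added, hence centred at the middle rank; this is
  why the remainder can still be symmetric. The three-element chain is a square of positions of k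
  and k + 1 that has lost a corner to the second family. Ranks are measured by the number of blocks,
  which falls along an edge: two ranks add up to n exactly when the numbers of blocks add up to n +
  2.\<close>

definition sym_list :: "('a \<Rightarrow> 'a \<Rightarrow> bool) \<Rightarrow> ('a \<Rightarrow> nat) \<Rightarrow> nat \<Rightarrow> 'a list \<Rightarrow> bool" where
  "sym_list E r M xs \<longleftrightarrow>
     xs \<noteq> [] \<and> distinct xs \<and> successively E xs \<and> r (hd xs) + r (last xs) = M"

text \<open>The lists run upwards along edges. \<open>r\<close> stands for a number of blocks and so
  decreases along them, which the lemmas below request as \<open>r x = Suc (r y)\<close>.\<close>

definition sym_dec :: "'a set \<Rightarrow> ('a \<Rightarrow> 'a \<Rightarrow> bool) \<Rightarrow> ('a \<Rightarrow> nat) \<Rightarrow> nat \<Rightarrow> bool" where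
  "sym_dec S E r M \<longleftrightarrow> (\<exists>D. partition_on S D \<and> (\<forall>C\<in>D. \<exists>xs. set xs = C \<and> sym_list E r M xs))"

lemma sym_dec_empty: "sym_dec {} E r M"
  unfolding sym_dec_def by (rule exI[of _ "{}"]) (simp add: partition_on_empty)

lemma sym_dec_list: "sym_list E r M xs \<Longrightarrow> sym_dec (set xs) E r M"
  unfolding sym_dec_def
  by (rule exI[of _ "{set xs}"]) (auto simp: sym_list_def intro!: partition_on_space)

lemma sym_dec_UN:
  assumes "\<And>i. i \<in> I \<Longrightarrow> sym_dec (F i) E r M" and "disjoint_family_on F I"
  shows "sym_dec (\<Union>i\<in>I. F i) E r M"
proof -
  obtain D where D: "\<And>i. i \<in> I \<Longrightarrow> partition_on (F i) (D i)"
    "\<And>i C. i \<in> I \<Longrightarrow> C \<in> D i \<Longrightarrow> \<exists>xs. set xs = C \<and> sym_list E r M xs"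
    using assms(1) unfolding sym_dec_def by metis
  have U: "\<Union>(D i) = F i" if "i \<in> I" for i
    using D(1)[OF that] by (simp add: partition_on_def)
  have "partition_on (\<Union>i\<in>I. F i) (\<Union>i\<in>I. D i)"
  proof (rule partition_onI)
    show "\<Union>(\<Union>i\<in>I. D i) = (\<Union>i\<in>I. F i)"
      using U by blast
    show "{} \<notin> (\<Union>i\<in>I. D i)"
      using D(1) by (auto simp: partition_on_def)
    fix p q assume "p \<in> (\<Union>i\<in>I. D i)" "q \<in> (\<Union>i\<in>I. D i)" "p \<noteq> q"
    then obtain i j where ij: "i \<in> I" "j \<in> I" "p \<in> D i" "q \<in> D j" by auto
    show "disjnt p q"
    proof (cases "i = j")
      case True
      then show ?thesis
        using D(1)[OF ij(1)] ij \<open>p \<noteq> q\<close> by (auto simp: partition_on_def pairwise_def)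
    next
      case False
      then have "F i \<inter> F j = {}"
        using assms(2) ij by (auto simp: disjoint_family_on_def)
      moreover have "p \<subseteq> F i" "q \<subseteq> F j"
        using U ij by blast+
      ultimately show ?thesis
        by (auto simp: disjnt_def)
    qed
  qed
  then show ?thesis
    unfolding sym_dec_def using D(2) by blast
qed

lemma sym_dec_Un:
  assumes "sym_dec S E r M" "sym_dec T E r M" "S \<inter> T = {}"
  shows "sym_dec (S \<union> T) E r M"
  using sym_dec_UN[of "UNIV :: bool set" "\<lambda>b. if b then S else T" E r M] assms
  by (fastforce simp: disjoint_family_on_def UNIV_bool Un_commute)

text \<open>Chains are only pushed forward, so \<open>f\<close> need not reflect edges and the image
  may carry more edges than the source. A piece of the poset thus has to be compared with a product
  in one direction only.\<close>

lemma sym_dec_image: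
  assumes "sym_dec S E r M" and "inj_on f S"
    and hom: "\<And>x y. x \<in> S \<Longrightarrow> y \<in> S \<Longrightarrow> E x y \<Longrightarrow> E' (f x) (f y)"
    and rk: "\<And>x. x \<in> S \<Longrightarrow> r' (f x) = r x"
  shows "sym_dec (f ` S) E' r' M"
proof -
  obtain D where D: "partition_on S D" "\<forall>C\<in>D. \<exists>xs. set xs = C \<and> sym_list E r M xs"
    using assms(1) by (auto simp: sym_dec_def)
  have *: "partition_on (f ` S) ((`) f ` D)"
  proof -
    have "(`) f ` D - {{}} = (`) f ` D"
      using D(1) by (auto simp: partition_on_def)
    then show ?thesis
      using partition_on_inj_image[OF D(1) assms(2)] by simp
  qed
  have "\<exists>ys. set ys = f ` C \<and> sym_list E' r' M ys" if "C \<in> D" for C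
  proof -
    obtain xs where xs: "set xs = C" "sym_list E r M xs"
      using D(2) \<open>C \<in> D\<close> by blast
    have CS: "C \<subseteq> S"
      using D(1) \<open>C \<in> D\<close> by (auto simp: partition_on_def)
    have ne: "xs \<noteq> []" using xs(2) by (simp add: sym_list_def)
    have "successively (\<lambda>x y. E' (f x) (f y)) xs"
      by (rule successively_mono[of E]) (use xs CS hom in \<open>auto simp: sym_list_def\<close>)
    moreover have "inj_on f (set xs)"
      using assms(2) CS xs(1) inj_on_subset by blast
    moreover have "hd xs \<in> S" "last xs \<in> S"
      using ne CS xs(1) by auto
    ultimately have "sym_list E' r' M (map f xs)"
      using xs(2) rk by (auto simp: sym_list_def successively_map distinct_map hd_map last_map)
    then show ?thesis
      using xs(1) by (intro exI[of _ "map f xs"]) auto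
  qed
  then show ?thesis
    unfolding sym_dec_def using * by blast
qed

definition prod_edge :: "('a \<Rightarrow> 'a \<Rightarrow> bool) \<Rightarrow> ('b \<Rightarrow> 'b \<Rightarrow> bool) \<Rightarrow> 'a \<times> 'b \<Rightarrow> 'a \<times> 'b \<Rightarrow> bool" where
  "prod_edge E F p q \<longleftrightarrow>
     (E (fst p) (fst q) \<and> snd p = snd q) \<or> (fst p = fst q \<and> F (snd p) (snd q))"

text \<open>Peeling the hook along the bottom and the right side off a grid leaves a smaller grid
  with the same centre.\<close>

lemma sym_dec_grid:
  fixes r :: "'a \<Rightarrow> nat" and q :: "'b \<Rightarrow> nat"
  assumes "xs \<noteq> []" "ys \<noteq> []" "distinct xs" "distinct ys"
    and "successively E xs" "successively F ys"
    and "\<And>x y. E x y \<Longrightarrow> r x = Suc (r y)" "\<And>x y. F x y \<Longrightarrow> q x = Suc (q y)"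
    and "r (hd xs) + r (last xs) + (q (hd ys) + q (last ys)) = M"
  shows "sym_dec (set xs \<times> set ys) (prod_edge E F) (\<lambda>p. r (fst p) + q (snd p)) M"
  using assms
proof (induction ys arbitrary: xs)
  case Nil
  then show ?case by simp
next
  case (Cons y ys)
  obtain xs' x where xs: "xs = xs' @ [x]"
    using Cons.prems(1) by (cases xs rule: rev_cases) auto
  define h where "h = map (\<lambda>u. (u, y)) xs @ map (\<lambda>v. (x, v)) ys"
  have succ_ys: "successively F ys" and y_hd: "ys \<noteq> [] \<Longrightarrow> F y (hd ys)"
    using Cons.prems(6) by (auto simp: successively_Cons)
  have succ_xs: "successively E xs'" and x_last: "xs' \<noteq> [] \<Longrightarrow> E (last xs') x"
    using Cons.prems(5) by (auto simp: xs successively_append_iff)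
  have "sym_list (prod_edge E F) (\<lambda>p. r (fst p) + q (snd p)) M h"
    unfolding sym_list_def
  proof (intro conjI)
    show "h \<noteq> []" using Cons.prems(1) by (simp add: h_def)
    show "distinct h"
      using Cons.prems(3,4) by (auto simp: h_def distinct_map inj_on_def)
    have "successively (prod_edge E F) (map (\<lambda>u. (u, y)) xs)"
      unfolding successively_map
      by (rule successively_mono[OF Cons.prems(5)]) (simp add: prod_edge_def)
    moreover have "successively (prod_edge E F) (map (\<lambda>v. (x, v)) ys)"
      unfolding successively_map by (rule successively_mono[OF succ_ys]) (simp add: prod_edge_def)
    ultimately show "successively (prod_edge E F) h"
      using y_hd unfolding h_def successively_append_iff
      by (auto simp: xs hd_map prod_edge_def)
    show "r (fst (hd h)) + q (snd (hd h)) + (r (fst (last h)) + q (snd (last h))) = M"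
      using Cons.prems(1,9) by (auto simp: h_def hd_append last_map hd_map xs split: if_splits)
  qed
  then have hook: "sym_dec (set h) (prod_edge E F) (\<lambda>p. r (fst p) + q (snd p)) M"
    by (rule sym_dec_list)
  have rest: "sym_dec (set xs' \<times> set ys) (prod_edge E F) (\<lambda>p. r (fst p) + q (snd p)) M"
  proof (cases "xs' = [] \<or> ys = []")
    case True
    then show ?thesis using sym_dec_empty by auto
  next
    case False
    \<comment> \<open>Cutting off the last entry of \<open>xs\<close> and the first entry of
      \<open>y # ys\<close> changes the sum of the four ranks by 1 and by -1, so the smaller grid
      keeps the constant \<open>M\<close>.\<close>
    have "r (last xs') = Suc (r x)" "q y = Suc (q (hd ys))"
      using Cons.prems(7)[OF x_last] Cons.prems(8)[OF y_hd] False by auto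
    then show ?thesis
      using False Cons.prems succ_ys succ_xs
      by (intro Cons.IH) (auto simp: xs)
  qed
  have "set xs \<times> set (y # ys) = set h \<union> set xs' \<times> set ys"
    by (auto simp: h_def xs)
  moreover have "set h \<inter> set xs' \<times> set ys = {}"
    using Cons.prems(3,4) by (auto simp: h_def xs)
  ultimately show ?case
    using sym_dec_Un[OF hook rest] by simp
qed

lemma sym_dec_prod:
  assumes "sym_dec S E r M" "sym_dec T F q N"
    and "\<And>x y. E x y \<Longrightarrow> r x = Suc (r y)" "\<And>x y. F x y \<Longrightarrow> q x = Suc (q y)"
  shows "sym_dec (S \<times> T) (prod_edge E F) (\<lambda>p. r (fst p) + q (snd p)) (M + N)"
proof -
  obtain D where D: "partition_on S D" "\<forall>C\<in>D. \<exists>xs. set xs = C \<and> sym_list E r M xs"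
    using assms(1) by (auto simp: sym_dec_def)
  obtain D' where D': "partition_on T D'" "\<forall>C\<in>D'. \<exists>xs. set xs = C \<and> sym_list F q N xs"
    using assms(2) by (auto simp: sym_dec_def)
  have "sym_dec (\<Union>(C, C')\<in>D \<times> D'. C \<times> C') (prod_edge E F) (\<lambda>p. r (fst p) + q (snd p)) (M + N)"
  proof (rule sym_dec_UN, goal_cases)
    case (1 i)
    then obtain C C' where i: "i = (C, C')" "C \<in> D" "C' \<in> D'" by auto
    obtain xs ys where "set xs = C" "sym_list E r M xs" "set ys = C'" "sym_list F q N ys"
      using D(2) D'(2) i by meson
    then show ?case
      using sym_dec_grid[of xs ys E F r q "M + N"] assms(3,4) i by (auto simp: sym_list_def)
  next
    case 2
    have "disjoint D" "disjoint D'" using D(1) D'(1) by (auto simp: partition_on_def)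
    then have "C = C''" if "C \<in> D" "C'' \<in> D" "x \<in> C" "x \<in> C''" for C C'' x
      using that by (auto simp: pairwise_def disjnt_def)
    moreover have "C = C''" if "C \<in> D'" "C'' \<in> D'" "x \<in> C" "x \<in> C''" for C C'' x
      using that \<open>disjoint D'\<close> by (auto simp: pairwise_def disjnt_def)
    ultimately show ?case
      unfolding disjoint_family_on_def by (force simp: disjoint_iff)
  qed
  moreover have "(\<Union>(C, C')\<in>D \<times> D'. C \<times> C') = S \<times> T"
    using D(1) D'(1) by (auto simp: partition_on_def)
  ultimately show ?thesis by simp
qed

text \<open>This is the product with a chain of \<open>l + 1\<close> elements, presented by its
  layers \<open>f i\<close>; the edges between consecutive layers come from the second factor. Layer
  \<open>i\<close> carries \<open>l - i\<close> additional blocks because block counts fall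
  upwards.\<close>

lemma sym_dec_layers:
  fixes r :: "'a \<Rightarrow> nat" and f :: "nat \<Rightarrow> 'a \<Rightarrow> 'b"
  assumes "sym_dec S E r M" and "\<And>x y. E x y \<Longrightarrow> r x = Suc (r y)"
    and "\<And>i x y. i \<le> l \<Longrightarrow> x \<in> S \<Longrightarrow> y \<in> S \<Longrightarrow> E x y \<Longrightarrow> E' (f i x) (f i y)"
    and "\<And>i x. i < l \<Longrightarrow> x \<in> S \<Longrightarrow> E' (f i x) (f (Suc i) x)"
    and "\<And>i j x y. i \<le> l \<Longrightarrow> j \<le> l \<Longrightarrow> x \<in> S \<Longrightarrow> y \<in> S \<Longrightarrow> f i x = f j y \<Longrightarrow> i = j \<and> x = y"
    and "\<And>i x. i \<le> l \<Longrightarrow> x \<in> S \<Longrightarrow> r' (f i x) = r x + (l - i)"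
  shows "sym_dec (\<Union>i\<le>l. f i ` S) E' r' (M + l)"
proof -
  define F where "F = (\<lambda>i j. j = Suc i \<and> j \<le> l)"
  have "successively F [0..<Suc l]"
    unfolding successively_conv_nth by (auto simp: F_def simp del: upt_Suc)
  then have "sym_list F (\<lambda>i. l - i) l [0..<Suc l]"
    by (auto simp: sym_list_def hd_append)
  from sym_dec_list[OF this] have "sym_dec {..l} F (\<lambda>i. l - i) l"
    by (simp add: atMost_atLeast0 atLeastLessThanSuc_atLeastAtMost del: upt_Suc)
  from sym_dec_prod[OF assms(1) this assms(2)]
  have "sym_dec (S \<times> {..l}) (prod_edge E F) (\<lambda>p. r (fst p) + (l - snd p)) (M + l)"
    by (auto simp: F_def)
  then have "sym_dec ((\<lambda>p. f (snd p) (fst p)) ` (S \<times> {..l})) E' r' (M + l)"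
  proof (rule sym_dec_image)
    show "inj_on (\<lambda>p. f (snd p) (fst p)) (S \<times> {..l})"
      using assms(5) by (auto simp: inj_on_def)
  qed (use assms(3,4,6) in \<open>auto simp: prod_edge_def F_def\<close>)
  moreover have "(\<lambda>p. f (snd p) (fst p)) ` (S \<times> {..l}) = (\<Union>i\<le>l. f i ` S)"
    by (force simp: image_iff)
  ultimately show ?thesis by simp
qed

section \<open>Noncrossing partitions\<close>

text \<open>The ground set is arbitrary because the inductions cut it into the points below a given
  one and the others. The single pattern a < b < c < d suffices, as the two blocks may be exchanged.
  \<open>NC_eq_nc\<close> links this to the geometric definition.\<close>

definition nc :: "nat set \<Rightarrow> nat set set set" where
  "nc A = {\<sigma>. partition_on A \<sigma> \<and>
     (\<forall>B\<in>\<sigma>. \<forall>C\<in>\<sigma>. \<forall>a\<in>B. \<forall>c\<in>B. \<forall>b\<in>C. \<forall>d\<in>C. a < b \<longrightarrow> b < c \<longrightarrow> c < d \<longrightarrow> B = C)}"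

definition blk :: "nat set set \<Rightarrow> nat \<Rightarrow> nat set" where
  "blk \<sigma> x = (THE B. B \<in> \<sigma> \<and> x \<in> B)"

definition bmin :: "nat set set \<Rightarrow> nat \<Rightarrow> nat" where
  "bmin \<sigma> x = Min (blk \<sigma> x)"

definition ins :: "nat \<Rightarrow> nat \<Rightarrow> nat set set \<Rightarrow> nat set set" where
  "ins i x \<sigma> = (\<lambda>B. if i \<in> B then insert x B else B) ` \<sigma>"

lemma nc_noncrossing:
  assumes "\<sigma> \<in> nc A" "B \<in> \<sigma>" "C \<in> \<sigma>" "a \<in> B" "c \<in> B" "b \<in> C" "d \<in> C" "a < b" "b < c" "c < d"
  shows "B = C"
  using assms unfolding nc_def by blast

lemma nc_Union: "\<sigma> \<in> nc A \<Longrightarrow> \<Union>\<sigma> = A"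
  by (simp add: nc_def partition_on_def)

lemma nc_nonempty: "\<sigma> \<in> nc A \<Longrightarrow> B \<in> \<sigma> \<Longrightarrow> B \<noteq> {}"
  by (auto simp: nc_def partition_on_def)

lemma nc_subset: "\<sigma> \<in> nc A \<Longrightarrow> B \<in> \<sigma> \<Longrightarrow> B \<subseteq> A"
  using nc_Union by blast

lemma nc_unique: "\<sigma> \<in> nc A \<Longrightarrow> B \<in> \<sigma> \<Longrightarrow> C \<in> \<sigma> \<Longrightarrow> x \<in> B \<Longrightarrow> x \<in> C \<Longrightarrow> B = C"
  by (auto simp: nc_def partition_on_def pairwise_def disjnt_def)

lemma nc_finite: "finite A \<Longrightarrow> \<sigma> \<in> nc A \<Longrightarrow> finite \<sigma>"
  by (rule finite_elements) (auto simp: nc_def)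

lemma nc_finite_block: "finite A \<Longrightarrow> \<sigma> \<in> nc A \<Longrightarrow> B \<in> \<sigma> \<Longrightarrow> finite B"
  by (rule finite_subset[OF nc_subset])

lemma nc_partition_on: "\<sigma> \<in> nc A \<Longrightarrow> partition_on A \<sigma>"
  by (simp add: nc_def)

lemma ncI:
  assumes "\<Union>\<sigma> = A" "\<And>B. B \<in> \<sigma> \<Longrightarrow> B \<noteq> {}"
    and "\<And>B C x. B \<in> \<sigma> \<Longrightarrow> C \<in> \<sigma> \<Longrightarrow> x \<in> B \<Longrightarrow> x \<in> C \<Longrightarrow> B = C"
    and "\<And>B C a b c d. B \<in> \<sigma> \<Longrightarrow> C \<in> \<sigma> \<Longrightarrow> a \<in> B \<Longrightarrow> c \<in> B \<Longrightarrow> b \<in> C \<Longrightarrow> d \<in> C \<Longrightarrow>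
      a < b \<Longrightarrow> b < c \<Longrightarrow> c < d \<Longrightarrow> B = C"
  shows "\<sigma> \<in> nc A"
proof -
  have "partition_on A \<sigma>"
    by (rule partition_onI) (use assms(1-3) in \<open>auto simp: disjnt_def\<close>)
  then show ?thesis
    unfolding nc_def using assms(4) by blast
qed

lemma blk_eq: "\<sigma> \<in> nc A \<Longrightarrow> B \<in> \<sigma> \<Longrightarrow> x \<in> B \<Longrightarrow> blk \<sigma> x = B"
  unfolding blk_def by (rule the_equality) (auto dest: nc_unique)

lemma blk_in: "\<sigma> \<in> nc A \<Longrightarrow> x \<in> A \<Longrightarrow> blk \<sigma> x \<in> \<sigma>"
  and blk_mem: "\<sigma> \<in> nc A \<Longrightarrow> x \<in> A \<Longrightarrow> x \<in> blk \<sigma> x"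
  by (metis UnionE blk_eq nc_Union)+

lemma nc_finite_blk: "finite A \<Longrightarrow> \<sigma> \<in> nc A \<Longrightarrow> x \<in> A \<Longrightarrow> finite (blk \<sigma> x)"
  by (rule nc_finite_block[OF _ _ blk_in])

lemma bmin_le: "finite A \<Longrightarrow> \<sigma> \<in> nc A \<Longrightarrow> x \<in> A \<Longrightarrow> bmin \<sigma> x \<le> x"
  unfolding bmin_def by (rule Min_le) (auto simp: nc_finite_blk blk_mem)

lemma bmin_in_blk: "finite A \<Longrightarrow> \<sigma> \<in> nc A \<Longrightarrow> x \<in> A \<Longrightarrow> bmin \<sigma> x \<in> blk \<sigma> x"
  unfolding bmin_def by (rule Min_in) (use nc_finite_blk blk_mem in blast)+

lemma bmin_in: "finite A \<Longrightarrow> \<sigma> \<in> nc A \<Longrightarrow> x \<in> A \<Longrightarrow> bmin \<sigma> x \<in> A"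
  by (rule subsetD[OF nc_subset[OF _ blk_in] bmin_in_blk])

lemma nc_empty: "nc {} = {{}}"
  by (auto simp: nc_def partition_on_empty)

section \<open>Extending, gluing and cutting noncrossing partitions\<close>

lemma nc_insert_single:
  assumes "\<sigma> \<in> nc A" "x \<notin> A"
  shows "insert {x} \<sigma> \<in> nc (insert x A)"
proof (rule ncI)
  show "\<Union>(insert {x} \<sigma>) = insert x A"
    using nc_Union[OF assms(1)] by auto
  show "B \<noteq> {}" if "B \<in> insert {x} \<sigma>" for B
    using that nc_nonempty[OF assms(1)] by auto
  show "B = C" if "B \<in> insert {x} \<sigma>" "C \<in> insert {x} \<sigma>" "y \<in> B" "y \<in> C" for B C y
    using that nc_unique[OF assms(1)] nc_subset[OF assms(1)] assms(2) by blast
  show "B = C" if "B \<in> insert {x} \<sigma>" "C \<in> insert {x} \<sigma>" "a \<in> B" "c \<in> B" "b \<in> C" "d \<in> C"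
    "a < b" "b < c" "c < d" for B C a b c d
    using that nc_noncrossing[OF assms(1), of B C a c b d] by auto
qed

text \<open>The point \<open>x\<close> comes after all of \<open>A\<close>, and \<open>i\<close> is
  the first or the last point of \<open>A\<close>. So \<open>i\<close> and \<open>x\<close> are
  neighbours on the circle and no block can separate them.\<close>

lemma nc_ins:
  assumes "\<sigma> \<in> nc A" "i \<in> A" "\<forall>y\<in>A. y < x" "(\<forall>y\<in>A. i \<le> y) \<or> (\<forall>y\<in>A. y \<le> i)"
  shows "ins i x \<sigma> \<in> nc (insert x A)"
proof (rule ncI)
  let ?g = "\<lambda>B. if i \<in> B then insert x B else B"
  have xA: "x \<notin> A" using assms(3) by auto
  have xB: "x \<notin> B" if "B \<in> \<sigma>" for B
    using that nc_subset[OF assms(1)] xA by blast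
  show "\<Union>(ins i x \<sigma>) = insert x A"
    using nc_Union[OF assms(1)] assms(2) by (fastforce simp: ins_def split: if_splits)
  show "B \<noteq> {}" if "B \<in> ins i x \<sigma>" for B
    using that nc_nonempty[OF assms(1)] by (auto simp: ins_def split: if_splits)
  show "B = C" if "B \<in> ins i x \<sigma>" "C \<in> ins i x \<sigma>" "y \<in> B" "y \<in> C" for B C y
    using that nc_unique[OF assms(1)] xB by (auto simp: ins_def split: if_splits)
  show "B = C" if hyp: "B \<in> ins i x \<sigma>" "C \<in> ins i x \<sigma>" "a \<in> B" "c \<in> B" "b \<in> C" "d \<in> C"
    "a < b" "b < c" "c < d" for B C a b c d
  proof -
    obtain B' C' where BC: "B' \<in> \<sigma>" "B = ?g B'" "C' \<in> \<sigma>" "C = ?g C'"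
      using hyp(1,2) by (auto simp: ins_def)
    have "d \<le> x"
      using hyp BC nc_subset[OF assms(1), of C'] assms(3) by (force split: if_splits)
    then have abc: "a \<in> B'" "b \<in> C'" "c \<in> B'"
      using hyp BC by (auto split: if_splits)
    have "B' = C'"
    proof (cases "d = x")
      case False
      then have "d \<in> C'" using hyp BC by (auto split: if_splits)
      then show ?thesis
        using nc_noncrossing[OF assms(1) BC(1,3) abc(1,3,2)] hyp by blast
    next
      case True
      \<comment> \<open>In a crossing that uses \<open>x\<close>, the point \<open>i\<close> of the
        same block takes its place: before \<open>a\<close> if \<open>i\<close> is the least point,
        after \<open>c\<close> if it is the greatest.\<close>
      then have iC: "i \<in> C'"
        using hyp(6) BC xB[of C'] by (auto split: if_splits)
      have "a \<in> A" "c \<in> A" using abc BC nc_subset[OF assms(1)] by blast+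
      then have "i \<le> a \<or> c \<le> i" using assms(4) by auto
      then consider "i < a" | "i = a" | "i = c" | "c < i" by linarith
      then show ?thesis
      proof cases
        case 1
        then show ?thesis
          using nc_noncrossing[OF assms(1) BC(3,1) iC abc(2,1,3)] hyp by blast
      next
        case 4
        then show ?thesis
          using nc_noncrossing[OF assms(1) BC(1,3) abc(1,3,2) iC] hyp by blast
      qed (use nc_unique[OF assms(1) BC(1,3)] abc iC in blast)+
    qed
    then show ?thesis using BC by simp
  qed
qed

lemma nc_Un:
  assumes "\<sigma> \<in> nc A" "\<tau> \<in> nc B" "\<forall>a\<in>A. \<forall>b\<in>B. a < b"
  shows "\<sigma> \<union> \<tau> \<in> nc (A \<union> B)"
proof (rule ncI)
  show "\<Union>(\<sigma> \<union> \<tau>) = A \<union> B"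
    using nc_Union assms by blast
  show "C \<noteq> {}" if "C \<in> \<sigma> \<union> \<tau>" for C
    using that nc_nonempty assms by blast
  have sub: "x \<in> A" if "C \<in> \<sigma>" "x \<in> C" for C x using that nc_subset assms by blast
  have sub': "x \<in> B" if "C \<in> \<tau>" "x \<in> C" for C x using that nc_subset assms by blast
  have less: "x < y" if "C \<in> \<sigma>" "x \<in> C" "D \<in> \<tau>" "y \<in> D" for C D x y
    using sub[OF that(1,2)] sub'[OF that(3,4)] assms(3) by simp
  show "C = D" if "C \<in> \<sigma> \<union> \<tau>" "D \<in> \<sigma> \<union> \<tau>" "x \<in> C" "x \<in> D" for C D x
    using that nc_unique[OF assms(1), of C D x] nc_unique[OF assms(2), of C D x]
      less[of C x D x] less[of D x C x] by auto
  show "C = D" if "C \<in> \<sigma> \<union> \<tau>" "D \<in> \<sigma> \<union> \<tau>" "a \<in> C" "c \<in> C" "b \<in> D" "d \<in> D"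
    "a < b" "b < c" "c < d" for C D a b c d
    using that nc_noncrossing[OF assms(1), of C D a c b d] nc_noncrossing[OF assms(2), of C D a c b d]
      less[of C c D b] less[of D b C a] by auto
qed

lemma nc_blocks_within:
  assumes "\<sigma> \<in> nc A" "A' \<subseteq> A" "\<And>B. B \<in> \<sigma> \<Longrightarrow> B \<subseteq> A' \<or> B \<inter> A' = {}"
  shows "{B \<in> \<sigma>. B \<subseteq> A'} \<in> nc A'"
proof (rule ncI)
  show "\<Union>{B \<in> \<sigma>. B \<subseteq> A'} = A'"
    using nc_Union[OF assms(1)] assms(2,3) by blast
  show "B = C" if "B \<in> {B \<in> \<sigma>. B \<subseteq> A'}" "C \<in> {B \<in> \<sigma>. B \<subseteq> A'}" "a \<in> B" "c \<in> B" "b \<in> C" "d \<in> C"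
    "a < b" "b < c" "c < d" for B C a b c d
    using that nc_noncrossing[OF assms(1), of B C a c b d] by simp
qed (use nc_nonempty[OF assms(1)] nc_unique[OF assms(1)] in blast)+

lemma nc_remove:
  assumes "\<sigma> \<in> nc (insert x A)" "x \<notin> A" "{x} \<notin> \<sigma>"
  shows "(\<lambda>B. B - {x}) ` \<sigma> \<in> nc A"
proof (rule ncI)
  show "\<Union>((\<lambda>B. B - {x}) ` \<sigma>) = A"
    using nc_Union[OF assms(1)] assms(2) by auto
  show "B \<noteq> {}" if "B \<in> (\<lambda>B. B - {x}) ` \<sigma>" for B
    using that assms(3) nc_nonempty[OF assms(1)]
    by (auto simp: subset_singleton_iff)
  show "B = C" if "B \<in> (\<lambda>B. B - {x}) ` \<sigma>" "C \<in> (\<lambda>B. B - {x}) ` \<sigma>" "y \<in> B" "y \<in> C" for B C y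
    using that nc_unique[OF assms(1)] by blast
  show "B = C" if hyp: "B \<in> (\<lambda>B. B - {x}) ` \<sigma>" "C \<in> (\<lambda>B. B - {x}) ` \<sigma>"
    "a \<in> B" "c \<in> B" "b \<in> C" "d \<in> C" "a < b" "b < c" "c < d" for B C a b c d
  proof -
    obtain B' C' where "B' \<in> \<sigma>" "C' \<in> \<sigma>" "B = B' - {x}" "C = C' - {x}"
      using hyp by auto
    then show ?thesis
      using hyp nc_noncrossing[OF assms(1), of B' C' a c b d] by auto
  qed
qed

lemma nc_top: "A \<noteq> {} \<Longrightarrow> {A} \<in> nc A"
  by (rule ncI) auto

lemma nc_singletons: "(\<lambda>x. {x}) ` A \<in> nc A"
  by (rule ncI) auto

text \<open>Let \<open>i\<close> be the minimum of the block of the largest point \<open>x\<close>.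
  A block with points on both sides of \<open>i\<close> would cross that block, as it would have a <
  i < c < x. Hence the partition splits at \<open>i\<close>, and deleting \<open>x\<close> leaves an
  arbitrary noncrossing partition of the upper half.\<close>

lemma nc_insert_cases:
  assumes "\<sigma> \<in> nc (insert x A)" "\<forall>y\<in>A. y < x" "finite A"
  obtains (single) "bmin \<sigma> x = x" "\<sigma> - {{x}} \<in> nc A" "\<sigma> = insert {x} (\<sigma> - {{x}})"
  | (join) i \<sigma>1 \<sigma>2 where "bmin \<sigma> x = i" "i \<in> A" "\<sigma>1 \<in> nc (A \<inter> {..<i})"
      "\<sigma>2 \<in> nc (A \<inter> {i..})" "\<sigma> = \<sigma>1 \<union> ins i x \<sigma>2"
proof -
  let ?B = "blk \<sigma> x" and ?i = "bmin \<sigma> x"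
  have xA: "x \<notin> A" using assms(2) by auto
  have B: "?B \<in> \<sigma>" "x \<in> ?B" using assms(1) by (auto intro: blk_in blk_mem)
  have fin: "finite ?B" using assms nc_finite_blk[of "insert x A"] by auto
  have iB: "?i \<in> ?B" "\<And>y. y \<in> ?B \<Longrightarrow> ?i \<le> y"
    using assms bmin_in_blk[of "insert x A"] fin by (auto simp: bmin_def)
  show thesis
  proof (cases "?i = x")
    case True
    have "?B \<subseteq> {x}"
      using iB(2) True nc_subset[OF assms(1) B(1)] assms(2) by force
    then have eq: "{x} \<in> \<sigma>" using B by (metis insert_subset subset_antisym empty_subsetI)
    have "\<sigma> - {{x}} = {B \<in> \<sigma>. B \<subseteq> A}"
      using xA nc_subset[OF assms(1)] nc_unique[OF assms(1) eq] by blast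
    moreover have "{B \<in> \<sigma>. B \<subseteq> A} \<in> nc A"
      by (rule nc_blocks_within[OF assms(1)])
        (use nc_subset[OF assms(1)] nc_unique[OF assms(1) eq] xA in blast)+
    ultimately show thesis using single True eq by auto
  next
    case False
    then have iA: "?i \<in> A" using bmin_in[OF _ assms(1), of x] assms(3) by auto
    have ix: "?i < x" using iA assms(2) by auto
    have dich: "C \<subseteq> {..<?i} \<or> C \<subseteq> {?i..}" if "C \<in> \<sigma>" for C
    proof (rule ccontr)
      assume "\<not> (C \<subseteq> {..<?i} \<or> C \<subseteq> {?i..})"
      then obtain a c where ac: "a \<in> C" "c \<in> C" "a < ?i" "?i \<le> c" by force
      have neq: "C \<noteq> ?B" using ac iB by force
      then have "c \<noteq> ?i" "c \<noteq> x"
        using nc_unique[OF assms(1) that B(1)] ac iB B by blast+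
      moreover have "c \<le> x" using ac that nc_subset[OF assms(1)] assms(2) by force
      ultimately show False
        using nc_noncrossing[OF assms(1) that B(1) ac(1,2) iB(1) B(2)] ac neq by linarith
    qed
    have within: "C \<subseteq> A \<inter> {..<?i} \<or> C \<subseteq> insert x (A \<inter> {?i..})" if "C \<in> \<sigma>" for C
      using dich[OF that]
    proof
      assume *: "C \<subseteq> {..<?i}"
      then have "x \<notin> C" using ix by auto
      then show ?thesis using * nc_subset[OF assms(1) that] by blast
    qed (use nc_subset[OF assms(1) that] in blast)
    have disj: "(A \<inter> {..<?i}) \<inter> insert x (A \<inter> {?i..}) = {}" using xA by auto
    define \<sigma>1 where "\<sigma>1 = {C \<in> \<sigma>. C \<subseteq> A \<inter> {..<?i}}"
    define \<rho> where "\<rho> = {C \<in> \<sigma>. C \<subseteq> insert x (A \<inter> {?i..})}"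
    have s1: "\<sigma>1 \<in> nc (A \<inter> {..<?i})"
      unfolding \<sigma>1_def by (rule nc_blocks_within[OF assms(1)]) (use within disj in blast)+
    have r: "\<rho> \<in> nc (insert x (A \<inter> {?i..}))"
      unfolding \<rho>_def by (rule nc_blocks_within[OF assms(1)]) (use within disj in blast)+
    have xr: "{x} \<notin> \<rho>"
    proof
      assume "{x} \<in> \<rho>"
      then have "?B = {x}"
        using nc_unique[OF assms(1) _ B(1), of "{x}" x] B by (auto simp: \<rho>_def)
      then show False using iB(1) False by blast
    qed
    have s2: "(\<lambda>B. B - {x}) ` \<rho> \<in> nc (A \<inter> {?i..})"
      using nc_remove[OF r _ xr] xA by simp
    have split: "\<sigma> = \<sigma>1 \<union> \<rho>"
      using within by (auto simp: \<sigma>1_def \<rho>_def)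
    have "(if ?i \<in> C - {x} then insert x (C - {x}) else C - {x}) = C" if "C \<in> \<rho>" for C
    proof (cases "C = ?B")
      case True
      then show ?thesis using iB ix B by auto
    next
      case False
      then have "x \<notin> C" "?i \<notin> C"
        using that nc_unique[OF assms(1) _ B(1)] B iB by (auto simp: \<rho>_def)
      then show ?thesis by auto
    qed
    then have eq: "ins ?i x ((\<lambda>B. B - {x}) ` \<rho>) = \<rho>"
      unfolding ins_def image_image by simp
    show thesis
      by (rule join[OF refl iA s1 s2]) (subst eq, rule split)
  qed
qed

section \<open>Blocks, minima and block counts of the constructed partitions\<close>

lemma blk_insert_single:
  assumes "\<sigma> \<in> nc A" "x \<notin> A"
  shows "blk (insert {x} \<sigma>) x = {x}" "y \<in> A \<Longrightarrow> blk (insert {x} \<sigma>) y = blk \<sigma> y"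
  using blk_eq[OF nc_insert_single[OF assms]] blk_in[OF assms(1)] blk_mem[OF assms(1)] by auto

lemma blk_Un:
  assumes "\<sigma> \<in> nc A" "\<tau> \<in> nc B" "\<forall>a\<in>A. \<forall>b\<in>B. a < b"
  shows "y \<in> A \<Longrightarrow> blk (\<sigma> \<union> \<tau>) y = blk \<sigma> y" "y \<in> B \<Longrightarrow> blk (\<sigma> \<union> \<tau>) y = blk \<tau> y"
  using blk_eq[OF nc_Un[OF assms]] blk_in[OF assms(1)] blk_mem[OF assms(1)]
    blk_in[OF assms(2)] blk_mem[OF assms(2)] by auto

lemma blk_ins:
  assumes "\<sigma> \<in> nc A" "i \<in> A" "\<forall>y\<in>A. y < x" "(\<forall>y\<in>A. i \<le> y) \<or> (\<forall>y\<in>A. y \<le> i)"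
  shows "blk (ins i x \<sigma>) x = insert x (blk \<sigma> i)"
    "y \<in> A \<Longrightarrow> blk (ins i x \<sigma>) y = (if i \<in> blk \<sigma> y then insert x (blk \<sigma> y) else blk \<sigma> y)"
proof -
  have "insert x (blk \<sigma> i) \<in> ins i x \<sigma>"
    using blk_in[OF assms(1,2)] blk_mem[OF assms(1,2)] by (auto simp: ins_def)
  then show "blk (ins i x \<sigma>) x = insert x (blk \<sigma> i)"
    using blk_eq[OF nc_ins[OF assms]] by blast
  show "blk (ins i x \<sigma>) y = (if i \<in> blk \<sigma> y then insert x (blk \<sigma> y) else blk \<sigma> y)" if "y \<in> A"
    by (rule blk_eq[OF nc_ins[OF assms]])
      (use blk_in[OF assms(1) that] blk_mem[OF assms(1) that] in \<open>auto simp: ins_def\<close>)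
qed

lemma bmin_insert_single:
  assumes "\<sigma> \<in> nc A" "x \<notin> A"
  shows "bmin (insert {x} \<sigma>) x = x" "y \<in> A \<Longrightarrow> bmin (insert {x} \<sigma>) y = bmin \<sigma> y"
  using blk_insert_single[OF assms] by (auto simp: bmin_def)

lemma bmin_Un:
  assumes "\<sigma> \<in> nc A" "\<tau> \<in> nc B" "\<forall>a\<in>A. \<forall>b\<in>B. a < b"
  shows "y \<in> A \<Longrightarrow> bmin (\<sigma> \<union> \<tau>) y = bmin \<sigma> y" "y \<in> B \<Longrightarrow> bmin (\<sigma> \<union> \<tau>) y = bmin \<tau> y"
  using blk_Un[OF assms] by (auto simp: bmin_def)

lemma Min_insert_greater:
  fixes x :: nat
  assumes "finite B" "B \<noteq> {}" "\<forall>y\<in>B. y < x"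
  shows "Min (insert x B) = Min B"
  using assms by (simp add: min_absorb2 less_imp_le)

lemma bmin_ins:
  assumes "\<sigma> \<in> nc A" "i \<in> A" "\<forall>y\<in>A. y < x" "(\<forall>y\<in>A. i \<le> y) \<or> (\<forall>y\<in>A. y \<le> i)" "finite A"
  shows "bmin (ins i x \<sigma>) x = bmin \<sigma> i" "y \<in> A \<Longrightarrow> bmin (ins i x \<sigma>) y = bmin \<sigma> y"
proof -
  have *: "Min (insert x (blk \<sigma> y)) = Min (blk \<sigma> y)" if "y \<in> A" for y
  proof (rule Min_insert_greater)
    show "\<forall>z\<in>blk \<sigma> y. z < x"
      using nc_subset[OF assms(1) blk_in[OF assms(1) that]] assms(3) by blast
    show "finite (blk \<sigma> y)" "blk \<sigma> y \<noteq> {}"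
      using nc_finite_blk[OF assms(5,1) that] blk_mem[OF assms(1) that] by auto
  qed
  show "bmin (ins i x \<sigma>) x = bmin \<sigma> i"
    unfolding bmin_def blk_ins(1)[OF assms(1-4)] by (rule *[OF assms(2)])
  show "bmin (ins i x \<sigma>) y = bmin \<sigma> y" if "y \<in> A"
    unfolding bmin_def blk_ins(2)[OF assms(1-4) that] using *[OF that] by simp
qed

lemma bmin_eq_minimum:
  assumes "finite A" "\<sigma> \<in> nc A" "a \<in> A" "\<forall>y\<in>A. a \<le> y"
  shows "bmin \<sigma> a = a"
proof (rule antisym)
  show "a \<le> bmin \<sigma> a" using bmin_in[OF assms(1-3)] assms(4) by blast
qed (rule bmin_le[OF assms(1-3)])

lemma card_insert_single:
  assumes "finite A" "\<sigma> \<in> nc A" "x \<notin> A"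
  shows "card (insert {x} \<sigma>) = Suc (card \<sigma>)"
proof -
  have "{x} \<notin> \<sigma>" using nc_subset[OF assms(2), of "{x}"] assms(3) by blast
  then show ?thesis using nc_finite[OF assms(1,2)] by simp
qed

lemma inj_on_extend:
  assumes "\<sigma> \<in> nc A" "x \<notin> A"
  shows "inj_on (\<lambda>B. if i \<in> B then insert x B else B) \<sigma>"
proof (rule inj_onI)
  fix B C assume "B \<in> \<sigma>" "C \<in> \<sigma>"
    "(if i \<in> B then insert x B else B) = (if i \<in> C then insert x C else C)"
  moreover from this have "x \<notin> B" "x \<notin> C" using nc_subset assms by blast+
  ultimately show "B = C" by (auto split: if_splits)
qed

lemma card_ins: "\<sigma> \<in> nc A \<Longrightarrow> x \<notin> A \<Longrightarrow> card (ins i x \<sigma>) = card \<sigma>"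
  unfolding ins_def by (rule card_image) (rule inj_on_extend)

lemma nc_Int_empty:
  assumes "\<sigma> \<in> nc A" "\<tau> \<in> nc B" "\<forall>a\<in>A. \<forall>b\<in>B. a < b"
  shows "\<sigma> \<inter> \<tau> = {}"
proof (rule ccontr)
  assume "\<sigma> \<inter> \<tau> \<noteq> {}"
  then obtain C where C: "C \<in> \<sigma>" "C \<in> \<tau>" by blast
  then obtain x where "x \<in> C" using nc_nonempty[OF assms(1)] by blast
  then have "x \<in> A" "x \<in> B" using C nc_subset[OF assms(1)] nc_subset[OF assms(2)] by blast+
  then show False using assms(3) by blast
qed

lemma card_nc_Un:
  assumes "\<sigma> \<in> nc A" "\<tau> \<in> nc B" "\<forall>a\<in>A. \<forall>b\<in>B. a < b" "finite A" "finite B"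
  shows "card (\<sigma> \<union> \<tau>) = card \<sigma> + card \<tau>"
proof (rule card_Un_disjoint)
  show "\<sigma> \<inter> \<tau> = {}" by (rule nc_Int_empty[OF assms(1-3)])
qed (use assms nc_finite in auto)

lemma ins_remove:
  assumes "\<sigma> \<in> nc A" "x \<notin> A"
  shows "(\<lambda>B. B - {x}) ` ins i x \<sigma> = \<sigma>"
proof -
  have "(if i \<in> B then insert x B else B) - {x} = B" if "B \<in> \<sigma>" for B
    using that nc_subset[OF assms(1)] assms(2) by auto
  then have "(\<lambda>B. (if i \<in> B then insert x B else B) - {x}) ` \<sigma> = (\<lambda>B. B) ` \<sigma>"
    by (intro image_cong refl)
  then show ?thesis unfolding ins_def image_image by (simp only: image_ident)
qed

lemma inj_on_ins: "x \<notin> A \<Longrightarrow> inj_on (ins i x) (nc A)"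
  by (rule inj_on_inverseI[of _ "(`) (\<lambda>B. B - {x})"]) (rule ins_remove)

lemma inj_on_insert_single: "x \<notin> A \<Longrightarrow> inj_on (insert {x}) (nc A)"
proof (rule inj_on_inverseI[of _ "\<lambda>\<sigma>. \<sigma> - {{x}}"])
  fix \<sigma> assume "x \<notin> A" "\<sigma> \<in> nc A"
  then have "{x} \<notin> \<sigma>" using nc_subset[of \<sigma> A "{x}"] by blast
  then show "insert {x} \<sigma> - {{x}} = \<sigma>" by simp
qed

section \<open>Merging blocks\<close>

text \<open>Here \<open>B\<close> absorbs a block with minimum \<open>m\<close>. The label is the
  greatest element of \<open>B\<close> below \<open>m\<close>, so it equals m - 1 exactly when m - 1
  lies in \<open>B\<close>; this turns conditions on labels into membership. Nothing is asked for m
  \<le> k, so \<open>edge m {1..m}\<close> is the covering relation of the whole lattice.\<close>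

definition allowed :: "nat \<Rightarrow> nat set \<Rightarrow> nat \<Rightarrow> bool" where
  "allowed k B m \<longleftrightarrow> (k + 1 < m \<longrightarrow> m - 1 \<in> B) \<and> (m = k + 1 \<longrightarrow> k \<notin> B)"

definition merge :: "nat \<Rightarrow> nat set set \<Rightarrow> nat set set \<Rightarrow> bool" where
  "merge k \<sigma> \<tau> \<longleftrightarrow> (\<exists>B\<in>\<sigma>. \<exists>C\<in>\<sigma>. Min B < Min C \<and> allowed k B (Min C) \<and>
     \<tau> = insert (B \<union> C) (\<sigma> - {B, C}))"

definition edge :: "nat \<Rightarrow> nat set \<Rightarrow> nat set set \<Rightarrow> nat set set \<Rightarrow> bool" where
  "edge k A \<sigma> \<tau> \<longleftrightarrow> \<sigma> \<in> nc A \<and> \<tau> \<in> nc A \<and> merge k \<sigma> \<tau>"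

lemma edge_nc: "edge k A \<sigma> \<tau> \<Longrightarrow> \<sigma> \<in> nc A" "edge k A \<sigma> \<tau> \<Longrightarrow> \<tau> \<in> nc A"
  by (auto simp: edge_def)

lemma allowed_le: "m \<le> k \<Longrightarrow> allowed k B m"
  by (simp add: allowed_def)

lemma allowed_insert: "allowed k B m \<Longrightarrow> m < x \<Longrightarrow> allowed k (insert x B) m"
  by (auto simp: allowed_def)

lemma merge_image:
  assumes "merge k \<sigma> \<tau>" "inj_on g \<sigma>"
    and "\<And>B C. B \<in> \<sigma> \<Longrightarrow> C \<in> \<sigma> \<Longrightarrow> g (B \<union> C) = g B \<union> g C"
    and "\<And>B. B \<in> \<sigma> \<Longrightarrow> Min (g B) = Min B"
    and "\<And>B C. B \<in> \<sigma> \<Longrightarrow> C \<in> \<sigma> \<Longrightarrow> allowed k B (Min C) \<Longrightarrow> allowed k (g B) (Min C)"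
  shows "merge k (g ` \<sigma>) (g ` \<tau>)"
proof -
  obtain B C where BC: "B \<in> \<sigma>" "C \<in> \<sigma>" "Min B < Min C" "allowed k B (Min C)"
    "\<tau> = insert (B \<union> C) (\<sigma> - {B, C})"
    using assms(1) by (auto simp: merge_def)
  have "g ` (\<sigma> - {B, C}) = g ` \<sigma> - {g B, g C}"
    using inj_on_image_set_diff[OF assms(2), of \<sigma> "{B, C}"] BC by auto
  then have "g ` \<tau> = insert (g B \<union> g C) (g ` \<sigma> - {g B, g C})"
    using assms(3) BC by simp
  then show ?thesis
    unfolding merge_def using BC assms(4,5) by (intro bexI[of _ "g B"] bexI[of _ "g C"]) auto
qed

lemma merge_Un:
  assumes "merge k \<sigma> \<tau>" "\<sigma> \<inter> \<rho> = {}"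
  shows "merge k (\<sigma> \<union> \<rho>) (\<tau> \<union> \<rho>)"
proof -
  obtain B C where BC: "B \<in> \<sigma>" "C \<in> \<sigma>" "Min B < Min C" "allowed k B (Min C)"
    "\<tau> = insert (B \<union> C) (\<sigma> - {B, C})"
    using assms(1) by (auto simp: merge_def)
  have "\<tau> \<union> \<rho> = insert (B \<union> C) (\<sigma> \<union> \<rho> - {B, C})"
    using BC assms(2) by auto
  then show ?thesis
    unfolding merge_def using BC by blast
qed

section \<open>Admissible merges under the constructions\<close>

lemma edge_Un_upper:
  assumes "edge k A \<sigma> \<tau>" "\<rho> \<in> nc B" "\<forall>a\<in>A. \<forall>b\<in>B. a < b"
  shows "edge k (A \<union> B) (\<sigma> \<union> \<rho>) (\<tau> \<union> \<rho>)"
proof -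
  have "\<sigma> \<inter> \<rho> = {}" by (rule nc_Int_empty[OF edge_nc(1)[OF assms(1)] assms(2,3)])
  then show ?thesis
    using assms nc_Un[OF _ assms(2,3)] merge_Un by (simp add: edge_def)
qed

lemma edge_Un_lower:
  assumes "edge k B \<sigma> \<tau>" "\<rho> \<in> nc A" "\<forall>a\<in>A. \<forall>b\<in>B. a < b"
  shows "edge k (A \<union> B) (\<rho> \<union> \<sigma>) (\<rho> \<union> \<tau>)"
proof -
  have "\<sigma> \<inter> \<rho> = {}" using nc_Int_empty[OF assms(2) edge_nc(1)[OF assms(1)] assms(3)] by blast
  then have "merge k (\<rho> \<union> \<sigma>) (\<rho> \<union> \<tau>)"
    using merge_Un[of k \<sigma> \<tau> \<rho>] assms(1) by (simp add: edge_def Un_commute)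
  then show ?thesis
    using assms(1) nc_Un[OF assms(2) _ assms(3)] by (simp add: edge_def)
qed

lemma edge_insert_single:
  assumes "edge k A \<sigma> \<tau>" "\<forall>y\<in>A. y < x"
  shows "edge k (insert x A) (insert {x} \<sigma>) (insert {x} \<tau>)"
  using edge_Un_upper[OF assms(1) nc_top[of "{x}"]] assms(2) by simp

text \<open>Since \<open>x\<close> exceeds every point, no minimum changes, and \<open>x\<close> is
  not the point \<open>k\<close> that must be avoided when the lost minimum is k + 1.\<close>

lemma edge_ins:
  assumes "edge k A \<sigma> \<tau>" "i \<in> A" "\<forall>y\<in>A. y < x" "(\<forall>y\<in>A. i \<le> y) \<or> (\<forall>y\<in>A. y \<le> i)" "finite A"
  shows "edge k (insert x A) (ins i x \<sigma>) (ins i x \<tau>)"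
proof -
  note nc = edge_nc[OF assms(1)]
  have B: "finite B" "B \<noteq> {}" "\<forall>y\<in>B. y < x" if "B \<in> \<sigma>" for B
    using nc_finite_block[OF assms(5) nc(1) that] nc_nonempty[OF nc(1) that]
      nc_subset[OF nc(1) that] assms(3) by auto
  have "merge k (ins i x \<sigma>) (ins i x \<tau>)"
    unfolding ins_def
  proof (rule merge_image)
    show "merge k \<sigma> \<tau>" using assms(1) by (simp add: edge_def)
    show "inj_on (\<lambda>B. if i \<in> B then insert x B else B) \<sigma>"
      by (rule inj_on_extend[OF nc(1)]) (use assms(3) in auto)
    show "Min (if i \<in> B then insert x B else B) = Min B" if "B \<in> \<sigma>" for B
      using Min_insert_greater[OF B[OF that]] by simp
    show "allowed k (if i \<in> B then insert x B else B) (Min C)"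
      if "B \<in> \<sigma>" "C \<in> \<sigma>" "allowed k B (Min C)" for B C
      using allowed_insert[OF that(3), of x] B[OF that(2)] that(3) by simp
  qed auto
  then show ?thesis
    using nc_ins[OF _ assms(2-4)] nc by (simp add: edge_def)
qed

text \<open>The minimum lost is \<open>x\<close> itself, so admissibility concerns the block that
  receives it. This is the only kind of edge used in the sequel that can lose a minimum above
  \<open>k\<close>, apart from its images under the other constructions.\<close>

lemma edge_attach:
  assumes "\<sigma> \<in> nc A" "i \<in> A" "\<forall>y\<in>A. y < x" "(\<forall>y\<in>A. i \<le> y) \<or> (\<forall>y\<in>A. y \<le> i)" "finite A"
    and "allowed k (blk \<sigma> i) x"
  shows "edge k (insert x A) (insert {x} \<sigma>) (ins i x \<sigma>)"
proof -
  let ?B = "blk \<sigma> i"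
  have xA: "x \<notin> A" using assms(3) by auto
  have B: "?B \<in> \<sigma>" "i \<in> ?B" using blk_in blk_mem assms(1,2) by auto
  have "Min ?B \<le> i"
    using bmin_le[OF assms(5,1,2)] by (simp add: bmin_def)
  then have "Min ?B < Min {x}" using assms(2,3) by (simp add: le_less_trans)
  moreover have "ins i x \<sigma> = insert (?B \<union> {x}) (insert {x} \<sigma> - {?B, {x}})"
  proof -
    have "i \<notin> C" if "C \<in> \<sigma> - {?B}" for C
      using that nc_unique[OF assms(1) _ B(1)] B(2) by blast
    then have "(\<lambda>C. if i \<in> C then insert x C else C) ` (\<sigma> - {?B}) = (\<lambda>C. C) ` (\<sigma> - {?B})"
      by (intro image_cong refl) simp
    then have "ins i x (\<sigma> - {?B}) = \<sigma> - {?B}"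
      by (simp only: ins_def image_ident)
    moreover have "ins i x \<sigma> = insert (?B \<union> {x}) (ins i x (\<sigma> - {?B}))"
      using B by (subst insert_Diff[OF B(1), symmetric]) (simp add: ins_def del: insert_Diff_single)
    moreover have "{x} \<notin> \<sigma>" using nc_subset[OF assms(1), of "{x}"] xA by blast
    ultimately show ?thesis by auto
  qed
  ultimately have "merge k (insert {x} \<sigma>) (ins i x \<sigma>)"
    unfolding merge_def using B(1) assms(6) by (intro bexI[of _ ?B] bexI[of _ "{x}"]) auto
  then show ?thesis
    using nc_ins[OF assms(1-4)] nc_insert_single[OF assms(1) xA] by (simp add: edge_def)
qed

text \<open>Supplies the last step of a path on which both halves of the ground set have become
  blocks.\<close>

lemma edge_join:
  assumes "L \<noteq> {}" "U \<noteq> {}" "finite L" "finite U" "\<forall>a\<in>L. \<forall>b\<in>U. a < b" "allowed k L (Min U)"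
  shows "edge k (L \<union> U) {L, U} {L \<union> U}"
proof -
  have "{L} \<union> {U} \<in> nc (L \<union> U)"
    by (rule nc_Un[OF nc_top nc_top assms(5)]) fact+
  then have "{L, U} \<in> nc (L \<union> U)" by (simp add: insert_commute)
  moreover have "merge k {L, U} {L \<union> U}"
  proof -
    have "Min L < Min U"
      using assms by simp
    then show ?thesis
      unfolding merge_def using assms(6)
      by (intro bexI[of _ L] bexI[of _ U]) auto
  qed
  ultimately show ?thesis
    using nc_top[of "L \<union> U"] assms(1) by (simp add: edge_def)
qed

lemma edge_card:
  assumes "edge k A \<sigma> \<tau>" "finite A"
  shows "card \<sigma> = Suc (card \<tau>)"
proof -
  obtain B C where BC: "B \<in> \<sigma>" "C \<in> \<sigma>" "Min B < Min C" "\<tau> = insert (B \<union> C) (\<sigma> - {B, C})"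
    using assms(1) by (auto simp: edge_def merge_def)
  have s: "\<sigma> \<in> nc A" using assms(1) by (simp add: edge_def)
  have "B \<noteq> C" using BC(3) by auto
  have "B \<union> C \<notin> \<sigma> - {B, C}"
    using nc_unique[OF s _ BC(1)] nc_nonempty[OF s BC(1)] by (metis DiffD1 DiffD2 UnCI ex_in_conv insertCI)
  moreover have "finite \<sigma>" using nc_finite[OF assms(2) s] .
  moreover have "card (\<sigma> - {B, C}) = card \<sigma> - 2"
    using BC \<open>finite \<sigma>\<close> \<open>B \<noteq> C\<close> by (subst card_Diff_subset) auto
  moreover have "card {B, C} \<le> card \<sigma>"
    using BC \<open>finite \<sigma>\<close> by (intro card_mono) auto
  ultimately show ?thesis
    using BC(4) \<open>B \<noteq> C\<close> by simp
qed

section \<open>Admissible paths from the discrete to the one-block partition\<close>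

abbreviation singletons :: "nat set \<Rightarrow> nat set set" where
  "singletons A \<equiv> (\<lambda>x. {x}) ` A"

text \<open>For \<open>A = {1..n + 1}\<close> these will turn out to be the elements of the poset.
  Other ground sets are needed for the halves of a split partition.\<close>

definition conn :: "nat \<Rightarrow> nat set \<Rightarrow> nat set set \<Rightarrow> bool" where
  "conn k A \<sigma> \<longleftrightarrow> (edge k A)\<^sup>*\<^sup>* (singletons A) \<sigma> \<and> (edge k A)\<^sup>*\<^sup>* \<sigma> {A}"

lemma rtranclp_hom:
  assumes "R\<^sup>*\<^sup>* x y" "\<And>x y. R x y \<Longrightarrow> S (f x) (f y)"
  shows "S\<^sup>*\<^sup>* (f x) (f y)"
  using assms(1) by induction (auto intro: rtranclp.rtrancl_into_rtrancl assms(2))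

lemma path_insert_single:
  assumes "(edge k A)\<^sup>*\<^sup>* \<sigma> \<tau>" "\<forall>y\<in>A. y < x"
  shows "(edge k (insert x A))\<^sup>*\<^sup>* (insert {x} \<sigma>) (insert {x} \<tau>)"
  by (rule rtranclp_hom[where f = "insert {x}", OF assms(1)]) (rule edge_insert_single[OF _ assms(2)])

lemma path_ins:
  assumes "(edge k A)\<^sup>*\<^sup>* \<sigma> \<tau>"
    and "i \<in> A" "\<forall>y\<in>A. y < x" "(\<forall>y\<in>A. i \<le> y) \<or> (\<forall>y\<in>A. y \<le> i)" "finite A"
  shows "(edge k (insert x A))\<^sup>*\<^sup>* (ins i x \<sigma>) (ins i x \<tau>)"
  by (rule rtranclp_hom[where f = "ins i x", OF assms(1)]) (rule edge_ins[OF _ assms(2-5)])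

lemma path_Un_upper:
  assumes "(edge k A)\<^sup>*\<^sup>* \<sigma> \<tau>" "\<rho> \<in> nc B" "\<forall>a\<in>A. \<forall>b\<in>B. a < b"
  shows "(edge k (A \<union> B))\<^sup>*\<^sup>* (\<sigma> \<union> \<rho>) (\<tau> \<union> \<rho>)"
  by (rule rtranclp_hom[where f = "\<lambda>\<sigma>. \<sigma> \<union> \<rho>", OF assms(1)]) (rule edge_Un_upper[OF _ assms(2,3)])

lemma path_Un_lower:
  assumes "(edge k B)\<^sup>*\<^sup>* \<sigma> \<tau>" "\<rho> \<in> nc A" "\<forall>a\<in>A. \<forall>b\<in>B. a < b"
  shows "(edge k (A \<union> B))\<^sup>*\<^sup>* (\<rho> \<union> \<sigma>) (\<rho> \<union> \<tau>)"
  by (rule rtranclp_hom[where f = "\<lambda>\<sigma>. \<rho> \<union> \<sigma>", OF assms(1)]) (rule edge_Un_lower[OF _ assms(2,3)])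

lemma path_nc:
  assumes "(edge k A)\<^sup>*\<^sup>* \<sigma> \<tau>" "\<sigma> \<in> nc A"
  shows "\<tau> \<in> nc A"
  using assms by induction (auto dest: edge_nc)

lemma conn_nc: "conn k A \<sigma> \<Longrightarrow> \<sigma> \<in> nc A"
  unfolding conn_def using path_nc nc_singletons by blast

lemma ins_singleton: "i \<in> A \<Longrightarrow> ins i x {A} = {insert x A}"
  by (simp add: ins_def)

lemma path_Un:
  assumes "(edge k A)\<^sup>*\<^sup>* \<sigma> \<sigma>'" "(edge k B)\<^sup>*\<^sup>* \<tau> \<tau>'" "\<sigma> \<in> nc A" "\<tau> \<in> nc B" "\<forall>a\<in>A. \<forall>b\<in>B. a < b"
  shows "(edge k (A \<union> B))\<^sup>*\<^sup>* (\<sigma> \<union> \<tau>) (\<sigma>' \<union> \<tau>')"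
  by (rule rtranclp_trans[OF path_Un_upper[OF assms(1,4,5)]
        path_Un_lower[OF assms(2) path_nc[OF assms(1,3)] assms(5)]])

text \<open>One path serves for both: follow a path up to \<sigma> with \<open>x\<close> kept as a
  singleton, attach \<open>x\<close> to the block of \<open>i\<close>, and continue to the top with
  \<open>x\<close> attached. Only the middle step needs the last hypothesis.\<close>

lemma conn_layers:
  assumes "conn k A \<sigma>" "i \<in> A" "\<forall>y\<in>A. y < x" "(\<forall>y\<in>A. i \<le> y) \<or> (\<forall>y\<in>A. y \<le> i)" "finite A"
    and "allowed k (blk \<sigma> i) x"
  shows "conn k (insert x A) (insert {x} \<sigma>)" "conn k (insert x A) (ins i x \<sigma>)"
proof -
  have att: "edge k (insert x A) (insert {x} \<sigma>) (ins i x \<sigma>)"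
    by (rule edge_attach[OF conn_nc[OF assms(1)] assms(2-6)])
  have "(edge k (insert x A))\<^sup>*\<^sup>* (insert {x} (singletons A)) (insert {x} \<sigma>)"
    using path_insert_single[OF _ assms(3)] assms(1) unfolding conn_def by blast
  moreover have "(edge k (insert x A))\<^sup>*\<^sup>* (ins i x \<sigma>) (ins i x {A})"
    using path_ins[OF _ assms(2-5)] assms(1) unfolding conn_def by blast
  moreover have "ins i x {A} = {insert x A}" by (rule ins_singleton[OF assms(2)])
  ultimately show "conn k (insert x A) (insert {x} \<sigma>)" "conn k (insert x A) (ins i x \<sigma>)"
    using att unfolding conn_def
    by (auto intro: converse_rtranclp_into_rtranclp rtranclp.rtrancl_into_rtrancl)
qed

section \<open>Symmetric chains of noncrossing partitions\<close>

text \<open>By \<open>nc_insert_cases\<close> these are the partitions in which the block of the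
  largest point \<open>x\<close> has minimum \<open>i\<close>. The image of a product is the form to
  which the product theorem applies.\<close>

definition joins :: "nat set \<Rightarrow> nat \<Rightarrow> nat \<Rightarrow> nat set set set" where
  "joins A i x = (\<lambda>p. fst p \<union> ins i x (snd p)) ` (nc (A \<inter> {..<i}) \<times> nc (A \<inter> {i..}))"

lemma split_at: "A \<inter> {..<i} \<union> insert x (A \<inter> {i..}) = insert x (A :: nat set)"
  by auto

lemma nc_join_upper:
  assumes "i \<in> A" "\<forall>y\<in>A. y < x" "\<sigma>2 \<in> nc (A \<inter> {i..})"
  shows "ins i x \<sigma>2 \<in> nc (insert x (A \<inter> {i..}))"
  by (rule nc_ins[OF assms(3)]) (use assms in auto)

lemma lower_less_upper:
  assumes "i \<in> A" "\<forall>y\<in>A. y < x"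
  shows "\<forall>a\<in>A \<inter> {..<i}. \<forall>b\<in>insert x (A \<inter> {i..}). a < (b::nat)"
  using assms by auto

lemma nc_join:
  assumes "i \<in> A" "\<forall>y\<in>A. y < x" "\<sigma>1 \<in> nc (A \<inter> {..<i})" "\<sigma>2 \<in> nc (A \<inter> {i..})"
  shows "\<sigma>1 \<union> ins i x \<sigma>2 \<in> nc (insert x A)"
  using nc_Un[OF assms(3) nc_join_upper[OF assms(1,2,4)] lower_less_upper[OF assms(1,2)]]
  by (simp only: split_at)

lemma joins_eq:
  assumes "i \<in> A" "\<forall>y\<in>A. y < x" "finite A"
  shows "joins A i x = {\<sigma> \<in> nc (insert x A). bmin \<sigma> x = i}"
proof (intro equalityI subsetI)
  fix \<sigma> assume "\<sigma> \<in> joins A i x"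
  then obtain \<sigma>1 \<sigma>2 where s: "\<sigma>1 \<in> nc (A \<inter> {..<i})" "\<sigma>2 \<in> nc (A \<inter> {i..})"
    "\<sigma> = \<sigma>1 \<union> ins i x \<sigma>2"
    by (auto simp: joins_def)
  have "bmin \<sigma> x = bmin (ins i x \<sigma>2) x"
    unfolding s(3)
    by (rule bmin_Un(2)[OF s(1) nc_join_upper[OF assms(1,2) s(2)] lower_less_upper[OF assms(1,2)]])
      simp
  also have "\<dots> = bmin \<sigma>2 i"
    by (rule bmin_ins(1)[OF s(2)]) (use assms in auto)
  also have "\<dots> = i"
    by (rule bmin_eq_minimum[OF _ s(2)]) (use assms in auto)
  finally show "\<sigma> \<in> {\<sigma> \<in> nc (insert x A). bmin \<sigma> x = i}"
    using nc_join[OF assms(1,2) s(1,2)] s(3) by simp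
next
  fix \<sigma> assume *: "\<sigma> \<in> {\<sigma> \<in> nc (insert x A). bmin \<sigma> x = i}"
  have "\<sigma> \<in> nc (insert x A)" using * by simp
  then show "\<sigma> \<in> joins A i x"
  proof (cases rule: nc_insert_cases[OF _ assms(2,3), consumes 1, case_names single join])
    case single
    then show ?thesis using * assms(1,2) by auto
  next
    case (join i' \<sigma>1 \<sigma>2)
    then have "i' = i" using * by auto
    then show ?thesis
      unfolding joins_def using join(3-5) by (intro image_eqI[of _ _ "(\<sigma>1, \<sigma>2)"]) auto
  qed
qed

lemma bmin_top_fiber:
  assumes "\<forall>y\<in>A. y < x" "finite A"
  shows "{\<sigma> \<in> nc (insert x A). bmin \<sigma> x = x} = insert {x} ` nc A"
proof (intro equalityI subsetI)
  fix \<sigma> assume *: "\<sigma> \<in> {\<sigma> \<in> nc (insert x A). bmin \<sigma> x = x}"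
  then have "\<sigma> \<in> nc (insert x A)" by simp
  then show "\<sigma> \<in> insert {x} ` nc A"
  proof (cases rule: nc_insert_cases[OF _ assms, consumes 1, case_names single join])
    case single
    then show ?thesis by blast
  next
    case (join i \<sigma>1 \<sigma>2)
    then show ?thesis using * assms(1) by auto
  qed
next
  fix \<sigma> assume "\<sigma> \<in> insert {x} ` nc A"
  moreover have "x \<notin> A" using assms(1) by auto
  ultimately show "\<sigma> \<in> {\<sigma> \<in> nc (insert x A). bmin \<sigma> x = x}"
    using nc_insert_single bmin_insert_single(1) by auto
qed

lemma bmin_bot_fiber:
  assumes "a \<in> A" "\<forall>y\<in>A. a \<le> y" "\<forall>y\<in>A. y < x" "finite A"
  shows "{\<sigma> \<in> nc (insert x A). bmin \<sigma> x = a} = ins a x ` nc A"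
proof -
  have "A \<inter> {..<a} = {}" "A \<inter> {a..} = A" using assms(2) by auto
  moreover have "{{}} \<times> nc A = Pair ({} :: nat set set) ` nc A" by auto
  ultimately have "joins A a x = ins a x ` nc A"
    by (simp add: joins_def nc_empty image_image)
  then show ?thesis using joins_eq[OF assms(1,3,4)] by simp
qed

text \<open>Attach \<open>x\<close> to \<open>i\<close> at the very beginning, while
  \<open>i\<close> is still a singleton; then only \<open>allowed k {i} x\<close> is needed.
  Afterwards both halves grow independently, and the final merge loses the minimum \<open>i\<close>,
  which is free of conditions because i \<le> k.\<close>

lemma conn_join:
  assumes "i \<in> A" "\<forall>y\<in>A. y < x" "finite A" "A \<inter> {..<i} \<noteq> {}"
    and "conn k (A \<inter> {..<i}) \<sigma>1" "conn k (A \<inter> {i..}) \<sigma>2" "i \<le> k" "allowed k {i} x"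
  shows "conn k (insert x A) (\<sigma>1 \<union> ins i x \<sigma>2)"
proof -
  let ?L = "A \<inter> {..<i}" and ?U = "A \<inter> {i..}"
  have U: "i \<in> ?U" "\<forall>y\<in>?U. y < x" "\<forall>y\<in>?U. i \<le> y" "finite ?U"
    using assms(1-3) by auto
  note LU = lower_less_upper[OF assms(1,2)]
  have eqA: "?L \<union> insert x ?U = insert x A" by auto
  have "blk (singletons ?U) i = {i}"
    by (rule blk_eq[OF nc_singletons]) (use U in auto)
  then have e: "edge k (insert x ?U) (insert {x} (singletons ?U)) (ins i x (singletons ?U))"
    using assms(8) by (intro edge_attach[OF nc_singletons]) (use U in auto)
  have "(edge k (insert x ?U))\<^sup>*\<^sup>* (ins i x (singletons ?U)) (ins i x \<sigma>2)"
    by (rule path_ins) (use assms(6) U in \<open>auto simp: conn_def\<close>)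
  with e have up1: "(edge k (insert x ?U))\<^sup>*\<^sup>* (singletons (insert x ?U)) (ins i x \<sigma>2)"
    by (simp add: converse_rtranclp_into_rtranclp)
  have "(edge k (insert x A))\<^sup>*\<^sup>* (singletons ?L \<union> singletons (insert x ?U)) (\<sigma>1 \<union> ins i x \<sigma>2)"
    using path_Un[OF _ up1 nc_singletons nc_singletons LU] assms(5) unfolding conn_def eqA by blast
  moreover have "singletons ?L \<union> singletons (insert x ?U) = singletons (insert x A)"
    by (subst image_Un[symmetric]) (simp only: eqA)
  ultimately have bot: "(edge k (insert x A))\<^sup>*\<^sup>* (singletons (insert x A)) (\<sigma>1 \<union> ins i x \<sigma>2)"
    by simp
  have "(edge k (insert x ?U))\<^sup>*\<^sup>* (ins i x \<sigma>2) (ins i x {?U})"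
    by (rule path_ins) (use assms(6) U in \<open>auto simp: conn_def\<close>)
  then have up2: "(edge k (insert x ?U))\<^sup>*\<^sup>* (ins i x \<sigma>2) {insert x ?U}"
    using ins_singleton[OF U(1)] by simp
  have "(edge k (insert x A))\<^sup>*\<^sup>* (\<sigma>1 \<union> ins i x \<sigma>2) ({?L} \<union> {insert x ?U})"
    using path_Un[OF _ up2 conn_nc[OF assms(5)] _ LU]
      nc_join_upper[OF assms(1,2) conn_nc[OF assms(6)]] assms(5)
    unfolding conn_def eqA by blast
  moreover have "edge k (insert x A) {?L, insert x ?U} {insert x A}"
  proof -
    have "i \<le> x" using assms(1,2) by (simp add: less_imp_le)
    then have "Min (insert x ?U) = i"
      by (intro Min_eqI) (use U in auto)
    then have "edge k (?L \<union> insert x ?U) {?L, insert x ?U} {?L \<union> insert x ?U}"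
      by (intro edge_join[OF assms(4) _ _ _ LU]) (use assms(3,7) in \<open>simp_all add: allowed_le\<close>)
    then show ?thesis unfolding eqA .
  qed
  ultimately have "(edge k (insert x A))\<^sup>*\<^sup>* (\<sigma>1 \<union> ins i x \<sigma>2) {insert x A}"
    by (simp add: insert_commute rtranclp.rtrancl_into_rtrancl)
  with bot show ?thesis by (simp add: conn_def)
qed

lemma max_remove:
  fixes A :: "nat set"
  assumes "finite A" "A \<noteq> {}"
  obtains x A' where "A = insert x A'" "\<forall>y\<in>A'. y < x" "finite A'" "x \<notin> A'"
proof (rule that[of "Max A" "A - {Max A}"])
  show "A = insert (Max A) (A - {Max A})" using Max_in[OF assms] by blast
  show "\<forall>y\<in>A - {Max A}. y < Max A"
    using Max_ge[OF assms(1)] by (metis Diff_iff insertI1 le_neq_implies_less)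
qed (use assms in auto)

text \<open>No point exceeds \<open>k\<close>, so all merges are admissible and no partition is
  lost. The induction removes the largest point and uses the split at the minimum of its block; the
  result provides the paths inside the halves in \<open>conn_join\<close>.\<close>

lemma nc_conn:
  assumes "finite A" "A \<noteq> {}" "A \<subseteq> {..k}" "\<sigma> \<in> nc A"
  shows "conn k A \<sigma>"
  using assms
proof (induction A arbitrary: \<sigma> rule: finite_psubset_induct)
  case (psubset A)
  obtain x A' where A: "A = insert x A'" "\<forall>y\<in>A'. y < x" "finite A'" "x \<notin> A'"
    using max_remove psubset.hyps psubset.prems(1) by metis
  have xk: "x \<le> k" using A psubset.prems(2) by auto
  have s: "\<sigma> \<in> nc (insert x A')" using psubset.prems A by simp
  show ?case
  proof (cases "A' = {}")
    case True
    have "\<sigma> = {{x}}"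
      using s True by (cases rule: nc_insert_cases[OF _ A(2,3)]) (auto simp: nc_empty)
    then show ?thesis using True A by (simp add: conn_def)
  next
    case False
    define a where "a = Min A'"
    have a: "a \<in> A'" "\<forall>y\<in>A'. a \<le> y" using False A(3) by (auto simp: a_def)
    have IH: "conn k C \<tau>" if "C \<subseteq> A'" "C \<noteq> {}" "\<tau> \<in> nc C" for C \<tau>
      using psubset.IH[of C \<tau>] that psubset.prems(2) A(1,4) by blast
    from s show ?thesis
    proof (cases rule: nc_insert_cases[OF _ A(2,3), consumes 1, case_names single join])
      case single
      have "conn k A (insert {x} (\<sigma> - {{x}}))"
        unfolding A(1)
        by (rule conn_layers(1)[OF IH[OF subset_refl False single(2)] a(1) A(2) _ A(3)])
          (use a xk allowed_le in auto)
      then show ?thesis using single(3) by simp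
    next
      case (join i \<sigma>1 \<sigma>2)
      show ?thesis
      proof (cases "A' \<inter> {..<i} = {}")
        case True
        then have e: "A' \<inter> {i..} = A'" by auto
        have "conn k A (ins i x \<sigma>2)"
          unfolding A(1)
          by (rule conn_layers(2)[OF IH[OF subset_refl False] join(2) A(2) _ A(3)])
            (use join(4) e xk allowed_le in auto)
        then show ?thesis using join(3,5) True by (simp add: nc_empty)
      next
        case ne: False
        have "conn k A (\<sigma>1 \<union> ins i x \<sigma>2)"
          unfolding A(1)
          by (rule conn_join[OF join(2) A(2,3) ne IH[OF _ ne join(3)] IH[OF _ _ join(4)]])
            (use join(2) A xk psubset.prems(2) allowed_le in auto)
        then show ?thesis using join(5) by simp
      qed
    qed
  qed
qed

text \<open>The point \<open>x\<close> is a singleton in the lower layer and lies with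
  \<open>i\<close> in the upper one. Edges inside a layer inherit admissibility; only the edges
  between the layers lose the minimum \<open>x\<close> and need the last hypothesis.\<close>

lemma sym_dec_two_layers:
  assumes "sym_dec S (edge k A) card M" "S \<subseteq> nc A"
    and "i \<in> A" "\<forall>y\<in>A. y < x" "(\<forall>y\<in>A. i \<le> y) \<or> (\<forall>y\<in>A. y \<le> i)" "finite A"
    and "\<And>\<sigma>. \<sigma> \<in> S \<Longrightarrow> allowed k (blk \<sigma> i) x"
  shows "sym_dec (insert {x} ` S \<union> ins i x ` S) (edge k (insert x A)) card (Suc M)"
proof -
  have xA: "x \<notin> A" using assms(4) by auto
  define f where "f = (\<lambda>l::nat. if l = 0 then insert {x} else ins i x)"
  have "sym_dec (\<Union>l\<le>1. f l ` S) (edge k (insert x A)) card (M + 1)"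
  proof (rule sym_dec_layers[OF assms(1)])
    show "card \<sigma> = Suc (card \<tau>)" if "edge k A \<sigma> \<tau>" for \<sigma> \<tau>
      using edge_card[OF that assms(6)] .
    show "edge k (insert x A) (f l \<sigma>) (f l \<tau>)" if "edge k A \<sigma> \<tau>" for l \<sigma> \<tau>
      using edge_insert_single[OF that assms(4)] edge_ins[OF that assms(3-6)] by (simp add: f_def)
    show "edge k (insert x A) (f l \<sigma>) (f (Suc l) \<sigma>)" if "l < 1" "\<sigma> \<in> S" for l \<sigma>
      using edge_attach[OF _ assms(3-6) assms(7)[OF that(2)]] that assms(2) by (auto simp: f_def)
    show "card (f l \<sigma>) = card \<sigma> + (1 - l)" if "l \<le> 1" "\<sigma> \<in> S" for l \<sigma>
      using card_insert_single[OF assms(6) _ xA] card_ins[OF _ xA] that assms(2)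
      by (auto simp: f_def)
    \<comment> \<open>The layers are told apart by the minimum of the block of \<open>x\<close>: it
      is \<open>x\<close> in one and a point of \<open>A\<close> in the other.\<close>
    have "insert {x} \<sigma> \<noteq> ins i x \<tau>" if "\<sigma> \<in> S" "\<tau> \<in> S" for \<sigma> \<tau>
    proof
      assume eq: "insert {x} \<sigma> = ins i x \<tau>"
      have "\<sigma> \<in> nc A" "\<tau> \<in> nc A" using that assms(2) by auto
      then have "bmin \<tau> i = x"
        using bmin_ins(1)[of \<tau>, OF _ assms(3-6)] bmin_insert_single(1)[of \<sigma>, OF _ xA] eq by simp
      then show False using bmin_in[OF assms(6) \<open>\<tau> \<in> nc A\<close> assms(3)] xA by simp
    qed
    note neq = this
    have inj: "\<sigma> = \<tau>" if "\<sigma> \<in> S" "\<tau> \<in> S" "f l \<sigma> = f l \<tau>" for l \<sigma> \<tau>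
      using that inj_onD[OF inj_on_insert_single[OF xA], of \<sigma> \<tau>]
        inj_onD[OF inj_on_ins[OF xA], of i \<sigma> \<tau>] subsetD[OF assms(2)]
      by (simp add: f_def split: if_splits)
    show "l = m \<and> \<sigma> = \<tau>"
      if "l \<le> 1" "m \<le> 1" "\<sigma> \<in> S" "\<tau> \<in> S" "f l \<sigma> = f m \<tau>" for l m \<sigma> \<tau>
    proof (cases "l = m")
      case True
      then show ?thesis using inj that by simp
    next
      case False
      then have "f l = insert {x} \<and> f m = ins i x \<or> f l = ins i x \<and> f m = insert {x}"
        using that(1,2) by (simp add: f_def)
      then show ?thesis using neq[OF that(3,4)] neq[OF that(4,3)] that(5) by metis
    qed
  qed
  moreover have "(\<Union>l\<le>1. f l ` S) = insert {x} ` S \<union> ins i x ` S"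
    by (auto simp: f_def atMost_Suc split: if_splits)
  ultimately show ?thesis by simp
qed

lemma filter_Un:
  assumes "\<And>x. x \<in> X \<Longrightarrow> P x" "\<And>x. x \<in> Y \<Longrightarrow> \<not> P x"
  shows "X = {x \<in> X \<union> Y. P x}" "Y = {x \<in> X \<union> Y. \<not> P x}"
  using assms by auto

text \<open>Attaching \<open>x\<close> to \<open>i\<close> creates no block, so the block counts of
  the two halves simply add, and so do the constants \<open>M\<close> and \<open>N\<close>.\<close>

lemma sym_dec_joins:
  assumes "i \<in> A" "\<forall>y\<in>A. y < x" "finite A"
    and "sym_dec (nc (A \<inter> {..<i})) (edge k (A \<inter> {..<i})) card M"
    and "sym_dec (nc (A \<inter> {i..})) (edge k (A \<inter> {i..})) card N"
  shows "sym_dec (joins A i x) (edge k (insert x A)) card (M + N)"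
proof -
  let ?L = "A \<inter> {..<i}" and ?U = "A \<inter> {i..}"
  have U: "i \<in> ?U" "\<forall>y\<in>?U. y < x" "\<forall>y\<in>?U. i \<le> y" "finite ?U" "x \<notin> ?U"
    using assms(1-3) by auto
  note LU = lower_less_upper[OF assms(1,2)]
  have eqA: "?L \<union> insert x ?U = insert x A" by auto
  have "sym_dec (nc ?L \<times> nc ?U) (prod_edge (edge k ?L) (edge k ?U))
      (\<lambda>p. card (fst p) + card (snd p)) (M + N)"
    by (rule sym_dec_prod[OF assms(4,5)]) (use edge_card assms(3) in auto)
  then show ?thesis
    unfolding joins_def
  proof (rule sym_dec_image)
    show "inj_on (\<lambda>p. fst p \<union> ins i x (snd p)) (nc ?L \<times> nc ?U)"
    proof (rule inj_onI, goal_cases)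
      case (1 p q)
      \<comment> \<open>The pair can be read off its union: the blocks inside \<open>?L\<close>
        belong to the first component, all others to the second.\<close>
      have parts: "fst r = {B \<in> fst r \<union> ins i x (snd r). B \<subseteq> ?L}"
        "ins i x (snd r) = {B \<in> fst r \<union> ins i x (snd r). \<not> B \<subseteq> ?L}"
        if r: "r \<in> nc ?L \<times> nc ?U" for r
      proof -
        have 1: "B \<subseteq> ?L" if "B \<in> fst r" for B
          using r that nc_subset[of "fst r" ?L B] by auto
        have 2: "\<not> B \<subseteq> ?L" if B: "B \<in> ins i x (snd r)" for B
        proof -
          have n: "ins i x (snd r) \<in> nc (insert x ?U)"
            using r nc_join_upper[OF assms(1,2)] by auto
          obtain z where "z \<in> B" using nc_nonempty[OF n B] by blast
          moreover have "z \<in> insert x ?U" using nc_subset[OF n B] \<open>z \<in> B\<close> by blast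
          ultimately show ?thesis using LU by blast
        qed
        show "fst r = {B \<in> fst r \<union> ins i x (snd r). B \<subseteq> ?L}"
          "ins i x (snd r) = {B \<in> fst r \<union> ins i x (snd r). \<not> B \<subseteq> ?L}"
          by (rule filter_Un[of "fst r" "\<lambda>B. B \<subseteq> ?L" "ins i x (snd r)", OF 1 2]; assumption)+
      qed
      have eq: "fst p \<union> ins i x (snd p) = fst q \<union> ins i x (snd q)"
        using 1(3) by simp
      have "fst p = fst q"
        by (subst parts(1)[OF 1(1)], subst eq, rule parts(1)[OF 1(2), symmetric])
      moreover have "ins i x (snd p) = ins i x (snd q)"
        by (subst parts(2)[OF 1(1)], subst eq, rule parts(2)[OF 1(2), symmetric])
      moreover have "snd p \<in> nc ?U" "snd q \<in> nc ?U" using 1 by auto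
      ultimately show ?case
        using inj_onD[OF inj_on_ins[OF U(5)]] by (simp add: prod_eq_iff)
    qed
  next
    fix p q assume pq: "p \<in> nc ?L \<times> nc ?U" "q \<in> nc ?L \<times> nc ?U"
      "prod_edge (edge k ?L) (edge k ?U) p q"
    then consider "edge k ?L (fst p) (fst q)" "snd p = snd q"
      | "edge k ?U (snd p) (snd q)" "fst p = fst q"
      by (auto simp: prod_edge_def)
    then show "edge k (insert x A) (fst p \<union> ins i x (snd p)) (fst q \<union> ins i x (snd q))"
    proof cases
      case 1
      then show ?thesis
        using edge_Un_upper[OF 1(1) nc_join_upper[OF assms(1,2)] LU] pq(2) unfolding eqA by auto
    next
      case 2
      have "edge k (insert x ?U) (ins i x (snd p)) (ins i x (snd q))"
        by (rule edge_ins[OF 2(1)]) (use U in auto)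
      then show ?thesis
        using edge_Un_lower[OF _ _ LU] pq(2) 2(2) unfolding eqA by auto
    qed
  next
    fix p assume p: "p \<in> nc ?L \<times> nc ?U"
    then have "card (fst p \<union> ins i x (snd p)) = card (fst p) + card (ins i x (snd p))"
      using assms(3) by (intro card_nc_Un[OF _ nc_join_upper[OF assms(1,2)] LU]) auto
    then show "card (fst p \<union> ins i x (snd p)) = card (fst p) + card (snd p)"
      using card_ins[OF _ U(5)] p by auto
  qed
qed

lemma card_split_at: "finite A \<Longrightarrow> card (A \<inter> {..<i}) + card (A \<inter> {i..}) = card (A :: nat set)"
  by (subst card_Un_disjoint[symmetric]) (auto intro!: arg_cong[where f = card])

text \<open>A split at a point strictly between the least and the largest one gives two nonempty
  halves, and their constants add up to card A + 1. The two extreme positions, where the largest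
  point is a singleton or lies with the least one, are off centre by one in opposite directions;
  together they form a product with a two-element chain, which is centred.\<close>

lemma nc_sym_dec:
  assumes "finite A" "A \<noteq> {}" "A \<subseteq> {..k}"
  shows "sym_dec (nc A) (edge k A) card (card A + 1)"
  using assms
proof (induction A rule: finite_psubset_induct)
  case (psubset A)
  obtain x A' where A: "A = insert x A'" "\<forall>y\<in>A'. y < x" "finite A'" "x \<notin> A'"
    using max_remove psubset.hyps psubset.prems(1) by metis
  have xk: "x \<le> k" using A psubset.prems(2) by auto
  show ?case
  proof (cases "A' = {}")
    case True
    have "nc A = {{{x}}}"
      using nc_top[of "{x}"] bmin_top_fiber[of "{}" x] nc_unique
      by (auto simp: True A(1) nc_empty elim!: nc_insert_cases[of _ x "{}", simplified])
    moreover have "sym_list (edge k A) card (card A + 1) [{{x}}]"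
      using True A by (simp add: sym_list_def)
    ultimately show ?thesis
      using sym_dec_list by fastforce
  next
    case False
    define a where "a = Min A'"
    have a: "a \<in> A'" "\<forall>y\<in>A'. a \<le> y" using False A(3) by (auto simp: a_def)
    have IH: "sym_dec (nc C) (edge k C) card (card C + 1)" if "C \<subseteq> A'" "C \<noteq> {}" for C
      using psubset.IH[of C] that psubset.prems(2) A(1,4) by blast
    have cA: "card A = Suc (card A')" using A by simp
    have 1: "sym_dec (insert {x} ` nc A' \<union> ins a x ` nc A') (edge k A) card (card A + 1)"
      using sym_dec_two_layers[OF IH[OF subset_refl False] subset_refl a(1) A(2) _ A(3)]
        a xk allowed_le by (simp add: cA A(1)[symmetric])
    have 2: "sym_dec (\<Union>i\<in>A' - {a}. joins A' i x) (edge k A) card (card A + 1)"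
    proof (rule sym_dec_UN)
      fix i assume i: "i \<in> A' - {a}"
      have L: "A' \<inter> {..<i} \<noteq> {}" using i a by (auto simp: less_le)
      have U: "A' \<inter> {i..} \<noteq> {}" using i by auto
      have "card (A' \<inter> {..<i}) + 1 + (card (A' \<inter> {i..}) + 1) = card A + 1"
        using card_split_at[OF A(3), of i] cA by simp
      then show "sym_dec (joins A' i x) (edge k A) card (card A + 1)"
        using sym_dec_joins[OF _ A(2,3) IH[OF _ L] IH[OF _ U]] i A(1) by auto
    next
      show "disjoint_family_on (\<lambda>i. joins A' i x) (A' - {a})"
        using joins_eq[OF _ A(2,3)] by (auto simp: disjoint_family_on_def)
    qed
    have f: "insert {x} ` nc A' = {\<sigma> \<in> nc A. bmin \<sigma> x = x}"
      "ins a x ` nc A' = {\<sigma> \<in> nc A. bmin \<sigma> x = a}"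
      using bmin_top_fiber[OF A(2,3)] bmin_bot_fiber[OF a A(2,3)] A(1) by auto
    have g: "(\<Union>i\<in>A' - {a}. joins A' i x) = {\<sigma> \<in> nc A. bmin \<sigma> x \<in> A' - {a}}"
      using joins_eq[OF _ A(2,3)] A(1) by auto
    have "bmin \<sigma> x \<in> A" if "\<sigma> \<in> nc A" for \<sigma>
      by (rule bmin_in[OF psubset.hyps that]) (simp add: A(1))
    then have "nc A = (insert {x} ` nc A' \<union> ins a x ` nc A') \<union> (\<Union>i\<in>A' - {a}. joins A' i x)"
      unfolding f g using A(1) by blast
    moreover have "(insert {x} ` nc A' \<union> ins a x ` nc A') \<inter> (\<Union>i\<in>A' - {a}. joins A' i x) = {}"
      unfolding f g using A(4) by auto
    ultimately show ?thesis
      using sym_dec_Un[OF 1 2] by simp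
  qed
qed

section \<open>Partitions on the admissible paths\<close>

text \<open>An invariant of paths from the bottom. A point m > k + 1 that is no longer a minimum was
  absorbed by a block containing m - 1. The point k + 1 can be absorbed only by a block without
  \<open>k\<close>, whose minimum is then below \<open>k\<close>, and later merges never raise the
  minimum of the block containing a point.\<close>

definition rising :: "nat \<Rightarrow> nat set set \<Rightarrow> bool" where
  "rising k \<sigma> \<longleftrightarrow> (\<forall>B\<in>\<sigma>. (\<forall>m\<in>B. k + 1 < m \<longrightarrow> m - 1 \<in> B \<or> Min B = m) \<and>
     (k + 1 \<in> B \<longrightarrow> Min B \<noteq> k))"

text \<open>A blocked partition lies on no path to the top: its block with minimum \<open>k + 1\<close> may only be
  merged into a block without \<open>k\<close>, and the union would cross the block of \<open>1\<close> and \<open>k\<close>.\<close>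

definition blocked :: "nat \<Rightarrow> nat set set \<Rightarrow> bool" where
  "blocked k \<sigma> \<longleftrightarrow> (\<exists>B\<in>\<sigma>. \<exists>C\<in>\<sigma>. Min B = k + 1 \<and> 1 \<in> C \<and> k \<in> C)"

lemma edge_rising:
  assumes "edge k A \<sigma> \<tau>" "finite A" "rising k \<sigma>"
  shows "rising k \<tau>"
proof -
  obtain B C where BC: "B \<in> \<sigma>" "C \<in> \<sigma>" "Min B < Min C" "allowed k B (Min C)"
    "\<tau> = insert (B \<union> C) (\<sigma> - {B, C})"
    using assms(1) by (auto simp: edge_def merge_def)
  have s: "\<sigma> \<in> nc A" using assms(1) by (simp add: edge_def)
  have fin: "finite B" "finite C" "B \<noteq> {}" "C \<noteq> {}"
    using nc_finite_block[OF assms(2) s] nc_nonempty[OF s] BC by auto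
  have M: "Min (B \<union> C) = Min B"
    using fin BC(3) by (simp add: Min_Un)
  have r: "\<And>m. m \<in> B \<Longrightarrow> k + 1 < m \<Longrightarrow> m - 1 \<in> B \<or> Min B = m" "k + 1 \<in> B \<Longrightarrow> Min B \<noteq> k"
    "\<And>m. m \<in> C \<Longrightarrow> k + 1 < m \<Longrightarrow> m - 1 \<in> C \<or> Min C = m" "k + 1 \<in> C \<Longrightarrow> Min C \<noteq> k"
    using assms(3) BC(1,2) by (auto simp: rising_def)
  have "m - 1 \<in> B \<union> C \<or> Min (B \<union> C) = m" if "m \<in> B \<union> C" "k + 1 < m" for m
    using that r(1)[of m] r(3)[of m] BC(4) M by (auto simp: allowed_def)
  moreover have "Min (B \<union> C) \<noteq> k" if "k + 1 \<in> B \<union> C"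
  proof
    assume "Min (B \<union> C) = k"
    then have k: "Min B = k" "k \<in> B" using M Min_in[OF fin(1,3)] by auto
    then have "k + 1 \<in> C" using that r(2) by auto
    then have "Min C \<le> k + 1" using fin by simp
    then have "Min C = k + 1" using BC(3) k by simp
    then show False using BC(4) k by (simp add: allowed_def)
  qed
  ultimately show ?thesis
    using assms(3) unfolding rising_def BC(5) by blast
qed

lemma edge_blocked:
  assumes "edge k A \<sigma> \<tau>" "finite A" "blocked k \<sigma>" "1 < k" "\<forall>a\<in>A. 1 \<le> a"
  shows "blocked k \<tau>"
proof -
  obtain B C where BC: "B \<in> \<sigma>" "C \<in> \<sigma>" "Min B < Min C" "allowed k B (Min C)"
    "\<tau> = insert (B \<union> C) (\<sigma> - {B, C})"
    using assms(1) by (auto simp: edge_def merge_def)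
  obtain D F where DF: "D \<in> \<sigma>" "F \<in> \<sigma>" "Min D = k + 1" "1 \<in> F" "k \<in> F"
    using assms(3) by (auto simp: blocked_def)
  have s: "\<sigma> \<in> nc A" and t: "\<tau> \<in> nc A" using assms(1) by (auto simp: edge_def)
  have fin: "finite X" "X \<noteq> {}" if "X \<in> \<sigma>" for X
    using nc_finite_block[OF assms(2) s that] nc_nonempty[OF s that] by auto
  have "C \<noteq> D"
  proof
    assume CD: "C = D"
    let ?b = "Min B"
    have kB: "k \<notin> B" using BC(4) DF(3) CD by (simp add: allowed_def)
    have bB: "?b \<in> B" using Min_in[OF fin[OF BC(1)]] .
    have "B \<noteq> F" using kB DF(5) by auto
    then have "1 \<notin> B" using nc_unique[OF s BC(1) DF(2)] DF(4) by blast
    moreover have "1 \<le> ?b" using bB nc_subset[OF s BC(1)] assms(5) by blast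
    \<comment> \<open>These bounds give the crossing 1 < \<open>?b\<close> < k < k + 1 of
      \<open>F\<close> and \<open>B \<union> C\<close>.\<close>
    ultimately have b: "1 < ?b" "?b < k"
      using bB kB BC(3) DF(3) CD by (metis le_neq_implies_less, metis Suc_eq_plus1 le_neq_implies_less less_Suc_eq_le)
    have "C \<noteq> F"
    proof
      assume "C = F"
      then have "Min C \<le> k" using DF(5) fin[OF BC(2)] by simp
      then show False using CD DF(3) by simp
    qed
    then have "F \<in> \<tau>" using BC(5) DF(2) \<open>B \<noteq> F\<close> by auto
    moreover have "B \<union> C \<in> \<tau>" using BC(5) by simp
    moreover have "k + 1 \<in> C" using Min_in[OF fin[OF BC(2)]] CD DF(3) by simp
    ultimately have "F = B \<union> C"
      using nc_noncrossing[OF t, of F "B \<union> C" 1 k ?b "k + 1"] DF(4,5) bB b by auto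
    then show False using DF(5) kB \<open>C \<noteq> F\<close> nc_unique[OF s BC(2) DF(2)] by blast
  qed
  have "\<exists>D'\<in>\<tau>. Min D' = k + 1"
  proof (cases "D = B")
    case True
    have "Min (B \<union> C) = Min B"
      using fin[OF BC(1)] fin[OF BC(2)] BC(3) by (simp add: Min_Un)
    then show ?thesis using BC(5) DF(3) True by auto
  next
    case False
    then show ?thesis using BC(5) DF(1,3) \<open>C \<noteq> D\<close> by auto
  qed
  moreover have "\<exists>F'\<in>\<tau>. F \<subseteq> F'"
    using BC(5) DF(2) by auto
  ultimately show ?thesis
    using DF(4,5) unfolding blocked_def by blast
qed

lemma conn_rising:
  assumes "conn k A \<sigma>" "finite A"
  shows "rising k \<sigma>"
proof -
  have "(edge k A)\<^sup>*\<^sup>* (singletons A) \<sigma>" using assms(1) by (simp add: conn_def)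
  then show ?thesis
  proof induction
    case base
    then show ?case by (auto simp: rising_def)
  next
    case (step \<sigma> \<tau>)
    then show ?case using edge_rising assms(2) by blast
  qed
qed

lemma conn_not_blocked:
  assumes "conn k A \<sigma>" "finite A" "1 < k" "\<forall>a\<in>A. 1 \<le> a" "1 \<in> A"
  shows "\<not> blocked k \<sigma>"
proof -
  have "(edge k A)\<^sup>*\<^sup>* \<sigma> {A}" using assms(1) by (simp add: conn_def)
  then show ?thesis
  proof (induction rule: converse_rtranclp_induct)
    case base
    have "Min A = 1" using assms by (intro Min_eqI) auto
    then show ?case using assms(3) by (simp add: blocked_def)
  next
    case (step \<sigma> \<tau>)
    then show ?case using edge_blocked assms(2-4) by blast
  qed
qed

section \<open>The base case n = k\<close>

lemma in_blk_minimum_iff: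
  assumes "\<sigma> \<in> nc A" "finite A" "a \<in> A" "\<forall>y\<in>A. a \<le> y" "x \<in> A"
  shows "x \<in> blk \<sigma> a \<longleftrightarrow> bmin \<sigma> x = a"
proof
  assume "x \<in> blk \<sigma> a"
  then have "blk \<sigma> x = blk \<sigma> a" by (rule blk_eq[OF assms(1) blk_in[OF assms(1,3)]])
  then show "bmin \<sigma> x = a"
    using bmin_eq_minimum[OF assms(2,1,3,4)] by (simp add: bmin_def)
next
  assume "bmin \<sigma> x = a"
  then have "a \<in> blk \<sigma> x" using bmin_in_blk[OF assms(2,1,5)] by simp
  then have "blk \<sigma> a = blk \<sigma> x" by (rule blk_eq[OF assms(1) blk_in[OF assms(1,5)]])
  then show "x \<in> blk \<sigma> a" using blk_mem[OF assms(1,5)] by simp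
qed

text \<open>The possible positions of k + 1 are: alone, with minimum 1, or with a minimum strictly
  between 1 and \<open>k\<close>. The last is covered by \<open>conn_join\<close>; in the first two,
  k + 1 can be attached to the block of 1 as long as \<open>k\<close> is not in it.\<close>

lemma conn_base:
  assumes "1 < k" "\<sigma> \<in> nc (insert (k + 1) {1..k})"
    and "bmin \<sigma> (k + 1) \<noteq> k" "\<not> (bmin \<sigma> (k + 1) = k + 1 \<and> bmin \<sigma> k = 1)"
  shows "conn k (insert (k + 1) {1..k}) \<sigma>"
proof -
  let ?A = "{1..k}" and ?x = "k + 1"
  have A: "finite ?A" "\<forall>y\<in>?A. y < ?x" "1 \<in> ?A" "\<forall>y\<in>?A. 1 \<le> y" "k \<in> ?A" "?A \<noteq> {}" "?A \<subseteq> {..k}"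
    using assms(1) by auto
  have A0: "insert k {1..<k} = ?A" using assms(1) by auto
  have conn_A: "conn k C \<tau>" if "\<tau> \<in> nc C" "C \<subseteq> ?A" "C \<noteq> {}" for C \<tau>
    by (rule nc_conn) (use that finite_subset[of C ?A] in auto)
  have two: "conn k (insert ?x ?A) (insert {?x} \<tau>)" "conn k (insert ?x ?A) (ins 1 ?x \<tau>)"
    if "\<tau> \<in> nc ?A" "bmin \<tau> k \<noteq> 1" for \<tau>
  proof -
    have "allowed k (blk \<tau> 1) ?x"
      using in_blk_minimum_iff[OF that(1) A(1,3,4,5)] that(2) by (simp add: allowed_def)
    then show "conn k (insert ?x ?A) (insert {?x} \<tau>)" "conn k (insert ?x ?A) (ins 1 ?x \<tau>)"
      using conn_layers[OF conn_A[OF that(1) subset_refl A(6)] A(3,2) _ A(1)] A(4) by blast+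
  qed
  from assms(2) show ?thesis
  proof (cases rule: nc_insert_cases[OF _ A(2,1), consumes 1, case_names single join])
    case single
    have "bmin \<sigma> k = bmin (\<sigma> - {{?x}}) k"
      by (subst single(3)) (rule bmin_insert_single(2)[OF single(2)], use assms(1) in auto)
    then show ?thesis using two(1)[OF single(2)] single(1,3) assms(4) by metis
  next
    case (join i \<sigma>1 \<sigma>2)
    have ik: "i < k" using join(1,2) assms(3) by (metis atLeastAtMost_iff le_neq_implies_less)
    show ?thesis
    proof (cases "i = 1")
      case False
      then have "1 \<in> ?A \<inter> {..<i}" using join(2) assms(1) by auto
      then have ne: "?A \<inter> {..<i} \<noteq> {}" by blast
      have "allowed k {i} ?x" using ik by (simp add: allowed_def)
      moreover have "?A \<inter> {i..} \<noteq> {}" using join(2) by auto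
      ultimately show ?thesis
        unfolding join(5) using ik
        by (intro conn_join[OF join(2) A(2,1) ne conn_A[OF join(3)] conn_A[OF join(4)]]) (use ne in auto)
    next
      case True
      then have e: "?A \<inter> {i..} = ?A" "?A \<inter> {..<i} = {}" by auto
      have s: "\<sigma> = ins 1 ?x \<sigma>2" "\<sigma>2 \<in> nc ?A"
        using join(3-5) True unfolding e by (auto simp: nc_empty)
      show ?thesis
      proof (cases "bmin \<sigma>2 k = 1")
        case False
        then show ?thesis using two(2)[OF s(2)] s(1) by simp
      next
        case b: True
        \<comment> \<open>Here \<open>k\<close> already lies with 1, so k + 1 cannot be attached
          last. The path attaches k + 1 to the block of 1 while \<open>k\<close> is a singleton, and
          adds \<open>k\<close> afterwards, which is a merge without conditions.\<close>
        have B: "1 \<in> {1..<k}" "\<forall>y\<in>{1..<k}. 1 \<le> y" "\<forall>y\<in>{1..<k}. y < k" "finite {1..<k}"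
          using assms(1) by auto
        have "\<sigma>2 \<in> {\<sigma> \<in> nc (insert k {1..<k}). bmin \<sigma> k = 1}"
          using s(2) b A0 by simp
        then obtain \<rho> where r: "\<rho> \<in> nc {1..<k}" "\<sigma>2 = ins 1 k \<rho>"
          using bmin_bot_fiber[OF B] by blast
        have att: "edge k ?A (insert {k} \<rho>) \<sigma>2"
          unfolding r(2) A0[symmetric]
          by (rule edge_attach[OF r(1) B(1,3) _ B(4)]) (use B(2) in \<open>auto simp: allowed_le\<close>)
        then have n: "insert {k} \<rho> \<in> nc ?A" by (simp add: edge_def)
        have "bmin (insert {k} \<rho>) k = k"
          by (rule bmin_insert_single(1)[OF r(1)]) auto
        then have "conn k (insert ?x ?A) (ins 1 ?x (insert {k} \<rho>))"
          using two(2)[OF n] assms(1) by simp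
        moreover have "edge k (insert ?x ?A) (ins 1 ?x (insert {k} \<rho>)) \<sigma>"
          unfolding s(1) using edge_ins[OF att A(3,2) _ A(1)] A(4) by blast
        moreover have "(edge k (insert ?x ?A))\<^sup>*\<^sup>* \<sigma> {insert ?x ?A}"
          using path_ins[OF _ A(3,2) _ A(1), of k \<sigma>2 "{?A}"] conn_A[OF s(2) subset_refl A(6)] A(4)
          unfolding s(1) conn_def ins_singleton[OF A(3)] by blast
        ultimately show ?thesis
          unfolding conn_def by (meson rtranclp.rtrancl_into_rtrancl)
      qed
    qed
  qed
qed

lemma rising_not_blocked_bmin:
  assumes "1 < k" "\<sigma> \<in> nc {1..k + 1}" "rising k \<sigma>" "\<not> blocked k \<sigma>"
  shows "bmin \<sigma> (k + 1) \<noteq> k" "\<not> (bmin \<sigma> (k + 1) = k + 1 \<and> bmin \<sigma> k = 1)"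
proof -
  have B: "blk \<sigma> y \<in> \<sigma>" "y \<in> blk \<sigma> y" if "y \<in> {1..k + 1}" for y
    using blk_in[OF assms(2) that] blk_mem[OF assms(2) that] by auto
  show "bmin \<sigma> (k + 1) \<noteq> k"
    using assms(3) B[of "k + 1"] by (auto simp: rising_def bmin_def)
  have "1 \<in> blk \<sigma> k" if "bmin \<sigma> k = 1"
    using bmin_in_blk[OF _ assms(2), of k] that assms(1) by simp
  then show "\<not> (bmin \<sigma> (k + 1) = k + 1 \<and> bmin \<sigma> k = 1)"
    using assms(1,4) B[of k] B[of "k + 1"] by (auto simp: blocked_def bmin_def)
qed

lemma conn_base_iff:
  assumes "1 < k"
  shows "conn k (insert (k + 1) {1..k}) \<sigma> \<longleftrightarrow> \<sigma> \<in> nc (insert (k + 1) {1..k}) \<and>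
    bmin \<sigma> (k + 1) \<noteq> k \<and> \<not> (bmin \<sigma> (k + 1) = k + 1 \<and> bmin \<sigma> k = 1)"
proof
  assume c: "conn k (insert (k + 1) {1..k}) \<sigma>"
  have e: "insert (k + 1) {1..k} = {1..k + 1}" by auto
  have "\<not> blocked k \<sigma>"
    by (rule conn_not_blocked[OF c]) (use assms in auto)
  moreover have "rising k \<sigma>" by (rule conn_rising[OF c]) simp
  moreover have "\<sigma> \<in> nc {1..k + 1}" using conn_nc[OF c] unfolding e .
  ultimately show "\<sigma> \<in> nc (insert (k + 1) {1..k}) \<and> bmin \<sigma> (k + 1) \<noteq> k \<and>
      \<not> (bmin \<sigma> (k + 1) = k + 1 \<and> bmin \<sigma> k = 1)"
    using rising_not_blocked_bmin[OF assms] unfolding e by blast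
qed (use conn_base[OF assms] in blast)

lemma fiber_insert_single:
  assumes "\<forall>y\<in>A. y < x" "finite A" "z \<in> A"
  shows "{\<sigma> \<in> nc (insert x A). bmin \<sigma> x = x \<and> bmin \<sigma> z = j} = insert {x} ` {\<sigma> \<in> nc A. bmin \<sigma> z = j}"
proof -
  have "x \<notin> A" using assms(1) by auto
  have "{\<sigma> \<in> nc (insert x A). bmin \<sigma> x = x \<and> bmin \<sigma> z = j} = {\<sigma> \<in> insert {x} ` nc A. bmin \<sigma> z = j}"
    using bmin_top_fiber[OF assms(1,2)] by auto
  also have "\<dots> = insert {x} ` {\<sigma> \<in> nc A. bmin (insert {x} \<sigma>) z = j}" by auto
  also have "\<dots> = insert {x} ` {\<sigma> \<in> nc A. bmin \<sigma> z = j}"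
    using bmin_insert_single(2)[OF _ \<open>x \<notin> A\<close> assms(3)] by (intro image_cong) auto
  finally show ?thesis .
qed

lemma fiber_ins:
  assumes "a \<in> A" "\<forall>y\<in>A. a \<le> y" "\<forall>y\<in>A. y < x" "finite A" "z \<in> A"
  shows "{\<sigma> \<in> nc (insert x A). bmin \<sigma> x = a \<and> bmin \<sigma> z = j} = ins a x ` {\<sigma> \<in> nc A. bmin \<sigma> z = j}"
proof -
  have "{\<sigma> \<in> nc (insert x A). bmin \<sigma> x = a \<and> bmin \<sigma> z = j} = {\<sigma> \<in> ins a x ` nc A. bmin \<sigma> z = j}"
    using bmin_bot_fiber[OF assms(1-4)] by auto
  also have "\<dots> = ins a x ` {\<sigma> \<in> nc A. bmin (ins a x \<sigma>) z = j}" by auto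
  also have "\<dots> = ins a x ` {\<sigma> \<in> nc A. bmin \<sigma> z = j}"
    using bmin_ins(2)[OF _ assms(1,3) _ assms(4,5)] assms(2) by (intro image_cong) auto
  finally show ?thesis .
qed

text \<open>The partitions are sorted by the pair of minima of the blocks of k + 1 and
  \<open>k\<close>, recorded in \<open>H\<close>. Absent are the pairs with first entry
  \<open>k\<close> and the pair (k + 1, 1). Every remaining piece has the constant k + 2, that is,
  rank sum \<open>k\<close>.\<close>

lemma sym_dec_base:
  assumes "1 < k"
  shows "sym_dec {\<sigma>. conn k (insert (k + 1) {1..k}) \<sigma>} (edge k (insert (k + 1) {1..k})) card (k + 2)"
proof -
  define a :: nat where "a = 1"
  define x A A0 where "x = k + 1" and "A = {1..k}" and "A0 = {1..<k}"
  note defs = a_def x_def A_def A0_def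
  let ?X = "insert x A"
  define G where "G = (\<lambda>j. {\<sigma> \<in> nc A. bmin \<sigma> k = j})"
  define H where "H = (\<lambda>i j. {\<sigma> \<in> nc ?X. bmin \<sigma> x = i \<and> bmin \<sigma> k = j})"
  have A: "a \<in> A" "\<forall>y\<in>A. a \<le> y" "\<forall>y\<in>A. y < x" "finite A" "k \<in> A" "A \<subseteq> {..k}"
    using assms by (auto simp: defs)
  have A0: "a \<in> A0" "\<forall>y\<in>A0. a \<le> y" "\<forall>y\<in>A0. y < k" "finite A0" "A0 \<subseteq> {..k}"
    using assms by (auto simp: defs)
  have ins_A0: "insert k A0 = A" using assms by (auto simp: defs)
  have ak: "a \<noteq> k" "a \<noteq> x" "k \<noteq> x" "a < k" "k < x" using assms by (auto simp: defs)
  have xA: "x \<notin> A" using A(3) by blast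
  have kA0: "k \<notin> A0" using A0(3) by blast
  have dec: "sym_dec (nc C) (edge k C) card (card C + 1)" if "C \<subseteq> A" "C \<noteq> {}" for C
    by (rule nc_sym_dec) (use that A(4,6) finite_subset[of C A] in auto)
  have H_top: "H x j = insert {x} ` G j" and H_bot: "H a j = ins a x ` G j" for j
    unfolding H_def G_def
    using fiber_insert_single[OF A(3,4,5), of j] fiber_ins[OF A(1-5), of j] by blast+
  have G_top: "G k = insert {k} ` nc A0"
    using bmin_top_fiber[OF A0(3,4)] by (simp add: G_def ins_A0)
  have G_bot: "G a = ins a k ` nc A0"
    using bmin_bot_fiber[OF A0(1-4)] by (simp add: G_def ins_A0)
  have G_mid: "G j = joins A0 j k" if "j \<in> A0" for j
    using joins_eq[OF that A0(3,4)] by (simp add: G_def ins_A0)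
  have ok: "allowed k (blk \<sigma> a) x" if "\<sigma> \<in> nc A" "bmin \<sigma> k \<noteq> a" for \<sigma>
    using in_blk_minimum_iff[OF that(1) A(4,1,2,5)] that(2) by (simp add: allowed_def x_def)
  have chain: "sym_dec (H x k \<union> H a k \<union> H a a) (edge k ?X) card (k + 2)"
  proof -
    \<comment> \<open>The three layers are the corners left of the square: \<open>k\<close> and k +
      1 both alone, k + 1 with 1, both with 1. The order is forced, as k + 1 may not enter a block
      that contains \<open>k\<close>.\<close>
    define f where "f = (\<lambda>l::nat. if l = 0 then insert {x} \<circ> insert {k}
      else if l = 1 then ins a x \<circ> insert {k} else ins a x \<circ> ins a k)"
    have nc1: "insert {k} \<sigma> \<in> nc A" "ins a k \<sigma> \<in> nc A" if "\<sigma> \<in> nc A0" for \<sigma>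
      using nc_insert_single[OF that kA0] nc_ins[OF that A0(1,3)] A0(2) by (simp_all add: ins_A0)
    have "sym_dec (\<Union>l\<le>2. f l ` nc A0) (edge k ?X) card (card A0 + 1 + 2)"
    proof (rule sym_dec_layers[OF dec])
      show "card \<sigma> = Suc (card \<tau>)" if "edge k A0 \<sigma> \<tau>" for \<sigma> \<tau>
        using edge_card[OF that A0(4)] .
      show "edge k ?X (f l \<sigma>) (f l \<tau>)" if "edge k A0 \<sigma> \<tau>" for l \<sigma> \<tau>
      proof -
        have "edge k A (insert {k} \<sigma>) (insert {k} \<tau>)" "edge k A (ins a k \<sigma>) (ins a k \<tau>)"
          using edge_insert_single[OF that A0(3)] edge_ins[OF that A0(1,3) _ A0(4)] A0(2)
          by (simp_all add: ins_A0)
        then show ?thesis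
          using edge_insert_single[OF _ A(3)] edge_ins[OF _ A(1,3) _ A(4)] A(2) by (simp add: f_def)
      qed
      show "edge k ?X (f l \<sigma>) (f (Suc l) \<sigma>)" if "l < 2" "\<sigma> \<in> nc A0" for l \<sigma>
      proof -
        have "bmin (insert {k} \<sigma>) k \<noteq> a"
          using bmin_insert_single(1)[OF that(2) kA0] ak by simp
        then have "edge k ?X (f 0 \<sigma>) (f 1 \<sigma>)"
          using edge_attach[OF nc1(1)[OF that(2)] A(1,3) _ A(4) ok] A(2) nc1(1)[OF that(2)]
          by (simp add: f_def)
        moreover have "edge k A (insert {k} \<sigma>) (ins a k \<sigma>)"
          using edge_attach[OF that(2) A0(1,3) _ A0(4), of k] A0(2) by (simp add: ins_A0 allowed_le)
        then have "edge k ?X (f 1 \<sigma>) (f 2 \<sigma>)"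
          using edge_ins[OF _ A(1,3) _ A(4)] A(2) by (simp add: f_def)
        moreover have "l = 0 \<or> l = 1" using that(1) by auto
        ultimately show ?thesis by (auto simp: numeral_2_eq_2)
      qed
      show "card (f l \<sigma>) = card \<sigma> + (2 - l)" if "l \<le> 2" "\<sigma> \<in> nc A0" for l \<sigma>
      proof -
        have "card (insert {k} \<sigma>) = card \<sigma> + 1" "card (ins a k \<sigma>) = card \<sigma>"
          using card_insert_single[OF A0(4) that(2) kA0] card_ins[OF that(2) kA0] by simp_all
        moreover have "l = 0 \<or> l = 1 \<or> l = 2" using that(1) by auto
        ultimately show ?thesis
          using card_insert_single[OF A(4) nc1(1)[OF that(2)] xA] card_ins[OF nc1(1)[OF that(2)] xA]
            card_ins[OF nc1(2)[OF that(2)] xA] by (auto simp: f_def)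
      qed
      \<comment> \<open>The sum of the two minima identifies the layer, because x + k, a + k and a +
        a are different for a < k < x.\<close>
      have key: "bmin (f l \<sigma>) x + bmin (f l \<sigma>) k = (if l = 0 then x + k else if l = 1 then a + k else a + a)"
        if "\<sigma> \<in> nc A0" for l \<sigma>
      proof -
        have "f 0 \<sigma> \<in> H x k" "f 1 \<sigma> \<in> H a k" "f 2 \<sigma> \<in> H a a"
          unfolding H_top H_bot G_top G_bot using that by (auto simp: f_def)
        moreover have "f l = (if l = 0 then f 0 else if l = 1 then f 1 else f 2)"
          by (simp add: f_def)
        ultimately show ?thesis by (simp add: H_def)
      qed
      show "l = m \<and> \<sigma> = \<tau>"
        if "l \<le> 2" "m \<le> 2" "\<sigma> \<in> nc A0" "\<tau> \<in> nc A0" "f l \<sigma> = f m \<tau>" for l m \<sigma> \<tau>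
      proof -
        have lm: "l = m"
          using key[OF that(3), of l] key[OF that(4), of m] that(1,2,5) ak
          by (auto split: if_splits)
        have "inj_on (f l) (nc A0)"
          unfolding f_def using nc1
          by (auto intro!: comp_inj_on inj_on_ins[OF kA0] inj_on_insert_single[OF kA0]
              inj_on_subset[OF inj_on_ins[OF xA]] inj_on_subset[OF inj_on_insert_single[OF xA]])
        then show ?thesis using that lm by (auto dest: inj_onD)
      qed
    qed (use ins_A0 A0(1) in auto)
    moreover have "(\<Union>l\<le>2. f l ` nc A0) = H x k \<union> H a k \<union> H a a"
      unfolding H_top H_bot G_top G_bot
      by (simp add: f_def atMost_Suc numeral_2_eq_2 image_comp Un_ac)
    moreover have "card A0 + 1 + 2 = k + 2" using assms by (simp add: A0_def)
    ultimately show ?thesis by simp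
  qed
  \<comment> \<open>Here the block of \<open>k\<close> has a minimum \<open>j\<close> strictly
    between 1 and \<open>k\<close>. The block of 1 then avoids \<open>k\<close>, so k + 1 may be
    alone or attached to 1, which gives the factor of two layers.\<close>
  have squares: "sym_dec (\<Union>j\<in>A0 - {a}. H x j \<union> H a j) (edge k ?X) card (k + 2)"
  proof (rule sym_dec_UN)
    fix j assume j: "j \<in> A0 - {a}"
    then have jA0: "j \<in> A0" by auto
    have "a \<in> A0 \<inter> {..<j}" "j \<in> A0 \<inter> {j..}" using j A0(1,2) by (auto simp: less_le)
    then have ne: "A0 \<inter> {..<j} \<noteq> {}" "A0 \<inter> {j..} \<noteq> {}" by blast+
    have sub: "A0 \<inter> {..<j} \<subseteq> A" "A0 \<inter> {j..} \<subseteq> A" using ins_A0 by auto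
    have "sym_dec (G j) (edge k A) card (card (A0 \<inter> {..<j}) + 1 + (card (A0 \<inter> {j..}) + 1))"
      using sym_dec_joins[OF jA0 A0(3,4) dec[OF sub(1) ne(1)] dec[OF sub(2) ne(2)]]
      unfolding G_mid[OF jA0] ins_A0 .
    moreover have "card (A0 \<inter> {..<j}) + 1 + (card (A0 \<inter> {j..}) + 1) = k + 1"
      using card_split_at[OF A0(4), of j] assms by (simp add: A0_def)
    ultimately have "sym_dec (G j) (edge k A) card (k + 1)" by simp
    from sym_dec_two_layers[OF this _ A(1,3) _ A(4)]
    show "sym_dec (H x j \<union> H a j) (edge k ?X) card (k + 2)"
      unfolding H_top H_bot using ok j A(2) by (simp add: G_def subset_iff)
  qed (auto simp: disjoint_family_on_def H_def)
  \<comment> \<open>Here the block of k + 1 has a minimum strictly between 1 and \<open>k\<close>.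
    The edges used inside these pieces come from the two halves of {1..k}, so they never lose the
    minimum k + 1 and carry no condition.\<close>
  have rest: "sym_dec (\<Union>i\<in>A0 - {a}. joins A i x) (edge k ?X) card (k + 2)"
  proof (rule sym_dec_UN)
    fix i assume i: "i \<in> A0 - {a}"
    then have iA: "i \<in> A" using ins_A0 by auto
    have "a \<in> A \<inter> {..<i}" "i \<in> A \<inter> {i..}" using i iA A(1,2) by (auto simp: less_le)
    then have ne: "A \<inter> {..<i} \<noteq> {}" "A \<inter> {i..} \<noteq> {}" by blast+
    have "sym_dec (joins A i x) (edge k ?X) card (card (A \<inter> {..<i}) + 1 + (card (A \<inter> {i..}) + 1))"
      using sym_dec_joins[OF iA A(3,4) dec[OF _ ne(1)] dec[OF _ ne(2)]] by blast
    moreover have "card (A \<inter> {..<i}) + 1 + (card (A \<inter> {i..}) + 1) = k + 2"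
      using card_split_at[OF A(4), of i] by (simp add: A_def)
    ultimately show "sym_dec (joins A i x) (edge k ?X) card (k + 2)" by simp
  next
    show "disjoint_family_on (\<lambda>i. joins A i x) (A0 - {a})"
      using joins_eq[OF _ A(3,4)] ins_A0 by (auto simp: disjoint_family_on_def)
  qed
  have joins_H: "(\<Union>i\<in>A0 - {a}. joins A i x) = {\<sigma> \<in> nc ?X. bmin \<sigma> x \<in> A0 - {a}}"
    using joins_eq[OF _ A(3,4)] ins_A0 by auto
  have "sym_dec ((H x k \<union> H a k \<union> H a a) \<union> (\<Union>j\<in>A0 - {a}. H x j \<union> H a j)) (edge k ?X) card (k + 2)"
    by (rule sym_dec_Un[OF chain squares]) (use ak kA0 in \<open>auto simp: H_def\<close>)
  then have "sym_dec ((H x k \<union> H a k \<union> H a a) \<union> (\<Union>j\<in>A0 - {a}. H x j \<union> H a j) \<union>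
      (\<Union>i\<in>A0 - {a}. joins A i x)) (edge k ?X) card (k + 2)"
    by (rule sym_dec_Un[OF _ rest]) (use xA ins_A0 in \<open>auto simp: H_def joins_H\<close>)
  moreover have "{\<sigma>. conn k ?X \<sigma>} = (H x k \<union> H a k \<union> H a a) \<union> (\<Union>j\<in>A0 - {a}. H x j \<union> H a j) \<union>
      (\<Union>i\<in>A0 - {a}. joins A i x)" (is "_ = ?R")
  proof (rule set_eqI)
    fix \<sigma>
    have conn: "conn k ?X \<sigma> \<longleftrightarrow> \<sigma> \<in> nc ?X \<and> bmin \<sigma> x \<noteq> k \<and> \<not> (bmin \<sigma> x = x \<and> bmin \<sigma> k = a)"
      using conn_base_iff[OF assms] unfolding a_def x_def A_def .
    have R: "\<sigma> \<in> ?R \<longleftrightarrow> \<sigma> \<in> nc ?X \<and> (bmin \<sigma> x \<in> A0 - {a} \<or>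
        (bmin \<sigma> x = x \<or> bmin \<sigma> x = a) \<and> (bmin \<sigma> k = k \<or> bmin \<sigma> k \<in> A0 - {a}) \<or>
        bmin \<sigma> x = a \<and> bmin \<sigma> k = a)"
      unfolding joins_H H_def Un_iff UN_iff mem_Collect_eq by blast
    have ni: "k \<notin> A0 - {a}" "x \<notin> A0 - {a}" "a \<notin> A0 - {a}" using kA0 xA ins_A0 by auto
    show "\<sigma> \<in> {\<sigma>. conn k ?X \<sigma>} \<longleftrightarrow> \<sigma> \<in> ?R"
    proof (cases "\<sigma> \<in> nc ?X")
      case True
      have "bmin \<sigma> x \<in> ?X" "bmin \<sigma> k \<in> ?X" "bmin \<sigma> k \<noteq> x"
        using bmin_in[OF _ True, of x] bmin_in[OF _ True, of k] bmin_le[OF _ True, of k] A(3-5) by auto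
      then have "bmin \<sigma> x = x \<or> bmin \<sigma> x = a \<or> bmin \<sigma> x = k \<or> bmin \<sigma> x \<in> A0 - {a}"
        "bmin \<sigma> k = a \<or> bmin \<sigma> k = k \<or> bmin \<sigma> k \<in> A0 - {a}"
        using ins_A0 by auto
      then show ?thesis
        unfolding mem_Collect_eq conn R using True ak(1-3) ni by metis
    next
      case False
      then show ?thesis
        unfolding mem_Collect_eq conn R by blast
    qed
  qed
  ultimately show ?thesis unfolding x_def A_def by simp
qed

section \<open>Adding one point beyond k + 1\<close>

lemma ins_of_remove:
  assumes "\<sigma> \<in> nc (insert x A)" "i \<in> A" "x \<notin> A" "i \<in> blk \<sigma> x"
  shows "ins i x ((\<lambda>B. B - {x}) ` \<sigma>) = \<sigma>"
proof -
  have B: "blk \<sigma> x \<in> \<sigma>" "x \<in> blk \<sigma> x"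
    using blk_in[OF assms(1)] blk_mem[OF assms(1)] by auto
  have ix: "i \<noteq> x" using assms(2,3) by auto
  have "(if i \<in> C - {x} then insert x (C - {x}) else C - {x}) = C" if "C \<in> \<sigma>" for C
  proof (cases "C = blk \<sigma> x")
    case True
    then show ?thesis using assms(4) B ix by auto
  next
    case False
    then have "x \<notin> C" "i \<notin> C"
      using nc_unique[OF assms(1) that B(1)] B(2) assms(4) by auto
    then show ?thesis by auto
  qed
  then show ?thesis unfolding ins_def image_image by simp
qed

text \<open>For the point n + 2 > k + 1, \<open>rising\<close> leaves two possibilities: it is the
  minimum of its block, hence a singleton, or it lies with n + 1. Deleting the largest point alters
  no other minimum, so both conditions pass to the smaller partition.\<close>

lemma last_point_cases:
  assumes "k \<le> n" "\<sigma> \<in> nc (insert (n + 2) {1..n + 1})" "rising k \<sigma>" "\<not> blocked k \<sigma>"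
  obtains \<tau> where "\<tau> \<in> nc {1..n + 1}" "rising k \<tau>" "\<not> blocked k \<tau>"
    "\<sigma> = insert {n + 2} \<tau> \<or> \<sigma> = ins (n + 1) (n + 2) \<tau>"
proof -
  let ?A = "{1..n + 1}" and ?x = "n + 2"
  note s = assms(2)
  have A: "n + 1 \<in> ?A" "\<forall>y\<in>?A. y < ?x" "finite ?A" "?x \<notin> ?A" by auto
  let ?B = "blk \<sigma> ?x"
  have B: "?B \<in> \<sigma>" "?x \<in> ?B" using blk_in[OF s] blk_mem[OF s] by auto
  have up: "\<And>C m. C \<in> \<sigma> \<Longrightarrow> m \<in> C \<Longrightarrow> k + 1 < m \<Longrightarrow> m - 1 \<in> C \<or> Min C = m"
    "\<And>C. C \<in> \<sigma> \<Longrightarrow> k + 1 \<in> C \<Longrightarrow> Min C \<noteq> k"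
    using assms(3) unfolding rising_def by blast+
  show thesis
  proof (cases "Min ?B = ?x")
    case True
    then have bx: "bmin \<sigma> ?x = ?x" by (simp add: bmin_def)
    then have "\<sigma> \<in> insert {?x} ` nc ?A"
      using bmin_top_fiber[OF A(2,3)] s by blast
    then obtain \<tau> where t: "\<tau> \<in> nc ?A" "\<sigma> = insert {?x} \<tau>" by blast
    then have "rising k \<tau>" "\<not> blocked k \<tau>"
      using assms(3,4) by (auto simp: rising_def blocked_def)
    then show thesis using that t by blast
  next
    case False
    then have nB: "n + 1 \<in> ?B" using up(1)[OF B] assms(1) by auto
    have single: "{?x} \<notin> \<sigma>"
    proof
      assume "{?x} \<in> \<sigma>"
      then have "{?x} = ?B" using nc_unique[OF s _ B(1)] B(2) by blast
      then show False using nB by (metis Suc_n_not_n add_2_eq_Suc' add.commute plus_1_eq_Suc singletonD)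
    qed
    define \<tau> where "\<tau> = (\<lambda>C. C - {?x}) ` \<sigma>"
    have t: "\<tau> \<in> nc ?A" unfolding \<tau>_def by (rule nc_remove[OF s A(4) single])
    have st: "\<sigma> = ins (n + 1) ?x \<tau>"
      unfolding \<tau>_def using ins_of_remove[OF s A(1,4) nB] by simp
    have M: "Min (C - {?x}) = Min C" if "C \<in> \<sigma>" for C
    proof (cases "?x \<in> C")
      case True
      let ?D = "C - {?x}"
      have "?D \<noteq> {}" using single that True by (metis insert_Diff)
      moreover have "finite ?D" using nc_finite_block[OF _ s that] by simp
      moreover have "\<forall>y\<in>?D. y < ?x" using nc_subset[OF s that] by auto
      ultimately show ?thesis
        using Min_insert_greater[of ?D ?x] insert_Diff[OF True] by simp
    qed simp
    have "rising k \<tau>"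
      unfolding rising_def \<tau>_def
    proof (intro ballI conjI impI, goal_cases)
      case (1 D m)
      then obtain C where C: "C \<in> \<sigma>" "D = C - {?x}" by auto
      have "m < ?x" using 1 C nc_subset[OF s C(1)] by auto
      then show ?case using up(1)[OF C(1), of m] 1 C M[OF C(1)] by auto
    next
      case (2 D)
      then obtain C where C: "C \<in> \<sigma>" "D = C - {?x}" by auto
      then show ?case using up(2)[OF C(1)] 2 M[OF C(1)] by auto
    qed
    moreover have "\<not> blocked k \<tau>"
    proof
      assume "blocked k \<tau>"
      then obtain C D where "C \<in> \<sigma>" "D \<in> \<sigma>" "Min (C - {?x}) = k + 1" "1 \<in> D" "k \<in> D"
        by (auto simp: blocked_def \<tau>_def)
      then show False using assms(4) M by (auto simp: blocked_def)
    qed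
    ultimately show thesis using that t st by blast
  qed
qed

text \<open>The block of n + 1 contains m - 1 for m = n + 2, so attaching n + 2 to it is always
  admissible.\<close>

lemma conn_last_point:
  assumes "k \<le> n" "conn k {1..n + 1} \<tau>"
  shows "conn k (insert (n + 2) {1..n + 1}) (insert {n + 2} \<tau>)"
    "conn k (insert (n + 2) {1..n + 1}) (ins (n + 1) (n + 2) \<tau>)"
proof -
  have A: "n + 1 \<in> {1..n + 1}" "\<forall>y\<in>{1..n + 1}. y < n + 2" "finite {1..n + 1}"
    "(\<forall>y\<in>{1..n + 1}. n + 1 \<le> y) \<or> (\<forall>y\<in>{1..n + 1}. y \<le> n + 1)"
    by auto
  have "allowed k (blk \<tau> (n + 1)) (n + 2)"
    using blk_mem[OF conn_nc[OF assms(2)] A(1)] assms(1) by (auto simp: allowed_def)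
  then show "conn k (insert (n + 2) {1..n + 1}) (insert {n + 2} \<tau>)"
    "conn k (insert (n + 2) {1..n + 1}) (ins (n + 1) (n + 2) \<tau>)"
    using conn_layers[OF assms(2) A(1,2,4,3)] by blast+
qed

lemma insert_last: "insert (n + 2) {1..n + 1} = {1..Suc n + 1}"
  by auto

text \<open>With \<open>conn_imp\<close> this describes the elements of the poset without mentioning
  paths. It is what makes the deletion of the largest point lead back into the smaller
  poset.\<close>

lemma rising_not_blocked_conn:
  assumes "1 < k" "k \<le> n" "\<sigma> \<in> nc {1..n + 1}" "rising k \<sigma>" "\<not> blocked k \<sigma>"
  shows "conn k {1..n + 1} \<sigma>"
  using assms(2-5)
proof (induction n arbitrary: \<sigma> rule: dec_induct)
  case base
  have e: "insert (k + 1) {1..k} = {1..k + 1}" by auto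
  show ?case
    using conn_base[OF assms(1), of \<sigma>] rising_not_blocked_bmin[OF assms(1) base] base(1)
    unfolding e by blast
next
  case (step n)
  have s: "\<sigma> \<in> nc (insert (n + 2) {1..n + 1})"
    using step.prems(1) unfolding insert_last .
  obtain \<tau> where t: "\<tau> \<in> nc {1..n + 1}" "rising k \<tau>" "\<not> blocked k \<tau>"
    "\<sigma> = insert {n + 2} \<tau> \<or> \<sigma> = ins (n + 1) (n + 2) \<tau>"
    using last_point_cases[OF step.hyps(1) s step.prems(2,3)] .
  show ?case
    using conn_last_point[OF step.hyps(1) step.IH[OF t(1-3)]] t(4) unfolding insert_last by blast
qed

lemma conn_imp:
  assumes "1 < k" "conn k {1..n + 1} \<sigma>"
  shows "\<sigma> \<in> nc {1..n + 1}" "rising k \<sigma>" "\<not> blocked k \<sigma>"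
  using conn_nc[OF assms(2)] conn_rising[OF assms(2)] conn_not_blocked[OF assms(2) _ assms(1)] by auto

lemma sym_dec_conn:
  assumes "1 < k" "k \<le> n"
  shows "sym_dec {\<sigma>. conn k {1..n + 1} \<sigma>} (edge k {1..n + 1}) card (n + 2)"
  using assms(2)
proof (induction n rule: dec_induct)
  case base
  have "insert (k + 1) {1..k} = {1..k + 1}" by auto
  then show ?case using sym_dec_base[OF assms(1)] by simp
next
  case (step n)
  let ?S = "{\<sigma>. conn k {1..n + 1} \<sigma>}"
  have A: "n + 1 \<in> {1..n + 1}" "\<forall>y\<in>{1..n + 1}. y < n + 2" "finite {1..n + 1}"
    "(\<forall>y\<in>{1..n + 1}. n + 1 \<le> y) \<or> (\<forall>y\<in>{1..n + 1}. y \<le> n + 1)"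
    by auto
  have "sym_dec (insert {n + 2} ` ?S \<union> ins (n + 1) (n + 2) ` ?S)
      (edge k (insert (n + 2) {1..n + 1})) card (Suc (n + 2))"
  proof (rule sym_dec_two_layers[OF step.IH _ A(1,2,4,3)])
    show "allowed k (blk \<tau> (n + 1)) (n + 2)" if "\<tau> \<in> ?S" for \<tau>
      using blk_mem[OF conn_nc[of k _ \<tau>] A(1)] that step.hyps(1) by (auto simp: allowed_def)
  qed (use conn_nc in auto)
  moreover have "insert {n + 2} ` ?S \<union> ins (n + 1) (n + 2) ` ?S = {\<sigma>. conn k {1..Suc n + 1} \<sigma>}"
  proof (intro equalityI subsetI)
    fix \<sigma> assume "\<sigma> \<in> insert {n + 2} ` ?S \<union> ins (n + 1) (n + 2) ` ?S"
    then show "\<sigma> \<in> {\<sigma>. conn k {1..Suc n + 1} \<sigma>}"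
      using conn_last_point[OF step.hyps(1)] unfolding insert_last by blast
  next
    fix \<sigma> assume "\<sigma> \<in> {\<sigma>. conn k {1..Suc n + 1} \<sigma>}"
    then have "conn k {1..Suc n + 1} \<sigma>" by simp
    note c = conn_imp[OF assms(1) this]
    obtain \<tau> where t: "\<tau> \<in> nc {1..n + 1}" "rising k \<tau>" "\<not> blocked k \<tau>"
      "\<sigma> = insert {n + 2} \<tau> \<or> \<sigma> = ins (n + 1) (n + 2) \<tau>"
      using last_point_cases[OF step.hyps(1) c(1)[folded insert_last] c(2,3)] .
    then show "\<sigma> \<in> insert {n + 2} ` ?S \<union> ins (n + 1) (n + 2) ` ?S"
      using rising_not_blocked_conn[OF assms(1) step.hyps(1) t(1-3)] by blast
  qed
  ultimately show ?case unfolding insert_last by simp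
qed

section \<open>Convex hulls of points on a circle\<close>

text \<open>Twice the signed area of the triangle, positive when \<open>p\<close>, \<open>q\<close>,
  \<open>r\<close> run clockwise, which is the orientation of \<open>circle_point\<close>.\<close>

definition tri :: "complex \<Rightarrow> complex \<Rightarrow> complex \<Rightarrow> real" where
  "tri p q r = (Re r - Re p) * (Im q - Im p) - (Im r - Im p) * (Re q - Re p)"

text \<open>The expression equals 4 sin(s/2) sin(t/2) sin((s+t)/2), and all three angles lie
  strictly between 0 and pi.\<close>

lemma sin_triangle_pos:
  fixes s t :: real
  assumes "0 < s" "0 < t" "s + t < 2 * pi"
  shows "0 < sin s + sin t - sin (s + t)"
proof -
  define x y where "x = s / 2" and "y = t / 2"
  have st: "s = 2 * x" "t = 2 * y" by (simp_all add: x_def y_def)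
  have "sin s + sin t - sin (s + t) = 4 * sin x * sin y * sin (x + y)"
  proof -
    have "sin (2 * x) + sin (2 * y) = 2 * sin (x + y) * cos (x - y)"
    proof -
      have "(2 * x + 2 * y) / 2 = x + y" "(2 * x - 2 * y) / 2 = x - y" by simp_all
      then show ?thesis using sin_plus_sin[of "2 * x" "2 * y"] by (simp only:)
    qed
    moreover have "sin (2 * x + 2 * y) = 2 * sin (x + y) * cos (x + y)"
      using sin_double[of "x + y"] by (simp add: algebra_simps)
    moreover have "cos (x - y) - cos (x + y) = 2 * (sin x * sin y)"
      by (simp add: cos_diff cos_add)
    ultimately show ?thesis
      unfolding st by (simp add: algebra_simps flip: right_diff_distrib)
  qed
  moreover have "0 < sin x" "0 < sin y" "0 < sin (x + y)"
    using assms st by (auto intro!: sin_gt_zero)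
  ultimately show ?thesis by simp
qed

lemma tri_circle_point_pos:
  assumes "1 \<le> a" "a < b" "b < c" "c \<le> m"
  shows "0 < tri (circle_point m a) (circle_point m b) (circle_point m c)"
proof -
  define f where "f = (\<lambda>j::nat. 2 * pi * real j / real m)"
  have m: "0 < real m" using assms by simp
  have coords: "Re (circle_point m j) = cos (f j)" "Im (circle_point m j) = - sin (f j)" for j
    by (simp_all add: circle_point_def f_def)
  have "tri (circle_point m a) (circle_point m b) (circle_point m c)
    = sin (f b - f a) + sin (f c - f b) - sin (f c - f a)"
    by (simp add: tri_def coords sin_diff algebra_simps)
  moreover have "0 < f b - f a" "0 < f c - f b"
    using assms m by (simp_all add: f_def divide_strict_right_mono)
  \<comment> \<open>As \<open>a\<close> is at least 1 and \<open>c\<close> at most \<open>m\<close>,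
    the arc from \<open>a\<close> to \<open>c\<close> is less than a full turn.\<close>
  moreover have "f b - f a + (f c - f b) < 2 * pi"
  proof -
    have "f c - f a = 2 * pi * (real c - real a) / real m"
      unfolding f_def by (simp only: diff_divide_distrib right_diff_distrib)
    also have "\<dots> = 2 * pi * ((real c - real a) / real m)" by simp
    also have "\<dots> < 2 * pi * 1"
      by (rule mult_strict_left_mono) (use assms m in simp_all)
    finally show ?thesis by simp
  qed
  ultimately show ?thesis
    using sin_triangle_pos[of "f b - f a" "f c - f b"] by simp
qed

text \<open>The affine dependency between four points in the plane has the areas of the four triangles
  as coefficients, with alternating signs; it exhibits the intersection of the diagonals.\<close>

lemma crossing_hulls:
  assumes "1 \<le> a" "a < b" "b < c" "c < d" "d \<le> m" "a \<in> B" "c \<in> B" "b \<in> C" "d \<in> C"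
  shows "convex hull (circle_point m ` B) \<inter> convex hull (circle_point m ` C) \<noteq> {}"
proof -
  define p where "p = circle_point m"
  define u v w z where "u = tri (p b) (p c) (p d)" and "v = tri (p a) (p b) (p d)"
    and "w = tri (p a) (p c) (p d)" and "z = tri (p a) (p b) (p c)"
  have pos: "0 < u" "0 < v" "0 < w" "0 < z"
    unfolding u_def v_def w_def z_def p_def
    by (rule tri_circle_point_pos; use assms in linarith)+
  have sum: "u + v = w + z"
    by (simp add: u_def v_def w_def z_def tri_def algebra_simps)
  have "u *\<^sub>R p a + v *\<^sub>R p c = w *\<^sub>R p b + z *\<^sub>R p d"
    by (rule complex_eqI) (simp_all add: u_def v_def w_def z_def tri_def algebra_simps)
  then have "(1 / (u + v)) *\<^sub>R (u *\<^sub>R p a + v *\<^sub>R p c) = (1 / (u + v)) *\<^sub>R (w *\<^sub>R p b + z *\<^sub>R p d)"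
    by simp
  then have eq: "(u / (u + v)) *\<^sub>R p a + (v / (u + v)) *\<^sub>R p c
      = (w / (u + v)) *\<^sub>R p b + (z / (u + v)) *\<^sub>R p d"
    by (simp add: scaleR_add_right)
  have "(u / (u + v)) *\<^sub>R p a + (v / (u + v)) *\<^sub>R p c \<in> convex hull (p ` B)"
    by (rule convexD[OF convex_convex_hull])
      (use assms pos in \<open>auto intro: hull_inc simp: add_divide_distrib[symmetric]\<close>)
  moreover have "(w / (u + v)) *\<^sub>R p b + (z / (u + v)) *\<^sub>R p d \<in> convex hull (p ` C)"
    by (rule convexD[OF convex_convex_hull])
      (use assms pos sum in \<open>auto intro: hull_inc simp: add_divide_distrib[symmetric]\<close>)
  ultimately show ?thesis
    using eq by (auto simp: p_def)
qed

text \<open>The indices p to q form an arc with midpoint \<open>cis (- \<phi>)\<close> and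
  half-angle \<open>h\<close>. The inner product with the midpoint is the cosine of the angular
  distance \<open>t j\<close> from it: at least cos h on the arc and smaller off it. So a line
  perpendicular to that direction separates the hulls.\<close>

lemma interval_separated_hulls:
  assumes "1 \<le> p" "p \<le> q" "q \<le> m" "B \<subseteq> {p..q}" "C \<subseteq> {1..m} - {p..q}"
  shows "convex hull (circle_point m ` B) \<inter> convex hull (circle_point m ` C) = {}"
proof -
  define \<phi> where "\<phi> = pi * real (p + q) / real m"
  define h where "h = pi * real (q - p) / real m"
  define t where "t = (\<lambda>j::nat. pi * \<bar>real (p + q) - 2 * real j\<bar> / real m)"
  have m: "0 < real m" using assms by simp
  have inner: "inner (cis (- \<phi>)) (circle_point m j) = cos (t j)" for j
  proof -
    have "inner (cis (- \<phi>)) (circle_point m j) = cos (\<phi> - 2 * pi * real j / real m)"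
      by (simp add: inner_complex_def circle_point_def cos_diff)
    also have "\<phi> - 2 * pi * real j / real m = pi * (real (p + q) - 2 * real j) / real m"
      unfolding \<phi>_def by (simp only: diff_divide_distrib right_diff_distrib mult_ac)
    also have "cos \<dots> = cos \<bar>pi * (real (p + q) - 2 * real j) / real m\<bar>"
      by (simp only: cos_abs_real)
    also have "\<bar>pi * (real (p + q) - 2 * real j) / real m\<bar> = t j"
      by (simp add: t_def abs_mult)
    finally show ?thesis .
  qed
  have mono: "pi * x / real m \<le> pi * y / real m \<longleftrightarrow> x \<le> y"
    "pi * x / real m < pi * y / real m \<longleftrightarrow> x < y" for x y :: real
    using m by (simp_all add: divide_le_cancel divide_less_cancel)
  have hpi: "h < pi"
    using mono(2)[of "real (q - p)" "real m"] assms m by (simp add: h_def of_nat_diff)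
  have h0: "0 \<le> h" by (simp add: h_def)
  have near: "cos h \<le> cos (t j)" if "j \<in> B" for j
  proof -
    have "\<bar>real (p + q) - 2 * real j\<bar> \<le> real (q - p)"
      using that assms by (auto simp: of_nat_diff abs_le_iff)
    then have "t j \<le> h" unfolding t_def h_def using mono(1) by blast
    then show ?thesis
      using hpi by (intro cos_monotone_0_pi_le) (auto simp: t_def)
  qed
  have far: "cos (t j) < cos h" if "j \<in> C" for j
  proof -
    have j: "1 \<le> j" "j \<le> m" "j < p \<or> q < j" using that assms(5) by auto
    have "real (q - p) < \<bar>real (p + q) - 2 * real j\<bar>"
      using j(3) assms(2) by (auto simp: of_nat_diff abs_if)
    then have 1: "h < t j" unfolding t_def h_def using mono(2) by blast
    \<comment> \<open>\<open>t j\<close> may exceed pi, and then the distance has to be measured the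
      other way round as 2 pi - \<open>t j\<close>. This bound, which holds because the indices stay
      between 1 and \<open>m\<close>, keeps that distance above \<open>h\<close>.\<close>
    have "\<bar>real (p + q) - 2 * real j\<bar> < 2 * real m - real (q - p)"
      using j assms(1-3) by (auto simp: of_nat_diff abs_less_iff)
    then have "t j < pi * (2 * real m - real (q - p)) / real m"
      unfolding t_def using mono(2) by blast
    also have "\<dots> = 2 * pi - h"
      using m by (simp add: h_def field_simps)
    finally have 2: "t j < 2 * pi - h" .
    show ?thesis
    proof (cases "t j \<le> pi")
      case True
      then show ?thesis using cos_monotone_0_pi[OF h0 1] by simp
    next
      case False
      have "cos (t j) = cos (2 * pi - t j)" by (simp add: cos_diff)
      also have "\<dots> < cos h"
        using False 2 by (intro cos_monotone_0_pi[OF h0]) auto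
      finally show ?thesis .
    qed
  qed
  have "convex hull (circle_point m ` B) \<subseteq> {z. inner (cis (- \<phi>)) z \<ge> cos h}"
    by (rule hull_minimal) (use near inner in \<open>auto simp: convex_halfspace_ge\<close>)
  moreover have "convex hull (circle_point m ` C) \<subseteq> {z. inner (cis (- \<phi>)) z < cos h}"
    by (rule hull_minimal) (use far inner in \<open>auto simp: convex_halfspace_lt\<close>)
  ultimately show ?thesis by force
qed

text \<open>The block with the larger minimum spans an interval that \<open>B\<close> avoids: a
  point x of \<open>B\<close> in it would give the crossing Min B < Min C < x < Max C.\<close>

lemma nc_disjoint_hulls:
  assumes "\<sigma> \<in> nc {1..m}" "B \<in> \<sigma>" "C \<in> \<sigma>" "Min B < Min C"
  shows "convex hull (circle_point m ` B) \<inter> convex hull (circle_point m ` C) = {}"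
proof -
  have fin: "finite X" "X \<noteq> {}" "X \<subseteq> {1..m}" if "X \<in> \<sigma>" for X
    using nc_finite_block[OF _ assms(1) that] nc_nonempty[OF assms(1) that] nc_subset[OF assms(1) that]
    by auto
  note mem = Min_in[OF fin(1,2)] Max_in[OF fin(1,2)]
  have "x \<notin> B" if x: "x \<in> {Min C..Max C}" for x
  proof
    assume "x \<in> B"
    have ne: "B \<noteq> C" using assms(4) by auto
    then have "x \<notin> C" using nc_unique[OF assms(1-3) \<open>x \<in> B\<close>] by blast
    then have "x \<noteq> Min C" "x \<noteq> Max C" using mem[OF assms(3,3)] by auto
    then have "Min C < x" "x < Max C" using x by auto
    then show False
      using nc_noncrossing[OF assms(1-3) mem(1)[OF assms(2,2)] \<open>x \<in> B\<close> mem[OF assms(3,3)]] assms(4) ne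
      by blast
  qed
  then have "B \<subseteq> {1..m} - {Min C..Max C}" using fin(3)[OF assms(2)] by blast
  moreover have "C \<subseteq> {Min C..Max C}" using fin(1)[OF assms(3)] by auto
  moreover have "Min C \<in> {1..m}" "Max C \<in> {1..m}" using mem[OF assms(3,3)] fin(3)[OF assms(3)] by blast+
  moreover have "Min C \<le> Max C" using fin[OF assms(3)] by simp
  ultimately show ?thesis
    using interval_separated_hulls[of "Min C" "Max C" m C B] by auto
qed

lemma NC_eq_nc: "NC m = nc {1..m}"
proof (intro equalityI subsetI)
  fix \<sigma> assume *: "\<sigma> \<in> NC m"
  have nx: "B = C" if "B \<in> \<sigma>" "C \<in> \<sigma>" "a \<in> B" "c \<in> B" "b \<in> C" "d \<in> C" "a < b" "b < c" "c < d"
    for B C a b c d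
  proof (rule ccontr)
    assume "B \<noteq> C"
    then have "convex hull (circle_point m ` B) \<inter> convex hull (circle_point m ` C) = {}"
      using * that(1,2) by (auto simp: NC_def)
    moreover have "a \<in> {1..m}" "d \<in> {1..m}"
      using * that by (auto simp: NC_def partition_on_def)
    ultimately show False
      using crossing_hulls[of a b c d m B C] that by auto
  qed
  have "partition_on {1..m} \<sigma>" using * by (simp add: NC_def)
  note part = this
  show "\<sigma> \<in> nc {1..m}"
    unfolding nc_def mem_Collect_eq
  proof (intro conjI ballI impI)
    show "B = C" if "B \<in> \<sigma>" "C \<in> \<sigma>" "a \<in> B" "c \<in> B" "b \<in> C" "d \<in> C" "a < b" "b < c" "c < d"
      for B C a c b d
      using that by (rule nx)
  qed (rule part)
next
  fix \<sigma> assume *: "\<sigma> \<in> nc {1..m}"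
  have "convex hull (circle_point m ` B) \<inter> convex hull (circle_point m ` C) = {}"
    if "B \<in> \<sigma>" "C \<in> \<sigma>" "B \<noteq> C" for B C
  proof -
    have "Min B \<in> B" "Min C \<in> C"
      using that nc_finite_block[OF _ *] nc_nonempty[OF *] by auto
    then have "Min B \<noteq> Min C" using nc_unique[OF * that(1,2)] that(3) by metis
    then consider "Min B < Min C" | "Min C < Min B" by linarith
    then show ?thesis using nc_disjoint_hulls[OF *] that by cases blast+
  qed
  then show "\<sigma> \<in> NC m" using nc_partition_on[OF *] by (simp add: NC_def)
qed

section \<open>Labels of maximal chains\<close>

text \<open>Otherwise only positions before \<open>i\<close> of the sorted list could hold entries
  up to \<open>v\<close>, which is too few.\<close>

lemma sort_nth_le:
  assumes "i < length a" "i < length (filter (\<lambda>x. x \<le> v) a)"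
  shows "sort a ! i \<le> (v::nat)"
proof (rule ccontr)
  assume *: "\<not> sort a ! i \<le> v"
  have "j < i" if "j < length (sort a)" "sort a ! j \<le> v" for j
  proof (rule ccontr)
    assume "\<not> j < i"
    then have "sort a ! i \<le> sort a ! j"
      using that(1) by (intro sorted_nth_mono) auto
    then show False using * that(2) by simp
  qed
  then have "{j. j < length (sort a) \<and> sort a ! j \<le> v} \<subseteq> {..<i}" by auto
  then have "length (filter (\<lambda>x. x \<le> v) (sort a)) \<le> i"
    unfolding length_filter_conv_card by (metis card_lessThan card_mono finite_lessThan)
  moreover have "mset (filter (\<lambda>x. x \<le> v) (sort a)) = mset (filter (\<lambda>x. x \<le> v) a)" by simp
  then have "length (filter (\<lambda>x. x \<le> v) (sort a)) = length (filter (\<lambda>x. x \<le> v) a)"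
    by (metis size_mset)
  ultimately show False using assms(2) by simp
qed

text \<open>\<open>e i\<close> is the minimum lost at step \<open>i\<close> and \<open>l i\<close>
  the label. Being a parking function follows from l i < e i alone; the two remaining conditions of
  \<open>PF\<close> fix the labels of the steps with large \<open>e i\<close>.\<close>

lemma PF_iff:
  fixes l e :: "nat \<Rightarrow> nat"
  assumes "1 < k" "k \<le> n" "bij_betw e {..<n} {2..n + 1}"
    and l: "\<And>i. i < n \<Longrightarrow> 1 \<le> l i" "\<And>i. i < n \<Longrightarrow> l i < e i"
  shows "map l [0..<n] \<in> PF n k \<longleftrightarrow>
    (\<forall>i<n. (k + 1 < e i \<longrightarrow> l i = e i - 1) \<and> (e i = k + 1 \<longrightarrow> l i \<noteq> k))"
proof
  let ?a = "map l [0..<n]"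
  have inj: "i = j" if "i < n" "j < n" "e i = e j" for i j
    using assms(3) that by (auto simp: bij_betw_def inj_on_def)
  have ex: "\<exists>i<n. e i = v" if "2 \<le> v" "v \<le> n + 1" for v
  proof -
    have "v \<in> e ` {..<n}" using assms(3) that by (simp add: bij_betw_def)
    then show ?thesis by auto
  qed
  {
    assume PF: "?a \<in> PF n k"
    have eq: "l i = e i - 1" if "i < n" "k + 1 < e i" for i
      using that
    proof (induction "n + 1 - e i" arbitrary: i rule: less_induct)
      case less
      have e_le: "e j \<le> n + 1" if "j < n" for j
        using assms(3) that by (auto simp: bij_betw_def)
      have "e i - 1 \<in> {k + 1..n}" using less.prems e_le[OF less.prems(1)] by auto
      then have "e i - 1 \<in> set ?a" using PF by (auto simp: PF_def)
      then obtain j where j: "j < n" "l j = e i - 1" by auto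
      \<comment> \<open>The label e i - 1 occurs at some step \<open>j\<close>, and e j is at least
        e i because it exceeds its label. Steps with a larger lost minimum already have larger
        labels by the downward induction, so \<open>j\<close> must be \<open>i\<close>.\<close>
      have "\<not> e i < e j"
      proof
        assume "e i < e j"
        moreover have "n + 1 - e j < n + 1 - e i" using \<open>e i < e j\<close> e_le[OF j(1)] by linarith
        ultimately have "l j = e j - 1" using less.hyps[of j] j(1) less.prems(2) by linarith
        then show False using j(2) \<open>e i < e j\<close> less.prems(2) by linarith
      qed
      moreover have "e i \<le> e j" using l(2)[OF j(1)] j(2) by linarith
      ultimately have "i = j" using inj[OF less.prems(1) j(1)] by linarith
      then show ?case using j(2) by simp
    qed
    have "k \<notin> set ?a" using PF by (simp add: PF_def)
    then have "l i \<noteq> k" if "i < n" for i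
      using that by auto
    with eq show "\<forall>i<n. (k + 1 < e i \<longrightarrow> l i = e i - 1) \<and> (e i = k + 1 \<longrightarrow> l i \<noteq> k)" by blast
  }
  {
    assume R: "\<forall>i<n. (k + 1 < e i \<longrightarrow> l i = e i - 1) \<and> (e i = k + 1 \<longrightarrow> l i \<noteq> k)"
    have "?a \<in> parking_functions n"
      unfolding parking_functions_def
    proof (intro CollectI conjI allI impI)
      show "\<forall>x\<in>set ?a. 0 < x" using l(1) by (auto simp: less_eq_Suc_le)
      fix i assume i: "i < n"
      \<comment> \<open>The i + 1 minima from 2 to i + 2 are lost at different steps, each with a
        label of at most i + 1. This yields the i + 1 small entries needed at position
        \<open>i\<close>, counted from 0.\<close>
      have "card {2..i + 2} \<le> card {j. j < n \<and> l j \<le> Suc i}"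
      proof (rule surj_card_le[of _ _ e])
        show "{2..i + 2} \<subseteq> e ` {j. j < n \<and> l j \<le> Suc i}"
        proof
          fix v assume v: "v \<in> {2..i + 2}"
          then obtain j where "j < n" "e j = v" using ex[of v] i by auto
          moreover from this have "l j \<le> Suc i" using l(2)[of j] v by simp
          ultimately show "v \<in> e ` {j. j < n \<and> l j \<le> Suc i}" by blast
        qed
      qed simp
      also have "\<dots> = length (filter (\<lambda>x. x \<le> Suc i) ?a)"
        unfolding length_filter_conv_card by (intro arg_cong[where f = card]) auto
      finally have "i < length (filter (\<lambda>x. x \<le> Suc i) ?a)" by simp
      then show "sort ?a ! i \<le> Suc i"
        using i by (intro sort_nth_le) auto
    qed simp
    moreover have "k \<notin> set ?a"
    proof
      assume "k \<in> set ?a"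
      then obtain i where i: "i < n" "l i = k" by auto
      have "k < e i" using l(2)[OF i(1)] i(2) by simp
      then consider "e i = k + 1" | "k + 1 < e i" by linarith
      then show False
      proof cases
        case 1
        then show False using R i by blast
      next
        case 2
        then have "l i = e i - 1" using R i(1) by blast
        then show False using 2 i(2) by linarith
      qed
    qed
    moreover have "{k + 1..n} \<subseteq> set ?a"
    proof
      fix v assume v: "v \<in> {k + 1..n}"
      then obtain i where i: "i < n" "e i = v + 1" using ex[of "v + 1"] by auto
      then have "l i = v" using R v by auto
      then show "v \<in> set ?a" using i(1) by auto
    qed
    ultimately show "?a \<in> PF n k" by (simp add: PF_def)
  }
qed

section \<open>The two blocks and the label of a single step\<close>

definition merges :: "nat set set \<Rightarrow> nat set set \<Rightarrow> nat set \<Rightarrow> nat set \<Rightarrow> bool" where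
  "merges \<sigma> \<tau> B C \<longleftrightarrow> B \<in> \<sigma> \<and> C \<in> \<sigma> \<and> Min B < Min C \<and> \<tau> = insert (B \<union> C) (\<sigma> - {B, C})"

lemma edge_iff_merges:
  "edge k A \<sigma> \<tau> \<longleftrightarrow> \<sigma> \<in> nc A \<and> \<tau> \<in> nc A \<and> (\<exists>B C. merges \<sigma> \<tau> B C \<and> allowed k B (Min C))"
  unfolding edge_def merge_def merges_def by blast

text \<open>The union of two different blocks is not a block, so what disappears in a step is
  exactly the merged pair. Hence the step determines \<open>B\<close> and \<open>C\<close>.\<close>

lemma merges_diff:
  assumes "\<sigma> \<in> nc A" "merges \<sigma> \<tau> B C"
  shows "\<sigma> - \<tau> = {B, C}"
proof -
  have BC: "B \<in> \<sigma>" "C \<in> \<sigma>" "B \<noteq> C" "\<tau> = insert (B \<union> C) (\<sigma> - {B, C})"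
    using assms(2) by (auto simp: merges_def)
  have "B \<union> C \<notin> \<sigma>"
  proof
    assume u: "B \<union> C \<in> \<sigma>"
    obtain x y where "x \<in> B" "y \<in> C" using nc_nonempty[OF assms(1)] BC(1,2) by blast
    then have "B \<union> C = B" "B \<union> C = C"
      using nc_unique[OF assms(1) u BC(1)] nc_unique[OF assms(1) u BC(2)] by blast+
    then show False using BC(3) by simp
  qed
  then show ?thesis using BC by auto
qed

lemma merges_unique:
  assumes "\<sigma> \<in> nc A" "merges \<sigma> \<tau> B C" "merges \<sigma> \<tau> B' C'"
  shows "B' = B" "C' = C"
proof -
  have "{B, C} = {B', C'}" using merges_diff[OF assms(1,2)] merges_diff[OF assms(1,3)] by simp
  moreover have "Min B < Min C" "Min B' < Min C'" using assms(2,3) by (auto simp: merges_def)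
  ultimately show "B' = B" "C' = C" by (auto simp: doubleton_eq_iff)
qed

text \<open>The definite description is resolved by \<open>merges_unique\<close>: containing the
  minimum of the union means having the smaller minimum, and lying below all of \<open>C\<close>
  means lying below \<open>Min C\<close>.\<close>

lemma cover_label_eq:
  assumes "\<sigma> \<in> nc A" "finite A" "merges \<sigma> \<tau> B C"
  shows "cover_label \<sigma> \<tau> = Max {x \<in> B. x < Min C}"
proof -
  have fin: "finite X" "X \<noteq> {}" if "X \<in> \<sigma>" for X
    using nc_finite_block[OF assms(2,1) that] nc_nonempty[OF assms(1) that] by auto
  have below: "{x \<in> X. \<forall>y\<in>Y. x < y} = {x \<in> X. x < Min Y}" if "Y \<in> \<sigma>" for X Y
    using fin[OF that] by auto
  have iff: "B1 \<in> \<sigma> \<and> B2 \<in> \<sigma> \<and> B1 \<noteq> B2 \<and> \<tau> = insert (B1 \<union> B2) (\<sigma> - {B1, B2}) \<and>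
      Min (B1 \<union> B2) \<in> B1 \<longleftrightarrow> merges \<sigma> \<tau> B1 B2" for B1 B2
  proof -
    have "B1 \<noteq> B2 \<and> Min (B1 \<union> B2) \<in> B1 \<longleftrightarrow> Min B1 < Min B2" if B: "B1 \<in> \<sigma>" "B2 \<in> \<sigma>"
    proof -
      have m: "Min B1 \<in> B1" "Min B2 \<in> B2" "Min (B1 \<union> B2) = min (Min B1) (Min B2)"
        using fin[OF B(1)] fin[OF B(2)] by (simp_all add: Min_Un)
      show ?thesis
      proof
        assume *: "B1 \<noteq> B2 \<and> Min (B1 \<union> B2) \<in> B1"
        then have "Min B2 \<notin> B1" using nc_unique[OF assms(1) B] m(2) by blast
        then have "min (Min B1) (Min B2) \<noteq> Min B2" using * m(3) by metis
        then show "Min B1 < Min B2" by (simp add: min_def split: if_splits)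
      next
        assume "Min B1 < Min B2"
        then show "B1 \<noteq> B2 \<and> Min (B1 \<union> B2) \<in> B1" using m by auto
      qed
    qed
    then show ?thesis unfolding merges_def by blast
  qed
  have eq: "(\<exists>B1 B2. B1 \<in> \<sigma> \<and> B2 \<in> \<sigma> \<and> B1 \<noteq> B2 \<and> \<tau> = insert (B1 \<union> B2) (\<sigma> - {B1, B2}) \<and>
        Min (B1 \<union> B2) \<in> B1 \<and> l = Max {x \<in> B1. \<forall>y\<in>B2. x < y}) \<longleftrightarrow> l = Max {x \<in> B. x < Min C}" for l
  proof
    assume "\<exists>B1 B2. B1 \<in> \<sigma> \<and> B2 \<in> \<sigma> \<and> B1 \<noteq> B2 \<and> \<tau> = insert (B1 \<union> B2) (\<sigma> - {B1, B2}) \<and>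
        Min (B1 \<union> B2) \<in> B1 \<and> l = Max {x \<in> B1. \<forall>y\<in>B2. x < y}"
    then obtain B1 B2 where *: "B2 \<in> \<sigma>" "merges \<sigma> \<tau> B1 B2" "l = Max {x \<in> B1. \<forall>y\<in>B2. x < y}"
      using iff by blast
    then have "B1 = B" "B2 = C" using merges_unique[OF assms(1,3)] by blast+
    then show "l = Max {x \<in> B. x < Min C}" using * below by simp
  next
    assume l: "l = Max {x \<in> B. x < Min C}"
    have C: "C \<in> \<sigma>" using assms(3) by (simp add: merges_def)
    have "l = Max {x \<in> B. \<forall>y\<in>C. x < y}" using l below[OF C] by (simp only:)
    with iffD2[OF iff assms(3)]
    show "\<exists>B1 B2. B1 \<in> \<sigma> \<and> B2 \<in> \<sigma> \<and> B1 \<noteq> B2 \<and> \<tau> = insert (B1 \<union> B2) (\<sigma> - {B1, B2}) \<and>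
        Min (B1 \<union> B2) \<in> B1 \<and> l = Max {x \<in> B1. \<forall>y\<in>B2. x < y}"
      by blast
  qed
  show ?thesis unfolding cover_label_def eq by simp
qed

lemma cover_label_props:
  assumes "\<sigma> \<in> nc {1..m}" "merges \<sigma> \<tau> B C"
  shows "cover_label \<sigma> \<tau> \<in> B" "1 \<le> cover_label \<sigma> \<tau>" "cover_label \<sigma> \<tau> < Min C"
    "\<And>x. x \<in> B \<Longrightarrow> x < Min C \<Longrightarrow> x \<le> cover_label \<sigma> \<tau>"
proof -
  let ?S = "{x \<in> B. x < Min C}"
  have B: "B \<in> \<sigma>" "Min B < Min C" using assms(2) by (auto simp: merges_def)
  have fin: "finite B" "B \<noteq> {}" "B \<subseteq> {1..m}"
    using nc_finite_block[OF _ assms(1) B(1)] nc_nonempty[OF assms(1) B(1)] nc_subset[OF assms(1) B(1)]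
    by auto
  have l: "cover_label \<sigma> \<tau> = Max ?S" by (rule cover_label_eq[OF assms(1) _ assms(2)]) simp
  have "Min B \<in> ?S" using B(2) Min_in[OF fin(1,2)] by simp
  then have S: "finite ?S" "?S \<noteq> {}" using fin(1) by (simp, blast)
  have "Max ?S \<in> ?S" by (rule Max_in[OF S])
  then show "cover_label \<sigma> \<tau> \<in> B" "cover_label \<sigma> \<tau> < Min C" "1 \<le> cover_label \<sigma> \<tau>"
    using l fin(3) by auto
  show "x \<le> cover_label \<sigma> \<tau>" if "x \<in> B" "x < Min C" for x
    using that S l by (auto intro: Max_ge)
qed

text \<open>A step removes one number from the set of block minima and adds none, so no number is
  lost twice along a chain.\<close>

lemma merges_mins:
  assumes "\<sigma> \<in> nc A" "finite A" "merges \<sigma> \<tau> B C"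
  shows "Min ` \<tau> = Min ` \<sigma> - {Min C}"
proof -
  have BC: "B \<in> \<sigma>" "C \<in> \<sigma>" "Min B < Min C" "\<tau> = insert (B \<union> C) (\<sigma> - {B, C})"
    using assms(3) by (auto simp: merges_def)
  have fin: "finite X" "X \<noteq> {}" if "X \<in> \<sigma>" for X
    using nc_finite_block[OF assms(2,1) that] nc_nonempty[OF assms(1) that] by auto
  have inj: "inj_on Min \<sigma>"
    by (rule inj_onI) (metis Min_in fin nc_unique[OF assms(1)])
  have "Min (B \<union> C) = Min B"
    using fin[OF BC(1)] fin[OF BC(2)] BC(3) by (simp add: Min_Un)
  then have "Min ` \<tau> = insert (Min B) (Min ` (\<sigma> - {B, C}))" using BC(4) by simp
  also have "Min ` (\<sigma> - {B, C}) = Min ` \<sigma> - {Min B, Min C}"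
    using inj_on_image_set_diff[OF inj, of \<sigma> "{B, C}"] BC by auto
  finally show ?thesis using BC by auto
qed

section \<open>Refinement\<close>

lemma edge_refines:
  assumes "edge k A \<sigma> \<tau>"
  shows "refines A \<sigma> \<tau>"
proof -
  obtain B C where "merges \<sigma> \<tau> B C" using assms by (auto simp: edge_iff_merges)
  then have "\<exists>Y\<in>\<tau>. X \<subseteq> Y" if "X \<in> \<sigma>" for X
    using that by (auto simp: merges_def)
  then show ?thesis
    using assms nc_partition_on by (auto simp: refines_def edge_def)
qed

text \<open>If a block \<open>D\<close> crosses the union, it lies in \<open>Y\<close> too, since
  \<tau> is noncrossing. As \<open>u\<close> and \<open>v\<close> are consecutive in
  \<open>Y\<close>, the block \<open>D\<close> has no point between them. So \<open>u\<close> and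
  \<open>v\<close> can replace each other in the crossing, which then already takes place with
  \<open>U\<close> or with \<open>V\<close>.\<close>

lemma merge_adjacent_nc:
  assumes s: "\<sigma> \<in> nc A" and t: "\<tau> \<in> nc A" and ref: "refines A \<sigma> \<tau>"
    and UV: "U \<in> \<sigma>" "V \<in> \<sigma>" "U \<noteq> V" and Y: "Y \<in> \<tau>" "U \<subseteq> Y" "V \<subseteq> Y"
    and uv: "u \<in> U" "v \<in> V" "u < v" and adj: "\<And>w. w \<in> Y \<Longrightarrow> u < w \<Longrightarrow> w < v \<Longrightarrow> False"
  shows "insert (U \<union> V) (\<sigma> - {U, V}) \<in> nc A"
proof -
  have cross: "\<not> (a < b \<and> b < c \<and> c < d)" "\<not> (b < a \<and> a < d \<and> d < c)"
    if D: "D \<in> \<sigma>" "D \<noteq> U" "D \<noteq> V" "a \<in> D" "c \<in> D" and bd: "b \<in> U \<union> V" "d \<in> U \<union> V" for D a b c d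
  proof -
    obtain Z where Z: "Z \<in> \<tau>" "D \<subseteq> Z" using ref D(1) unfolding refines_def by blast
    have bdY: "b \<in> Y" "d \<in> Y" using bd Y by auto
    have acZ: "a \<in> Z" "c \<in> Z" using D Z by auto
    have noU: "\<not> (x < p \<and> p < y \<and> y < q)" "\<not> (p < x \<and> x < q \<and> q < y)"
      if "x \<in> D" "y \<in> D" "p \<in> U" "q \<in> U" for x y p q
      using nc_noncrossing[OF s D(1) UV(1) that] nc_noncrossing[OF s UV(1) D(1) that(3,4,1,2)] D(2)
      by blast+
    have noV: "\<not> (x < p \<and> p < y \<and> y < q)" "\<not> (p < x \<and> x < q \<and> q < y)"
      if "x \<in> D" "y \<in> D" "p \<in> V" "q \<in> V" for x y p q
      using nc_noncrossing[OF s D(1) UV(2) that] nc_noncrossing[OF s UV(2) D(1) that(3,4,1,2)] D(3)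
      by blast+
    have away: "x < u \<or> v < x" if "x \<in> D" "Z = Y" for x
    proof -
      have "x \<noteq> u" "x \<noteq> v"
        using nc_unique[OF s D(1) UV(1) that(1)] nc_unique[OF s D(1) UV(2) that(1)] uv D(2,3) by auto
      moreover have "x \<in> Y" using that Z(2) by auto
      ultimately show ?thesis using adj[of x] by (metis linorder_neqE_nat)
    qed
    show "\<not> (a < b \<and> b < c \<and> c < d)"
    proof
      assume o: "a < b \<and> b < c \<and> c < d"
      then have ZY: "Z = Y" using nc_noncrossing[OF t Z(1) Y(1) acZ bdY] by blast
      note aw = away[OF D(4) ZY] away[OF D(5) ZY]
      show False
        using bd noU[OF D(4,5), of b d] noU[OF D(4,5), of b u] noU[OF D(4,5), of u b]
          noU[OF D(4,5), of u d] noU[OF D(4,5), of d u] noV[OF D(4,5), of b d] noV[OF D(4,5), of b v]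
          noV[OF D(4,5), of v b] noV[OF D(4,5), of v d] noV[OF D(4,5), of d v] aw o uv
        by (elim UnE) auto
    qed
    show "\<not> (b < a \<and> a < d \<and> d < c)"
    proof
      assume o: "b < a \<and> a < d \<and> d < c"
      then have ZY: "Z = Y" using nc_noncrossing[OF t Y(1) Z(1) bdY acZ] by blast
      note aw = away[OF D(4) ZY] away[OF D(5) ZY]
      show False
        using bd noU[OF D(4,5), of b d] noU[OF D(4,5), of b u] noU[OF D(4,5), of u b]
          noU[OF D(4,5), of u d] noU[OF D(4,5), of d u] noV[OF D(4,5), of b d] noV[OF D(4,5), of b v]
          noV[OF D(4,5), of v b] noV[OF D(4,5), of v d] noV[OF D(4,5), of d v] aw o uv
        by (elim UnE) auto
    qed
  qed
  show ?thesis
  proof (rule ncI)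
    show "\<Union>(insert (U \<union> V) (\<sigma> - {U, V})) = A"
      using nc_Union[OF s] UV by blast
    show "B \<noteq> {}" if "B \<in> insert (U \<union> V) (\<sigma> - {U, V})" for B
      using that nc_nonempty[OF s] UV by auto
    show "B = C" if "B \<in> insert (U \<union> V) (\<sigma> - {U, V})" "C \<in> insert (U \<union> V) (\<sigma> - {U, V})"
      "x \<in> B" "x \<in> C" for B C x
      using that nc_unique[OF s _ UV(1), of _ x] nc_unique[OF s _ UV(2), of _ x] nc_unique[OF s, of B C x]
      by auto
    show "B = C" if h: "B \<in> insert (U \<union> V) (\<sigma> - {U, V})" "C \<in> insert (U \<union> V) (\<sigma> - {U, V})"
      "a \<in> B" "c \<in> B" "b \<in> C" "d \<in> C" "a < b" "b < c" "c < d" for B C a b c d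
    proof -
      consider "B = U \<union> V" "C = U \<union> V" | "B = U \<union> V" "C \<in> \<sigma>" "C \<noteq> U" "C \<noteq> V"
        | "C = U \<union> V" "B \<in> \<sigma>" "B \<noteq> U" "B \<noteq> V" | "B \<in> \<sigma>" "C \<in> \<sigma>"
        using h(1,2) by blast
      then show ?thesis
      proof cases
        case 2
        then show ?thesis using cross(2)[OF 2(2-4) h(5,6), of a c] h(3,4,7-9) 2(1) by simp
      next
        case 3
        then show ?thesis using cross(1)[OF 3(2-4) h(3,4), of b d] h(5-9) 3(1) by simp
      next
        case 4
        then show ?thesis using nc_noncrossing[OF s 4 h(3-9)] by simp
      qed simp
    qed
  qed
qed

text \<open>Some block \<open>Y\<close> of \<tau> is the union of several blocks of \<sigma>. Two
  points of \<open>Y\<close> in different blocks of \<sigma> at the least possible distance are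
  consecutive in \<open>Y\<close>, and their blocks can be merged. The parameter \<open>m\<close>
  makes every merge admissible.\<close>

lemma refines_edge:
  assumes "\<sigma> \<in> nc {1..m}" "\<tau> \<in> nc {1..m}" "refines {1..m} \<sigma> \<tau>" "\<sigma> \<noteq> \<tau>"
  obtains \<rho> where "edge m {1..m} \<sigma> \<rho>" "refines {1..m} \<rho> \<tau>"
proof -
  let ?A = "{1..m}"
  note s = assms(1) and t = assms(2)
  have "\<not> \<tau> \<subseteq> \<sigma>"
  proof
    assume "\<tau> \<subseteq> \<sigma>"
    then have "refines ?A \<tau> \<sigma>" using nc_partition_on s t by (auto simp: refines_def)
    then show False using refines_asym[OF assms(3)] assms(4) by blast
  qed
  then obtain Y where Y: "Y \<in> \<tau>" "Y \<notin> \<sigma>" by blast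
  have inY: "blk \<sigma> y \<subseteq> Y" "y \<in> ?A" if "y \<in> Y" for y
  proof -
    show yA: "y \<in> ?A" using that nc_subset[OF t Y(1)] by blast
    obtain Z where Z: "Z \<in> \<tau>" "blk \<sigma> y \<subseteq> Z"
      using assms(3) blk_in[OF s yA] unfolding refines_def by blast
    then have "y \<in> Z" using blk_mem[OF s yA] by blast
    then show "blk \<sigma> y \<subseteq> Y" using nc_unique[OF t Z(1) Y(1) _ that] Z(2) by simp
  qed
  define P where "P = (\<lambda>u v. u \<in> Y \<and> v \<in> Y \<and> u < v \<and> blk \<sigma> u \<noteq> blk \<sigma> v)"
  have "\<exists>u v. P u v"
  proof -
    obtain x where x: "x \<in> Y" using nc_nonempty[OF t Y(1)] by blast
    have "blk \<sigma> x \<noteq> Y" using blk_in[OF s inY(2)[OF x]] Y(2) by metis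
    then obtain y where y: "y \<in> Y" "y \<notin> blk \<sigma> x" using inY(1)[OF x] by blast
    then have "blk \<sigma> y \<noteq> blk \<sigma> x" using blk_mem[OF s inY(2)[OF y(1)]] by metis
    then have "x \<noteq> y" by auto
    then have "P x y \<or> P y x"
      using \<open>blk \<sigma> y \<noteq> blk \<sigma> x\<close> x y(1) by (auto simp: P_def)
    then show ?thesis by blast
  qed
  then obtain u0 v0 where "P u0 v0" by blast
  then obtain p where p: "P (fst p) (snd p)"
    "\<forall>q. P (fst q) (snd q) \<longrightarrow> snd p - fst p \<le> snd q - fst q"
    using ex_has_least_nat[of "\<lambda>p. P (fst p) (snd p)" "(u0, v0)" "\<lambda>p. snd p - fst p"] by auto
  define u v where "u = fst p" and "v = snd p"
  have uv: "P u v" and least: "\<And>u' v'. P u' v' \<Longrightarrow> v - u \<le> v' - u'"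
    using p(1) p(2)[rule_format, of "(u', v')" for u' v'] by (simp_all add: u_def v_def)
  have uv': "u \<in> Y" "v \<in> Y" "u < v" "blk \<sigma> u \<noteq> blk \<sigma> v" using uv by (auto simp: P_def)
  let ?U = "blk \<sigma> u" and ?V = "blk \<sigma> v"
  have adj: False if w: "w \<in> Y" "u < w" "w < v" for w
  proof (cases "blk \<sigma> w = ?U")
    case True
    then have "P w v" using uv' w by (simp add: P_def)
    from least[OF this] show False using w by linarith
  next
    case False
    then have "P u w" using uv' w by (simp add: P_def)
    from least[OF this] show False using w by linarith
  qed
  have UV: "?U \<in> \<sigma>" "?V \<in> \<sigma>" "u \<in> ?U" "v \<in> ?V"
    using blk_in[OF s] blk_mem[OF s] inY(2) uv' by auto
  define \<rho> where "\<rho> = insert (?U \<union> ?V) (\<sigma> - {?U, ?V})"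
  have r: "\<rho> \<in> nc ?A"
    unfolding \<rho>_def
    by (rule merge_adjacent_nc[OF s t assms(3) UV(1,2) uv'(4) Y(1) inY(1)[OF uv'(1)] inY(1)[OF uv'(2)]
          UV(3,4) uv'(3) adj])
  have fin: "finite X" "X \<noteq> {}" "X \<subseteq> ?A" if "X \<in> \<sigma>" for X
    using nc_finite_block[OF _ s that] nc_nonempty[OF s that] nc_subset[OF s that] by auto
  have "Min ?U \<noteq> Min ?V"
    using Min_in[OF fin(1,2)[OF UV(1)]] Min_in[OF fin(1,2)[OF UV(2)]] nc_unique[OF s UV(1,2)] uv'(4)
    by metis
  then have "merges \<sigma> \<rho> ?U ?V \<or> merges \<sigma> \<rho> ?V ?U"
    using UV by (auto simp: merges_def \<rho>_def Un_commute insert_commute)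
  moreover have "Min X \<le> m" if "X \<in> \<sigma>" for X
    using Min_in[OF fin(1,2)[OF that]] fin(3)[OF that] by auto
  ultimately have "edge m ?A \<sigma> \<rho>"
    unfolding edge_iff_merges using s r UV(1,2) allowed_le by blast
  moreover have "refines ?A \<rho> \<tau>"
    unfolding refines_def
  proof (intro conjI ballI)
    fix X assume "X \<in> \<rho>"
    then consider "X = ?U \<union> ?V" | "X \<in> \<sigma>" by (auto simp: \<rho>_def)
    then show "\<exists>Z\<in>\<tau>. X \<subseteq> Z"
    proof cases
      case 1
      then show ?thesis using Y(1) inY(1) uv'(1,2) by blast
    next
      case 2
      then show ?thesis using assms(3) by (simp add: refines_def)
    qed
  qed (use r t nc_partition_on in auto)
  ultimately show thesis by (rule that)
qed

text \<open>Each step of \<open>refines_edge\<close> towards \<tau> loses exactly one block.\<close>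

lemma refines_card:
  assumes "\<sigma> \<in> nc {1..m}" "\<tau> \<in> nc {1..m}" "refines {1..m} \<sigma> \<tau>"
  shows "card \<tau> \<le> card \<sigma> \<and> (card \<tau> = card \<sigma> \<longrightarrow> \<sigma> = \<tau>)"
  using assms
proof (induction "card \<sigma>" arbitrary: \<sigma> rule: less_induct)
  case less
  show ?case
  proof (cases "\<sigma> = \<tau>")
    case False
    obtain \<rho> where r: "edge m {1..m} \<sigma> \<rho>" "refines {1..m} \<rho> \<tau>"
      using refines_edge[OF less.prems False] .
    have c: "card \<sigma> = Suc (card \<rho>)" by (rule edge_card[OF r(1)]) simp
    then have "card \<tau> \<le> card \<rho>"
      using less.hyps[OF _ edge_nc(2)[OF r(1)] less.prems(2) r(2)] by simp
    then show ?thesis using c by simp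
  qed simp
qed

section \<open>Maximal chains and the poset\<close>

definition full_path :: "nat \<Rightarrow> nat \<Rightarrow> nat set set list \<Rightarrow> bool" where
  "full_path k m c \<longleftrightarrow> c \<noteq> [] \<and> hd c = singletons {1..m} \<and> last c = {{1..m}} \<and>
     successively (edge k {1..m}) c"

lemma full_path_nc:
  assumes "full_path k m c" "1 \<le> m" "\<sigma> \<in> set c"
  shows "\<sigma> \<in> nc {1..m}"
proof -
  obtain i where i: "i < length c" "\<sigma> = c ! i" using assms(3) by (metis in_set_conv_nth)
  show ?thesis
  proof (cases "Suc i < length c")
    case True
    then have "edge k {1..m} (c ! i) (c ! Suc i)"
      using assms(1) by (auto simp: full_path_def successively_conv_nth)
    then show ?thesis using i by (simp add: edge_def)
  next
    case False
    then have "i = length c - 1" using i(1) by linarith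
    moreover have "c \<noteq> []" using i(1) by auto
    ultimately have "\<sigma> = last c" using i(2) by (simp add: last_conv_nth)
    then show ?thesis using assms(1,2) nc_top[of "{1..m}"] by (simp add: full_path_def)
  qed
qed

lemma full_path_card:
  assumes "full_path k m c" "i < length c"
  shows "card (c ! i) + i = m"
  using assms(2)
proof (induction i)
  case 0
  then have "c ! 0 = singletons {1..m}"
    using assms(1) by (simp add: full_path_def hd_conv_nth)
  then show ?case by (simp add: card_image)
next
  case (Suc i)
  have "edge k {1..m} (c ! i) (c ! Suc i)"
    using assms(1) Suc.prems by (auto simp: full_path_def successively_conv_nth)
  then have "card (c ! i) = Suc (card (c ! Suc i))" by (rule edge_card) simp
  then show ?case using Suc by simp
qed

lemma full_path_length:
  assumes "full_path k m c"
  shows "length c = m"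
proof -
  have ne: "c \<noteq> []" using assms by (simp add: full_path_def)
  then have "card (c ! (length c - 1)) + (length c - 1) = m"
    by (intro full_path_card[OF assms]) simp
  moreover have "c ! (length c - 1) = {{1..m}}"
    using assms ne by (simp add: full_path_def last_conv_nth)
  ultimately show ?thesis using ne by (cases c) auto
qed

lemma singletons_refines:
  assumes "\<sigma> \<in> nc A"
  shows "refines A (singletons A) \<sigma>"
  using nc_Union[OF assms] nc_partition_on[OF assms] partition_on_singletons[of A]
  by (auto simp: refines_def)

lemma refines_top:
  assumes "\<sigma> \<in> nc A" "A \<noteq> {}"
  shows "refines A \<sigma> {A}"
  using nc_subset[OF assms(1)] nc_partition_on[OF assms(1)] partition_on_space[OF assms(2)]
  by (auto simp: refines_def)

text \<open>A maximal chain contains every partition comparable to all its members: the bottom, the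
  top, and the merge which \<open>refines_edge\<close> puts between two neighbours. Conversely a
  full path has one member for each number of blocks, and partitions that are comparable and have
  equally many blocks coincide.\<close>

lemma NC_maximal_chain_iff:
  assumes "1 \<le> m"
  shows "NC_maximal_chain m c \<longleftrightarrow> full_path m m c"
proof
  assume mc: "NC_maximal_chain m c"
  let ?A = "{1..m}"
  have ne: "?A \<noteq> {}" using assms by auto
  have nc: "\<sigma> \<in> nc ?A" if "\<sigma> \<in> set c" for \<sigma>
    using mc that by (auto simp: NC_maximal_chain_def pred_on.maxchain_def pred_on.chain_def NC_eq_nc)
  have comp: "refines ?A \<sigma> \<tau> \<or> refines ?A \<tau> \<sigma>" if "\<sigma> \<in> set c" "\<tau> \<in> set c" for \<sigma> \<tau>
  proof -
    have "\<sigma> = \<tau> \<or> refines ?A \<sigma> \<tau> \<or> refines ?A \<tau> \<sigma>"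
      using mc that by (auto simp: NC_maximal_chain_def pred_on.maxchain_def pred_on.chain_def)
    then show ?thesis using refines_refl[OF nc_partition_on[OF nc[OF that(1)]]] by blast
  qed
  have max: "\<rho> \<in> set c"
    if r: "\<rho> \<in> nc ?A" "\<And>\<sigma>. \<sigma> \<in> set c \<Longrightarrow> refines ?A \<sigma> \<rho> \<or> refines ?A \<rho> \<sigma>" for \<rho>
  proof (rule ccontr)
    assume "\<rho> \<notin> set c"
    moreover have "pred_on.chain (NC m) (refines ?A) (insert \<rho> (set c))"
      unfolding pred_on.chain_def NC_eq_nc using r nc comp by auto
    ultimately show False
      using mc unfolding NC_maximal_chain_def pred_on.maxchain_def by blast
  qed
  have less: "refines ?A (c ! i) (c ! j)" "c ! i \<noteq> c ! j" if "i < j" "j < length c" for i j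
    using mc sorted_wrt_nth_less[OF _ that] by (auto simp: NC_maximal_chain_def)
  have le: "refines ?A (c ! i) (c ! j)" if "i \<le> j" "j < length c" for i j
    using that less(1)[of i j] refines_refl[OF nc_partition_on[OF nc[OF nth_mem]], of i]
    by (cases "i = j") auto
  have bot: "singletons ?A \<in> set c"
    using singletons_refines nc by (intro max nc_singletons) blast
  have top: "{?A} \<in> set c"
    using refines_top[OF nc ne] by (intro max nc_top[OF ne]) blast
  have cne: "c \<noteq> []" using bot by auto
  have hd: "hd c = singletons ?A"
  proof -
    obtain i where "i < length c" "singletons ?A = c ! i" using bot by (metis in_set_conv_nth)
    then have "refines ?A (c ! 0) (singletons ?A)" using le[of 0 i] by simp
    then have "c ! 0 = singletons ?A"
      using refines_asym singletons_refines[OF nc[OF nth_mem]] cne by blast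
    then show ?thesis using cne by (simp add: hd_conv_nth)
  qed
  have last: "last c = {?A}"
  proof -
    let ?j = "length c - 1"
    obtain i where "i < length c" "{?A} = c ! i" using top by (metis in_set_conv_nth)
    then have "refines ?A {?A} (c ! ?j)" using le[of i ?j] by simp
    moreover have "refines ?A (c ! ?j) {?A}" using refines_top[OF nc[OF nth_mem] ne] cne by simp
    ultimately have "c ! ?j = {?A}" using refines_asym by blast
    then show ?thesis using cne by (simp add: last_conv_nth)
  qed
  have "edge m ?A (c ! i) (c ! Suc i)" if i: "Suc i < length c" for i
  proof -
    have mem: "c ! i \<in> set c" "c ! Suc i \<in> set c" using i by auto
    obtain \<rho> where r: "edge m ?A (c ! i) \<rho>" "refines ?A \<rho> (c ! Suc i)"
      using refines_edge[OF nc[OF mem(1)] nc[OF mem(2)] less[OF lessI i]] .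
    note ir = edge_refines[OF r(1)]
    have "\<rho> \<in> set c"
    proof (rule max[OF edge_nc(2)[OF r(1)]])
      fix \<sigma> assume "\<sigma> \<in> set c"
      then obtain j where j: "j < length c" "\<sigma> = c ! j" by (metis in_set_conv_nth)
      show "refines ?A \<sigma> \<rho> \<or> refines ?A \<rho> \<sigma>"
      proof (cases "j \<le> i")
        case True
        then show ?thesis using refines_trans[OF le[of j i] ir] i j by simp
      next
        case False
        then show ?thesis using refines_trans[OF r(2) le[of "Suc i" j]] j by simp
      qed
    qed
    then obtain j where j: "j < length c" "\<rho> = c ! j" by (metis in_set_conv_nth)
    \<comment> \<open>\<rho> has fewer blocks than \<open>c ! i\<close>, so it stands later in the
      chain; as it also refines the next member, it is that member.\<close>
    have "card (c ! i) = Suc (card \<rho>)" by (rule edge_card[OF r(1)]) simp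
    then have "\<not> refines ?A \<rho> (c ! i)" using refines_asym[OF ir] by auto
    then have "\<not> j \<le> i" using le[of j i] i j(2) by auto
    then have "refines ?A (c ! Suc i) \<rho>" using le[of "Suc i" j] j by simp
    then have "\<rho> = c ! Suc i" using refines_asym[OF r(2)] by simp
    then show ?thesis using r(1) by simp
  qed
  then show "full_path m m c"
    using cne hd last by (simp add: full_path_def successively_conv_nth)
next
  let ?A = "{1..m}"
  assume fp: "full_path m m c"
  have nc: "\<sigma> \<in> nc ?A" if "\<sigma> \<in> set c" for \<sigma> by (rule full_path_nc[OF fp assms that])
  let ?Q = "\<lambda>\<sigma> \<tau>. refines ?A \<sigma> \<tau> \<and> card \<tau> < card \<sigma>"
  have "transp ?Q" by (auto intro!: transpI intro: refines_trans)
  moreover have "successively ?Q c"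
    using fp edge_refines edge_card[of m ?A] unfolding full_path_def
    by (auto elim!: successively_mono)
  ultimately have Q: "sorted_wrt ?Q c" by (simp add: successively_conv_sorted_wrt)
  then have sorted: "sorted_wrt (\<lambda>\<sigma> \<tau>. refines ?A \<sigma> \<tau> \<and> \<sigma> \<noteq> \<tau>) c"
    by (rule sorted_wrt_mono_rel[rotated]) auto
  have "pred_on.chain (NC m) (refines ?A) (set c)"
    unfolding pred_on.chain_def NC_eq_nc
  proof (intro conjI subsetI ballI)
    show "\<sigma> \<in> nc ?A" if "\<sigma> \<in> set c" for \<sigma> by (rule nc[OF that])
    fix \<sigma> \<tau> assume "\<sigma> \<in> set c" "\<tau> \<in> set c"
    then obtain i j where "i < length c" "\<sigma> = c ! i" "j < length c" "\<tau> = c ! j"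
      by (metis in_set_conv_nth)
    then show "(refines ?A)\<^sup>=\<^sup>= \<sigma> \<tau> \<or> (refines ?A)\<^sup>=\<^sup>= \<tau> \<sigma>"
      using sorted_wrt_nth_less[OF Q, of i j] sorted_wrt_nth_less[OF Q, of j i]
      by (cases i j rule: linorder_cases) auto
  qed
  moreover have "\<not> (pred_on.chain (NC m) (refines ?A) S \<and> set c \<subset> S)" for S
  proof
    assume S: "pred_on.chain (NC m) (refines ?A) S \<and> set c \<subset> S"
    then obtain \<rho> where r: "\<rho> \<in> S" "\<rho> \<notin> set c" by blast
    have rn: "\<rho> \<in> nc ?A" using S r(1) by (auto simp: pred_on.chain_def NC_eq_nc)
    have "\<rho> \<noteq> {}" using nc_Union[OF rn] assms by auto
    then have "1 \<le> card \<rho>" using nc_finite[OF _ rn] by (simp add: card_gt_0_iff Suc_le_eq)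
    moreover have len: "length c = m" by (rule full_path_length[OF fp])
    moreover have "card \<rho> \<le> m"
      using refines_card[OF nc_singletons rn singletons_refines[OF rn]] by (simp add: card_image)
    ultimately have i: "m - card \<rho> < length c" "card (c ! (m - card \<rho>)) = card \<rho>"
      using full_path_card[OF fp, of "m - card \<rho>"] by auto
    let ?\<tau> = "c ! (m - card \<rho>)"
    have t: "?\<tau> \<in> set c" using i(1) by simp
    have "?\<tau> = \<rho> \<or> refines ?A ?\<tau> \<rho> \<or> refines ?A \<rho> ?\<tau>"
      using S r(1) t by (auto simp: pred_on.chain_def)
    then have "?\<tau> = \<rho>"
      using refines_card[OF nc[OF t] rn] refines_card[OF rn nc[OF t]] i(2) by auto
    then show False using r(2) t by simp
  qed
  ultimately show "NC_maximal_chain m c"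
    using sorted by (auto simp: NC_maximal_chain_def pred_on.maxchain_def)
qed

text \<open>The lost minima \<open>e i\<close> and the labels \<open>l i\<close> of the chain are
  fed into \<open>PF_iff\<close>, whose conditions are then read step by step as
  \<open>allowed\<close>.\<close>

lemma chain_labels_in_PF_iff:
  assumes "1 < k" "k \<le> n" "full_path (n + 1) (n + 1) c"
  shows "chain_labels c \<in> PF n k \<longleftrightarrow> full_path k (n + 1) c"
proof -
  let ?A = "{1..n + 1}"
  have len: "length c = n + 1" by (rule full_path_length[OF assms(3)])
  have edge: "edge (n + 1) ?A (c ! i) (c ! Suc i)" if "i < n" for i
    using assms(3) that len by (auto simp: full_path_def successively_conv_nth)
  have "\<forall>i<n. \<exists>B C. merges (c ! i) (c ! Suc i) B C"
    using edge unfolding edge_iff_merges by blast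
  then obtain B C where BC: "\<And>i. i < n \<Longrightarrow> merges (c ! i) (c ! Suc i) (B i) (C i)"
    by metis
  have nc: "c ! i \<in> nc ?A" if "i < n" for i using edge_nc(1)[OF edge[OF that]] .
  define e where "e = (\<lambda>i. Min (C i))"
  define l where "l = (\<lambda>i. cover_label (c ! i) (c ! Suc i))"
  have mins: "Min ` (c ! Suc i) = Min ` (c ! i) - {e i}" if "i < n" for i
    unfolding e_def by (rule merges_mins[OF nc[OF that] _ BC[OF that]]) simp
  have e_mem: "e i \<in> Min ` (c ! i)" if "i < n" for i
    using BC[OF that] by (auto simp: merges_def e_def)
  have anti: "Min ` (c ! j) \<subseteq> Min ` (c ! i)" if "i \<le> j" "j \<le> n" for i j
    using that
  proof (induction j rule: dec_induct)
    case (step j)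
    then show ?case using mins[of j] by auto
  qed simp
  have label: "l i \<in> B i" "1 \<le> l i" "l i < e i" "\<And>x. x \<in> B i \<Longrightarrow> x < e i \<Longrightarrow> x \<le> l i"
    if "i < n" for i
    using cover_label_props[OF nc[OF that] BC[OF that]] by (auto simp: l_def e_def)
  have "inj_on e {..<n}"
  proof (rule linorder_inj_onI)
    fix i j assume "i < j" "i \<in> {..<n}" "j \<in> {..<n}"
    then have "e j \<in> Min ` (c ! Suc i)" "e i \<notin> Min ` (c ! Suc i)"
      using e_mem[of j] anti[of "Suc i" j] mins[of i] by auto
    then show "e i \<noteq> e j" by metis
  qed auto
  \<comment> \<open>The number 1 is never lost, because a positive label lies below the lost
    minimum. The \<open>n\<close> steps therefore exhaust {2..n + 1}.\<close>
  moreover have "e ` {..<n} \<subseteq> {2..n + 1}"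
  proof
    fix v assume "v \<in> e ` {..<n}"
    then obtain i where i: "i < n" "v = e i" by auto
    have "hd c = singletons ?A" "c \<noteq> []" using assms(3) unfolding full_path_def by blast+
    then have "c ! 0 = singletons ?A" by (metis hd_conv_nth)
    then have "Min ` (c ! 0) = ?A" by (simp add: image_image)
    then have "v \<in> ?A" using e_mem[OF i(1)] anti[of 0 i] i by auto
    then show "v \<in> {2..n + 1}" using label(2,3)[OF i(1)] i(2) by auto
  qed
  ultimately have bij: "bij_betw e {..<n} {2..n + 1}"
    unfolding bij_betw_def by (intro conjI card_subset_eq) (auto simp: card_image)
  have "chain_labels c = map l [0..<n]"
    by (simp add: chain_labels_def l_def len)
  then have "chain_labels c \<in> PF n k \<longleftrightarrow>
      (\<forall>i<n. (k + 1 < e i \<longrightarrow> l i = e i - 1) \<and> (e i = k + 1 \<longrightarrow> l i \<noteq> k))"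
    using PF_iff[OF assms(1,2) bij label(2,3)] by simp
  also have "\<dots> \<longleftrightarrow> (\<forall>i<n. allowed k (B i) (e i))"
  proof -
    have "l i = e i - 1 \<longleftrightarrow> e i - 1 \<in> B i" if "i < n" for i
      using label(1,3)[OF that] label(4)[OF that, of "e i - 1"] by (cases "e i") auto
    moreover have "l i \<noteq> k \<longleftrightarrow> k \<notin> B i" if "i < n" "e i = k + 1" for i
      using label(1,3)[OF that(1)] label(4)[OF that(1), of k] that(2) by auto
    ultimately show ?thesis unfolding allowed_def by blast
  qed
  also have "\<dots> \<longleftrightarrow> (\<forall>i<n. edge k ?A (c ! i) (c ! Suc i))"
  proof -
    have "allowed k (B i) (e i) \<longleftrightarrow> edge k ?A (c ! i) (c ! Suc i)" if "i < n" for i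
      using edge_nc[OF edge[OF that]] BC[OF that] merges_unique[OF nc[OF that] BC[OF that]]
      unfolding edge_iff_merges e_def by metis
    then show ?thesis by blast
  qed
  also have "\<dots> \<longleftrightarrow> full_path k (n + 1) c"
    using assms(3) len by (auto simp: full_path_def successively_conv_nth)
  finally show ?thesis .
qed

lemma chains_of_PF:
  assumes "1 < k" "k \<le> n"
  shows "chains_of n (PF n k) = {c. full_path k (n + 1) c}"
proof -
  have "full_path (n + 1) (n + 1) c" if c: "full_path k (n + 1) c" for c
  proof -
    have "edge (n + 1) {1..n + 1} \<sigma> \<tau>" if e: "edge k {1..n + 1} \<sigma> \<tau>" for \<sigma> \<tau>
    proof -
      obtain B C where BC: "merges \<sigma> \<tau> B C" using e unfolding edge_iff_merges by blast
      then have "C \<in> \<sigma>" by (simp add: merges_def)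
      then have "finite C" "C \<noteq> {}" "C \<subseteq> {1..n + 1}"
        using nc_finite_block[OF _ edge_nc(1)[OF e]] nc_nonempty[OF edge_nc(1)[OF e]]
          nc_subset[OF edge_nc(1)[OF e]] by auto
      then have "Min C \<le> n + 1" using Min_in by fastforce
      then show ?thesis
        using edge_nc[OF e] BC allowed_le unfolding edge_iff_merges by blast
    qed
    then show ?thesis using c by (auto simp: full_path_def elim: successively_mono)
  qed
  then show ?thesis
    unfolding chains_of_def
    using NC_maximal_chain_iff[of "n + 1"] chain_labels_in_PF_iff[OF assms] by auto
qed

section \<open>Elements and edges of the poset\<close>

lemma successively_imp_rtranclp:
  "successively R xs \<Longrightarrow> xs \<noteq> [] \<Longrightarrow> R\<^sup>*\<^sup>* (hd xs) (last xs)"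
proof (induction xs rule: induct_list012)
  case (3 x y zs)
  then have "R x y" "R\<^sup>*\<^sup>* y (last (y # zs))" by auto
  then have "R\<^sup>*\<^sup>* x (last (y # zs))" by (rule converse_rtranclp_into_rtranclp)
  then show ?case by simp
qed auto

lemma rtranclp_imp_successively:
  assumes "R\<^sup>*\<^sup>* x y"
  obtains xs where "xs \<noteq> []" "hd xs = x" "last xs = y" "successively R xs"
proof -
  have "\<exists>xs. xs \<noteq> [] \<and> hd xs = x \<and> last xs = y \<and> successively R xs"
    using assms
  proof (induction rule: rtranclp_induct)
    case base
    show ?case by (rule exI[of _ "[x]"]) simp
  next
    case (step y z)
    then obtain xs where "xs \<noteq> [] \<and> hd xs = x \<and> last xs = y \<and> successively R xs" by blast
    then show ?case
      using step(2) by (intro exI[of _ "xs @ [z]"]) (auto simp: successively_append_iff)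
  qed
  then show thesis using that by blast
qed

lemma full_path_conn:
  assumes "full_path k m c" "\<sigma> \<in> set c"
  shows "conn k {1..m} \<sigma>"
proof -
  obtain ys zs where c: "c = ys @ \<sigma> # zs" using assms(2) by (metis split_list)
  have "successively (edge k {1..m}) (ys @ [\<sigma>])" "successively (edge k {1..m}) (\<sigma> # zs)"
    using assms(1) unfolding full_path_def c by (auto simp: successively_append_iff)
  from successively_imp_rtranclp[OF this(1)] successively_imp_rtranclp[OF this(2)]
  show ?thesis
    using assms(1) unfolding conn_def full_path_def c by (cases ys) auto
qed

text \<open>Concatenate a path up to \<sigma>, the edge, and a path from \<tau>. Hence every
  admissible merge between two elements of the poset is one of its edges, and chains of merges found
  inside the carrier need no further check.\<close>

lemma conn_full_path:
  assumes "conn k {1..m} \<sigma>" "conn k {1..m} \<tau>" "edge k {1..m} \<sigma> \<tau>"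
  obtains c i where "full_path k m c" "Suc i < length c" "\<sigma> = c ! i" "\<tau> = c ! Suc i"
proof -
  obtain xs where xs: "xs \<noteq> []" "hd xs = singletons {1..m}" "last xs = \<sigma>" "successively (edge k {1..m}) xs"
    using assms(1) rtranclp_imp_successively unfolding conn_def by metis
  obtain ys where ys: "ys \<noteq> []" "hd ys = \<tau>" "last ys = {{1..m}}" "successively (edge k {1..m}) ys"
    using assms(2) rtranclp_imp_successively unfolding conn_def by metis
  show thesis
  proof (rule that[of "xs @ ys" "length xs - 1"])
    show "full_path k m (xs @ ys)"
      using xs ys assms(3) by (simp add: full_path_def successively_append_iff)
    show "Suc (length xs - 1) < length (xs @ ys)" using xs(1) ys(1) by simp
    show "\<sigma> = (xs @ ys) ! (length xs - 1)" using xs(1,3) by (simp add: nth_append last_conv_nth)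
    show "\<tau> = (xs @ ys) ! Suc (length xs - 1)" using xs(1) ys(1,2) by (simp add: nth_append hd_conv_nth)
  qed
qed

lemma Poset_carrier_PF:
  assumes "1 < k" "k \<le> n"
  shows "Poset_carrier n (PF n k) = {\<sigma>. conn k {1..n + 1} \<sigma>}"
proof (intro equalityI subsetI)
  fix \<sigma> assume "\<sigma> \<in> Poset_carrier n (PF n k)"
  then show "\<sigma> \<in> {\<sigma>. conn k {1..n + 1} \<sigma>}"
    unfolding Poset_carrier_def chains_of_PF[OF assms] using full_path_conn by blast
next
  fix \<sigma> assume "\<sigma> \<in> {\<sigma>. conn k {1..n + 1} \<sigma>}"
  then have c: "(edge k {1..n + 1})\<^sup>*\<^sup>* (singletons {1..n + 1}) \<sigma>" "(edge k {1..n + 1})\<^sup>*\<^sup>* \<sigma> {{1..n + 1}}"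
    by (auto simp: conn_def)
  obtain xs where xs: "xs \<noteq> []" "hd xs = singletons {1..n + 1}" "last xs = \<sigma>" "successively (edge k {1..n + 1}) xs"
    using rtranclp_imp_successively[OF c(1)] .
  obtain ys where ys: "ys \<noteq> []" "hd ys = \<sigma>" "last ys = {{1..n + 1}}" "successively (edge k {1..n + 1}) ys"
    using rtranclp_imp_successively[OF c(2)] .
  obtain zs where zs: "ys = \<sigma> # zs" using ys(1,2) by (cases ys) simp_all
  have "last (xs @ zs) = {{1..n + 1}}"
    using xs(1,3) ys(3) unfolding zs by (cases "zs = []") simp_all
  moreover have "successively (edge k {1..n + 1}) (xs @ zs)"
    using xs(3,4) ys(4) unfolding zs successively_append_iff successively_Cons by auto
  ultimately have "full_path k (n + 1) (xs @ zs)"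
    unfolding full_path_def using xs(1,2) by simp
  moreover have "\<sigma> \<in> set (xs @ zs)" using xs(1,3) by auto
  ultimately show "\<sigma> \<in> Poset_carrier n (PF n k)"
    unfolding Poset_carrier_def chains_of_PF[OF assms] by blast
qed

lemma Poset_edges_PF:
  assumes "1 < k" "k \<le> n"
  shows "(\<sigma>, \<tau>) \<in> Poset_edges n (PF n k) \<longleftrightarrow>
    edge k {1..n + 1} \<sigma> \<tau> \<and> conn k {1..n + 1} \<sigma> \<and> conn k {1..n + 1} \<tau>"
proof
  assume "(\<sigma>, \<tau>) \<in> Poset_edges n (PF n k)"
  then obtain c i where "full_path k (n + 1) c" "Suc i < length c" "\<sigma> = c ! i" "\<tau> = c ! Suc i"
    unfolding Poset_edges_def chains_of_PF[OF assms] by auto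
  moreover from this have "edge k {1..n + 1} (c ! i) (c ! Suc i)"
    by (auto simp: full_path_def successively_conv_nth)
  ultimately show "edge k {1..n + 1} \<sigma> \<tau> \<and> conn k {1..n + 1} \<sigma> \<and> conn k {1..n + 1} \<tau>"
    using full_path_conn[of k "n + 1" c] by simp
next
  assume "edge k {1..n + 1} \<sigma> \<tau> \<and> conn k {1..n + 1} \<sigma> \<and> conn k {1..n + 1} \<tau>"
  then show "(\<sigma>, \<tau>) \<in> Poset_edges n (PF n k)"
    unfolding Poset_edges_def chains_of_PF[OF assms] using conn_full_path by blast
qed

theorem theorem2p12:
  fixes n k :: nat
  assumes "1 < k" and "k \<le> n"
  shows "has_symmetric_chain_decomposition
           (Poset_carrier n (PF n k)) (Poset_order n (PF n k)) (Poset_rank n) n"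
proof -
  let ?A = "{1..n + 1}" and ?P = "Poset_carrier n (PF n k)" and ?r = "Poset_order n (PF n k)"
  let ?E = "Poset_edges n (PF n k)"
  note P = Poset_carrier_PF[OF assms] and E = Poset_edges_PF[OF assms]
  have nc: "\<sigma> \<in> nc ?A" if "\<sigma> \<in> ?P" for \<sigma> using that conn_nc by (simp add: P)
  have card_le: "card \<sigma> \<le> n + 1" if "\<sigma> \<in> ?P" for \<sigma>
    using refines_card[OF nc_singletons nc[OF that] singletons_refines[OF nc[OF that]]]
    by (simp add: card_image)
  have E_card: "card \<sigma> = Suc (card \<tau>)" if "(\<sigma>, \<tau>) \<in> ?E" for \<sigma> \<tau>
    using that edge_card[of k ?A \<sigma> \<tau>] by (simp add: E)
  have E_rank: "Poset_rank n \<tau> = Suc (Poset_rank n \<sigma>)" if "(\<sigma>, \<tau>) \<in> ?E" for \<sigma> \<tau>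
    using E_card[OF that] card_le[of \<sigma>] that by (simp add: Poset_rank_def P E)
  have E_P: "\<sigma> \<in> ?P" "\<tau> \<in> ?P" if "(\<sigma>, \<tau>) \<in> ?E" for \<sigma> \<tau>
    using that by (simp_all add: P E)
  have star_card: "card \<tau> \<le> card \<sigma> \<and> (card \<tau> = card \<sigma> \<longrightarrow> \<sigma> = \<tau>)" if "(\<sigma>, \<tau>) \<in> ?E\<^sup>*" for \<sigma> \<tau>
    using that
  proof (induction rule: rtrancl_induct)
    case (step \<rho> \<tau>)
    then show ?case using E_card[OF step.hyps(2)] by linarith
  qed simp
  have r_iff: "(\<sigma>, \<tau>) \<in> ?r \<longleftrightarrow> (\<sigma>, \<tau>) \<in> ?E\<^sup>* \<and> \<sigma> \<in> ?P \<and> \<tau> \<in> ?P" for \<sigma> \<tau>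
    by (auto simp: Poset_order_def)
  \<comment> \<open>An edge lowers the number of blocks by exactly one, so nothing fits strictly
    between its ends; a covering pair is joined by a sequence of edges, of which the first must be
    the only one.\<close>
  have covers: "poset_covers ?P ?r \<sigma> \<tau> \<longleftrightarrow> (\<sigma>, \<tau>) \<in> ?E" for \<sigma> \<tau>
  proof
    assume c: "poset_covers ?P ?r \<sigma> \<tau>"
    then have "(\<sigma>, \<tau>) \<in> ?E\<^sup>*" "\<sigma> \<noteq> \<tau>" by (auto simp: poset_covers_def r_iff)
    then obtain \<rho> where \<rho>: "(\<sigma>, \<rho>) \<in> ?E" "(\<rho>, \<tau>) \<in> ?E\<^sup>*" by (metis converse_rtranclE)
    then have "\<rho> \<in> ?P" "(\<sigma>, \<rho>) \<in> ?r" "(\<rho>, \<tau>) \<in> ?r" "\<rho> \<noteq> \<sigma>"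
      using E_P[OF \<rho>(1)] E_card[OF \<rho>(1)] c by (auto simp: r_iff poset_covers_def)
    then have "\<rho> = \<tau>" using c by (auto simp: poset_covers_def)
    then show "(\<sigma>, \<tau>) \<in> ?E" using \<rho>(1) by simp
  next
    assume e: "(\<sigma>, \<tau>) \<in> ?E"
    have "\<rho> = \<sigma> \<or> \<rho> = \<tau>" if "(\<sigma>, \<rho>) \<in> ?r" "(\<rho>, \<tau>) \<in> ?r" for \<rho>
    proof -
      have "card \<rho> = card \<sigma> \<or> card \<rho> = card \<tau>"
        using star_card[of \<sigma> \<rho>] star_card[of \<rho> \<tau>] that E_card[OF e] by (auto simp: r_iff)
      then show ?thesis using star_card[of \<sigma> \<rho>] star_card[of \<rho> \<tau>] that by (auto simp: r_iff)
    qed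
    then show "poset_covers ?P ?r \<sigma> \<tau>"
      using E_P[OF e] E_card[OF e] e unfolding poset_covers_def r_iff by auto
  qed
  have graded: "graded_poset ?P ?r (Poset_rank n) n"
    unfolding graded_poset_def
  proof (intro conjI ballI impI)
    have "?P \<subseteq> {\<sigma>. partition_on ?A \<sigma>}" using nc nc_partition_on by blast
    then show "finite ?P" by (rule finite_subset) (rule finitely_many_partition_on, simp)
    show "partial_order_on ?P ?r"
      unfolding partial_order_on_def preorder_on_def
    proof (intro conjI)
      show "refl_on ?P ?r" by (auto simp: refl_on_def r_iff)
      show "?r \<subseteq> ?P \<times> ?P" by (auto simp: r_iff)
      show "trans ?r" by (rule transI) (auto simp: r_iff)
      show "antisym ?r"
        by (rule antisymI) (metis r_iff star_card order_antisym)
    qed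
    show "Poset_rank n \<tau> = Suc (Poset_rank n \<sigma>)" if "poset_covers ?P ?r \<sigma> \<tau>" for \<sigma> \<tau>
      using that E_rank covers by blast
    show "Poset_rank n \<sigma> = 0" if s: "\<sigma> \<in> ?P" and min: "\<forall>\<tau>\<in>?P. (\<tau>, \<sigma>) \<in> ?r \<longrightarrow> \<tau> = \<sigma>" for \<sigma>
    proof -
      obtain c where c: "full_path k (n + 1) c" "\<sigma> \<in> set c"
        using s unfolding Poset_carrier_def chains_of_PF[OF assms] by blast
      then obtain i where i: "i < length c" "\<sigma> = c ! i" by (metis in_set_conv_nth)
      \<comment> \<open>The member before \<sigma> on the full path would be a smaller element of
        the poset, so a minimal \<sigma> stands at the bottom of the path.\<close>
      have "i = 0"
      proof (rule ccontr)
        assume "i \<noteq> 0"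
        then have e: "(c ! (i - 1), \<sigma>) \<in> ?E"
          unfolding Poset_edges_def chains_of_PF[OF assms] using c(1) i
          by (auto intro!: exI[of _ c] exI[of _ "i - 1"])
        then have "c ! (i - 1) = \<sigma>" using min E_P[OF e] by (auto simp: r_iff)
        then show False using E_card[OF e] by simp
      qed
      then show ?thesis
        using full_path_card[OF c(1) i(1)] i(2) by (simp add: Poset_rank_def)
    qed
    show "Poset_rank n \<sigma> = n" if s: "\<sigma> \<in> ?P" and max: "\<forall>\<tau>\<in>?P. (\<sigma>, \<tau>) \<in> ?r \<longrightarrow> \<tau> = \<sigma>" for \<sigma>
    proof -
      obtain c where c: "full_path k (n + 1) c" "\<sigma> \<in> set c"
        using s unfolding Poset_carrier_def chains_of_PF[OF assms] by blast
      then obtain i where i: "i < length c" "\<sigma> = c ! i" by (metis in_set_conv_nth)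
      have "\<not> Suc i < length c"
      proof
        assume "Suc i < length c"
        then have e: "(\<sigma>, c ! Suc i) \<in> ?E"
          unfolding Poset_edges_def chains_of_PF[OF assms] using c(1) i by auto
        then have "c ! Suc i = \<sigma>" using max E_P[OF e] by (auto simp: r_iff)
        then show False using E_card[OF e] by simp
      qed
      then show ?thesis
        using full_path_card[OF c(1) i(1)] full_path_length[OF c(1)] i by (simp add: Poset_rank_def)
    qed
  qed
  obtain D where D: "partition_on ?P D"
    "\<And>C. C \<in> D \<Longrightarrow> \<exists>xs. set xs = C \<and> sym_list (edge k ?A) card (n + 2) xs"
    using sym_dec_conn[OF assms] unfolding sym_dec_def P[symmetric] by blast
  have "symmetric_chain ?P ?r (Poset_rank n) n C" if C: "C \<in> D" for C
  proof -
    obtain xs where xs: "set xs = C" "sym_list (edge k ?A) card (n + 2) xs" using D(2)[OF C] by blast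
    have CP: "C \<subseteq> ?P" using D(1) C by (auto simp: partition_on_def)
    have ne: "xs \<noteq> []" using xs(2) by (simp add: sym_list_def)
    have "successively (poset_covers ?P ?r) xs"
    proof (rule successively_mono)
      show "successively (edge k ?A) xs" using xs(2) unfolding sym_list_def by blast
      show "poset_covers ?P ?r \<sigma> \<tau>" if "\<sigma> \<in> set xs" "\<tau> \<in> set xs" "edge k ?A \<sigma> \<tau>" for \<sigma> \<tau>
        using that xs(1) CP P unfolding covers E by blast
    qed
    moreover have "Poset_rank n (hd xs) + Poset_rank n (last xs) = n"
    proof -
      have "hd xs \<in> ?P" "last xs \<in> ?P" using ne xs(1) CP by auto
      then have "card (hd xs) \<le> n + 1" "card (last xs) \<le> n + 1" using card_le by auto
      moreover have "card (hd xs) + card (last xs) = n + 2" using xs(2) by (simp add: sym_list_def)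
      ultimately show ?thesis by (simp add: Poset_rank_def)
    qed
    ultimately show ?thesis
      unfolding symmetric_chain_def using ne xs(1) CP by blast
  qed
  then show ?thesis
    unfolding has_symmetric_chain_decomposition_def using graded D(1) by blast
qed

end
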